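(* Let $\mathcal{A}$ be a T-algebra of rank $r$, so that $\mathcal{K}(\mathcal{A})$ is a homogeneous cone of rank $r$, and let $\mathcal{F}$ be a face of $\operatorname{cl}\mathcal{K}(\mathcal{A})$ of rank $s$. Then the conjugate face $\mathcal{F}^\Delta=\mathcal{K}(\mathcal{A})^*\cap\mathcal{F}^\perp$ has rank $r-s$.
   Context: Matrix algebra with involution of rank $r$: a finite-dimensional real (not necessarily associative) algebra $\mathcal{A}=\bigoplus_{i,j=1}^r\mathcal{A}_{ij}$ (direct sum of subspaces) with $\mathcal{A}_{ij}\mathcal{A}_{jk}\subseteq\mathcal{A}_{ik}$ and $\mathcal{A}_{ij}\mathcal{A}_{kl}=\{0\}$ if $j\ne k$, with a linear bijection $*:\mathcal{A}\to\mathcal{A}$ satisfying $a^{**}=a$, $(ab)^*=b^*a^*$, $\mathcal{A}_{ij}^*=\mathcal{A}_{ji}$. Write $a=\sum_{i,j}a_{ij}$ with $a_{ij}\in\mathcal{A}_{ij}$; $b_{lk}^*$ means $(b_{lk})^*$. It is a T-algebra of rank $r$ if: (a1) each $\mathcal{A}_{ii}$ is a subalgebra isomorphic to $\mathbb{R}$, via an algebra isomorphism $\rho_i:\mathcal{A}_{ii}\to\mathbb{R}$; let $e_i\in\mathcal{A}_{ii}$ with $\rho_i(e_i)=1$ and $\operatorname{tr}(a)=\sum_i\rho_i(a_{ii})$; (a2) $e_ia_{ij}=a_{ij}$ and $a_{ji}e_i=a_{ji}$ for all $a,i,j$; (a3) $\operatorname{tr}(ab)=\operatorname{tr}(ba)$;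 (a4) $\operatorname{tr}((ab)c)=\operatorname{tr}(a(bc))$; (a5) $\operatorname{tr}(aa^* )\ge0$ with equality iff $a=0$; (a6) $a_{ij}(b_{jk}c_{kl})=(a_{ij}b_{jk})c_{kl}$ for all $a,b,c$ and $1\le i\le j\le k\le l\le r$; (a7) $a_{ij}(b_{jk}b_{lk}^* )=(a_{ij}b_{jk})b_{lk}^*$ for all $a,b$, $1\le i\le j\le k\le r$ and $1\le l\le k\le r$. The inner product is $\langle a,b\rangle=\operatorname{tr}(ab^* )$. Let $\mathcal{H}(\mathcal{A})=\{a: a^*=a\}$, $\mathcal{T}(\mathcal{A})=\bigoplus_{i\le j}\mathcal{A}_{ij}$, $\mathcal{T}_{++}(\mathcal{A})=\{a\in\mathcal{T}(\mathcal{A}):\rho_i(a_{ii})>0\ \forall i\}$. Set $\mathcal{K}(\mathcal{A})=\{tt^*: t\in\mathcal{T}_{++}(\mathcal{A})\}$, an open convex cone in $\mathcal{H}(\mathcal{A})$. Its dual cone is $\mathcal{K}(\mathcal{A})^*=\{y\in\mathcal{H}(\mathcal{A}):\langle x,y\rangle\ge0\ \forall x\in\mathcal{K}(\mathcal{A})\}$, and $\mathcal{F}^\perp$ is the orthogonal complement of $\mathcal{F}$ in $\mathcal{H}(\mathcal{A})$ under $\langle\cdot,\cdot\rangle$. A face of a convex cone $\mathcal{K}$ is a nonempty convex cone $\mathcal{F}\subseteq\mathcal{K}$ such that $x,y\in\mathcal{K}$, $x+y\in\mathcal{F}$ imply $x,y\in\mathcal{F}$. A convex cone is homogeneous if its group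 of automorphisms (linear bijections of its ambient space, or of its span, preserving the cone) acts transitively on its relative interior. All faces of $\operatorname{cl}\mathcal{K}(\mathcal{A})$ and of $\mathcal{K}(\mathcal{A})^*$ are pointed homogeneous cones. The rank of a pointed homogeneous cone is the rank of the T-algebra $\mathcal{B}$, unique up to isomorphism by a theorem of Vinberg, such that the relative interior of the cone is linearly isomorphic to $\mathcal{K}(\mathcal{B})$ (the cone $\{0\}$ has rank $0$); it is invariant under linear isomorphisms. *)

theory Defs
  imports "HOL-Analysis.Analysis" "HOL-Analysis.Finite_Function_Topology"
begin

(* Raw data of a (not necessarily associative) real algebra graded by index pairs from
   {1..r}.  The algebra is the subspace "carrier_of A" of the ambient type 'a; the values of
   the operations outside this subspace, and of the blocks outside {1..r}, are irrelevant.
   The maps "rho i" belong to the data because (a1) refers to them; nothing depends on a choice,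
   since an algebra isomorphism from block i i onto the reals is unique. *)
record 'a matrix_alg =
  alg_rank :: nat
  block :: "nat \<Rightarrow> nat \<Rightarrow> 'a set"
  amult :: "'a \<Rightarrow> 'a \<Rightarrow> 'a"
  star :: "'a \<Rightarrow> 'a"
  rho :: "nat \<Rightarrow> 'a \<Rightarrow> real"

definition indices :: "'a matrix_alg \<Rightarrow> nat set" where
  "indices A = {1..alg_rank A}"

definition block_family :: "'a::real_vector matrix_alg \<Rightarrow> (nat \<Rightarrow> nat \<Rightarrow> 'a) \<Rightarrow> bool" where
  "block_family A x \<longleftrightarrow>
     (\<forall>i j. if i \<in> indices A \<and> j \<in> indices A then x i j \<in> block A i j else x i j = 0)"

definition family_sum :: "'a::real_vector matrix_alg \<Rightarrow> (nat \<Rightarrow> nat \<Rightarrow> 'a) \<Rightarrow> 'a" where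
  "family_sum A x = (\<Sum>i\<in>indices A. \<Sum>j\<in>indices A. x i j)"

definition carrier_of :: "'a::real_vector matrix_alg \<Rightarrow> 'a set" where
  "carrier_of A = {family_sum A x | x. block_family A x}"

(* component A a i j is a_ij; it is determined by a when the sum of the blocks is direct. *)
definition component :: "'a::real_vector matrix_alg \<Rightarrow> 'a \<Rightarrow> nat \<Rightarrow> nat \<Rightarrow> 'a" where
  "component A a = (THE x. block_family A x \<and> family_sum A x = a)"

definition linear_map_on ::
  "'a::real_vector set \<Rightarrow> ('a \<Rightarrow> 'b::real_vector) \<Rightarrow> bool" where
  "linear_map_on S f \<longleftrightarrow>
     (\<forall>x\<in>S. \<forall>y\<in>S. f (x + y) = f x + f y) \<and> (\<forall>c. \<forall>x\<in>S. f (c *\<^sub>R x) = c *\<^sub>R f x)"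

definition matrix_algebra_with_involution :: "'a::real_vector matrix_alg \<Rightarrow> bool" where
  "matrix_algebra_with_involution A \<longleftrightarrow>
     (\<forall>i\<in>indices A. \<forall>j\<in>indices A. subspace (block A i j)) \<and>
     (\<exists>S. finite S \<and> carrier_of A \<subseteq> span S) \<and>
     (\<forall>x y. block_family A x \<and> block_family A y \<and> family_sum A x = family_sum A y \<longrightarrow> x = y) \<and>
     (\<forall>a\<in>carrier_of A. \<forall>b\<in>carrier_of A. amult A a b \<in> carrier_of A) \<and>
     (\<forall>a\<in>carrier_of A. linear_map_on (carrier_of A) (\<lambda>b. amult A a b)) \<and>
     (\<forall>b\<in>carrier_of A. linear_map_on (carrier_of A) (\<lambda>a. amult A a b)) \<and>
     (\<forall>i\<in>indices A. \<forall>j\<in>indices A. \<forall>k\<in>indices A.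
        \<forall>a\<in>block A i j. \<forall>b\<in>block A j k. amult A a b \<in> block A i k) \<and>
     (\<forall>i\<in>indices A. \<forall>j\<in>indices A. \<forall>k\<in>indices A. \<forall>l\<in>indices A. j \<noteq> k \<longrightarrow>
        (\<forall>a\<in>block A i j. \<forall>b\<in>block A k l. amult A a b = 0)) \<and>
     bij_betw (star A) (carrier_of A) (carrier_of A) \<and>
     linear_map_on (carrier_of A) (star A) \<and>
     (\<forall>a\<in>carrier_of A. star A (star A a) = a) \<and>
     (\<forall>a\<in>carrier_of A. \<forall>b\<in>carrier_of A. star A (amult A a b) = amult A (star A b) (star A a)) \<and>
     (\<forall>i\<in>indices A. \<forall>j\<in>indices A. star A ` block A i j = block A j i)"

definition unit_of :: "'a matrix_alg \<Rightarrow> nat \<Rightarrow> 'a" where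
  "unit_of A i = the_inv_into (block A i i) (rho A i) 1"

definition tr :: "'a::real_vector matrix_alg \<Rightarrow> 'a \<Rightarrow> real" where
  "tr A a = (\<Sum>i\<in>indices A. rho A i (component A a i i))"

(* In (a7) both b_jk and b_lk are components of the same element b; in particular they
   coincide when l = j. *)
definition T_algebra :: "'a::real_vector matrix_alg \<Rightarrow> bool" where
  "T_algebra A \<longleftrightarrow> matrix_algebra_with_involution A \<and>
     \<comment> \<open>a1\<close>
     (\<forall>i\<in>indices A. bij_betw (rho A i) (block A i i) UNIV \<and>
        linear_map_on (block A i i) (rho A i) \<and>
        (\<forall>a\<in>block A i i. \<forall>b\<in>block A i i. rho A i (amult A a b) = rho A i a * rho A i b)) \<and>
     \<comment> \<open>a2\<close>
     (\<forall>a\<in>carrier_of A. \<forall>i\<in>indices A. \<forall>j\<in>indices A.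
        amult A (unit_of A i) (component A a i j) = component A a i j \<and>
        amult A (component A a j i) (unit_of A i) = component A a j i) \<and>
     \<comment> \<open>a3\<close>
     (\<forall>a\<in>carrier_of A. \<forall>b\<in>carrier_of A. tr A (amult A a b) = tr A (amult A b a)) \<and>
     \<comment> \<open>a4\<close>
     (\<forall>a\<in>carrier_of A. \<forall>b\<in>carrier_of A. \<forall>c\<in>carrier_of A.
        tr A (amult A (amult A a b) c) = tr A (amult A a (amult A b c))) \<and>
     \<comment> \<open>a5\<close>
     (\<forall>a\<in>carrier_of A. tr A (amult A a (star A a)) \<ge> 0 \<and>
        (tr A (amult A a (star A a)) = 0 \<longleftrightarrow> a = 0)) \<and>
     \<comment> \<open>a6\<close>
     (\<forall>a\<in>carrier_of A. \<forall>b\<in>carrier_of A. \<forall>c\<in>carrier_of A.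
        \<forall>i\<in>indices A. \<forall>j\<in>indices A. \<forall>k\<in>indices A. \<forall>l\<in>indices A.
        i \<le> j \<and> j \<le> k \<and> k \<le> l \<longrightarrow>
          amult A (component A a i j) (amult A (component A b j k) (component A c k l)) =
          amult A (amult A (component A a i j) (component A b j k)) (component A c k l)) \<and>
     \<comment> \<open>a7\<close>
     (\<forall>a\<in>carrier_of A. \<forall>b\<in>carrier_of A.
        \<forall>i\<in>indices A. \<forall>j\<in>indices A. \<forall>k\<in>indices A. \<forall>l\<in>indices A.
        i \<le> j \<and> j \<le> k \<and> l \<le> k \<longrightarrow>
          amult A (component A a i j) (amult A (component A b j k) (star A (component A b l k))) =
          amult A (amult A (component A a i j) (component A b j k)) (star A (component A b l k)))"

definition inner_of :: "'a::real_vector matrix_alg \<Rightarrow> 'a \<Rightarrow> 'a \<Rightarrow> real" where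
  "inner_of A a b = tr A (amult A a (star A b))"

definition hermitian :: "'a::real_vector matrix_alg \<Rightarrow> 'a set" where
  "hermitian A = {a \<in> carrier_of A. star A a = a}"

definition triangular :: "'a::real_vector matrix_alg \<Rightarrow> 'a set" where
  "triangular A = {a \<in> carrier_of A.
     \<forall>i\<in>indices A. \<forall>j\<in>indices A. j < i \<longrightarrow> component A a i j = 0}"

definition triangular_pos :: "'a::real_vector matrix_alg \<Rightarrow> 'a set" where
  "triangular_pos A = {a \<in> triangular A. \<forall>i\<in>indices A. rho A i (component A a i i) > 0}"

definition cone_of :: "'a::real_vector matrix_alg \<Rightarrow> 'a set" where
  "cone_of A = {amult A t (star A t) | t. t \<in> triangular_pos A}"

definition dual_cone :: "'a::real_vector matrix_alg \<Rightarrow> 'a set" where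
  "dual_cone A = {y \<in> hermitian A. \<forall>x\<in>cone_of A. inner_of A x y \<ge> 0}"

definition perp :: "'a::real_vector matrix_alg \<Rightarrow> 'a set \<Rightarrow> 'a set" where
  "perp A F = {y \<in> hermitian A. \<forall>x\<in>F. inner_of A x y = 0}"

definition conjugate_face :: "'a::real_vector matrix_alg \<Rightarrow> 'a set \<Rightarrow> 'a set" where
  "conjugate_face A F = dual_cone A \<inter> perp A F"

(* The library's convex_cone is nonempty and contains 0.  Requiring 0 in F is no restriction for
   a face of a cone C with 0 in C (such as a closed cone): 0 + x = x. *)
definition cone_face :: "'a::real_vector set \<Rightarrow> 'a set \<Rightarrow> bool" where
  "cone_face F C \<longleftrightarrow> convex_cone F \<and> F \<subseteq> C \<and>
     (\<forall>x\<in>C. \<forall>y\<in>C. x + y \<in> F \<longrightarrow> x \<in> F \<and> y \<in> F)"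

(* Linear isomorphism between the linear spans; a linear map on a span extends to the whole space. *)
definition linearly_isomorphic :: "'a::real_vector set \<Rightarrow> 'b::real_vector set \<Rightarrow> bool" where
  "linearly_isomorphic C D \<longleftrightarrow> (\<exists>f. linear f \<and> inj_on f (span C) \<and> f ` C = D)"

(* has_cone_rank C n: the pointed homogeneous cone C has rank n.  The T-algebra B ranges over
   subspaces of the finitely supported real sequences, into which every finite-dimensional real
   vector space embeds, so no T-algebra is lost.  That n is determined by C is Vinberg's uniqueness
   theorem; it is not built into the definition.  The T-algebra with alg_rank 0 is the zero space
   and its cone is {0}, so {0} is the cone of rank 0. *)
definition has_cone_rank :: "'a::real_normed_vector set \<Rightarrow> nat \<Rightarrow> bool" where
  "has_cone_rank C n \<longleftrightarrow>
     (\<exists>B :: (nat \<Rightarrow>\<^sub>0 real) matrix_alg. T_algebra B \<and> alg_rank B = n \<and>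
        linearly_isomorphic (rel_interior C) (cone_of B))"

end

theory Submission
  imports Defs
begin

text \<open>
  The upper triangular part \<open>T\<close> of a T-algebra is an associative unital algebra, and the facial structure
  can be read off from it. For \<open>t\<close> and \<open>u\<close> in \<open>T\<close> the axioms give \<open>\<langle>tt\<^sup>*, u\<^sup>*u\<rangle> = \<bar>ut\<bar>\<^sup>2\<close> (lemma \<open>pairing\<close>).
  A Cholesky elimination turns this pairing into a duality: a Hermitian \<open>y\<close> that pairs nonnegatively with
  all squares \<open>tt\<^sup>*\<close> has the form \<open>u\<^sup>*u\<close> (\<open>cholesky\<close>). Reversing the order of the indices gives
  another T-algebra, so a Hermitian \<open>x\<close> that pairs nonnegatively with all \<open>u\<^sup>*u\<close> has the
  form \<open>tt\<^sup>*\<close> (\<open>cholesky_upper\<close>). Hence the closed cone consists of all \<open>tt\<^sup>*\<close>, the dual cone of all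
  \<open>u\<^sup>*u\<close>, and both are given by explicit linear inequalities.

  The elimination also makes a column of \<open>t\<close> vanish whenever its diagonal entry does. Therefore each point of
  the closed cone can be written as \<open>x = (gE\<^sub>J)(gE\<^sub>J)\<^sup>*\<close> with \<open>g\<close> invertible in \<open>T\<close> and \<open>E\<^sub>J\<close> the sum of the
  diagonal units with index in \<open>J\<close> (\<open>normal_form\<close>). The \<open>u\<close> in \<open>T\<close> with \<open>\<langle>x, u\<^sup>*u\<rangle> = 0\<close> form the left
  annihilator of \<open>gE\<^sub>J\<close>, and \<open>x - \<epsilon>y\<close> stays in the closed cone for some \<open>\<epsilon> > 0\<close> exactly if the annihilator
  of \<open>x\<close> is contained in that of \<open>y\<close> (\<open>dominates_iff_null\<close>). Consequently the face with \<open>x\<close> in its relative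
  interior is the set of all \<open>(gs)(gs)\<^sup>*\<close> with \<open>E\<^sub>Js = s\<close>. The linear map \<open>tt\<^sup>* \<mapsto> (gt)(gt)\<^sup>*\<close> identifies it with
  the closed cone of the T-algebra formed by the blocks with indices in \<open>J\<close>, so its rank is the number of
  elements of \<open>J\<close> (\<open>face_set_rank\<close>). The conjugate face consists of the \<open>u\<^sup>*u\<close> with \<open>ugE\<^sub>J = 0\<close>. Writing
  \<open>u = wg\<^sup>-\<^sup>1\<close> shows that it is a face of the same kind for the reversed T-algebra, with the
  complementary index set (\<open>conjugate_face_reversed\<close>), and its rank is \<open>r\<close> minus the number of elements of \<open>J\<close>.

  It remains to see that a cone cannot have two ranks. The annihilators above are left ideals \<open>Tp\<close> with \<open>p\<close>
  idempotent, the diagonal of \<open>p\<close> consists of zeros and ones, and a strict inclusion of annihilators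
  lowers the number of ones. So the rank is the largest length of a chain of points of the closed
  cone, each dominated by the next but not conversely (\<open>chain_length\<close>, \<open>unit_chain\<close>), and linear isomorphisms
  preserve such chains (\<open>has_cone_rank_unique\<close>).
\<close>

section \<open>Convex cones in finite-dimensional subspaces of normed spaces\<close>

text \<open>
  The distance of \<open>b\<close> from the closed subspace \<open>V\<close> is positive, and its inverse serves as \<open>M\<close>.
\<close>

lemma coordinate_bound:
  fixes b :: "'a::real_normed_vector"
  assumes "subspace V" "closed V" "b \<notin> V"
  shows "\<exists>M>0. \<forall>c. \<forall>s\<in>V. \<bar>c\<bar> \<le> M * norm (c *\<^sub>R b + s)"
proof -
  obtain d where d: "d > 0" "ball b d \<subseteq> - V"
    using assms open_contains_ball[of "- V"] by (auto simp: open_closed)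
  have "\<bar>c\<bar> \<le> (1/d) * norm (c *\<^sub>R b + s)" if s: "s \<in> V" for c s
  proof (cases "c = 0")
    case False
    have "- (1/c) *\<^sub>R s \<in> V" using s assms(1) by (simp add: subspace_scale subspace_neg)
    then have "- (1/c) *\<^sub>R s \<notin> ball b d" using d by blast
    then have "d \<le> norm (b + (1/c) *\<^sub>R s)" by (simp add: dist_norm)
    then have "\<bar>c\<bar> * d \<le> norm (c *\<^sub>R (b + (1/c) *\<^sub>R s))" by (simp add: mult_left_mono)
    also have "c *\<^sub>R (b + (1/c) *\<^sub>R s) = c *\<^sub>R b + s" using False by (simp add: scaleR_add_right)
    finally show ?thesis using d by (simp add: field_simps)
  qed (use d in auto)
  then show ?thesis using d by (intro exI[of _ "1/d"]) auto
qed

text \<open>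
  By induction on the spanning set. Along a convergent sequence the coordinate that belongs to a
  new vector is a Cauchy sequence by \<open>coordinate_bound\<close>, and what remains after subtracting it converges in the
  smaller span.
\<close>

lemma closed_span_finite:
  fixes S :: "'a::real_normed_vector set"
  assumes "finite S" shows "closed (span S)"
  using assms
proof (induction S)
  case (insert b S)
  show ?case
  proof (cases "b \<in> span S")
    case True
    then show ?thesis using insert by (simp add: span_redundant)
  next
    case False
    obtain M where M: "M > 0" "\<And>c s. s \<in> span S \<Longrightarrow> \<bar>c\<bar> \<le> M * norm (c *\<^sub>R b + s)"
      using coordinate_bound[OF subspace_span insert.IH False] by blast
    have "l \<in> span (insert b S)" if xs: "\<And>n. x n \<in> span (insert b S)" and l: "x \<longlonglongrightarrow> l" for x l
    proof -
      have "\<forall>n. \<exists>k. x n - k *\<^sub>R b \<in> span S" using xs by (simp add: span_insert)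
      then obtain k where k: "\<And>n. x n - k n *\<^sub>R b \<in> span S" by metis
      have "Cauchy k"
      proof (rule metric_CauchyI)
        fix e :: real assume "e > 0"
        then obtain N where N: "\<And>m n. m \<ge> N \<Longrightarrow> n \<ge> N \<Longrightarrow> dist (x m) (x n) < e / M"
          using LIMSEQ_imp_Cauchy[OF l] M(1) by (meson metric_CauchyD divide_pos_pos)
        have "dist (k m) (k n) < e" if "m \<ge> N" "n \<ge> N" for m n
        proof -
          have "(x m - k m *\<^sub>R b) - (x n - k n *\<^sub>R b) \<in> span S" using k span_diff by blast
          from M(2)[OF this, of "k m - k n"] have "\<bar>k m - k n\<bar> \<le> M * norm (x m - x n)"
            by (simp add: algebra_simps)
          also have "\<dots> < e" using N[OF that] M(1) by (simp add: dist_norm field_simps)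
          finally show ?thesis by (simp add: dist_real_def)
        qed
        then show "\<exists>N. \<forall>m\<ge>N. \<forall>n\<ge>N. dist (k m) (k n) < e" by blast
      qed
      then obtain c where c: "k \<longlonglongrightarrow> c" using Cauchy_convergent convergent_def by blast
      have "(\<lambda>n. x n - k n *\<^sub>R b) \<longlonglongrightarrow> l - c *\<^sub>R b" by (intro tendsto_intros l c)
      then have "l - c *\<^sub>R b \<in> span S"
        using insert.IH k closed_sequentially[of "span S" "\<lambda>n. x n - k n *\<^sub>R b"] by blast
      then show ?thesis by (auto simp: span_insert)
    qed
    then show ?thesis by (simp add: closed_sequential_limits) blast
  qed
qed simp

lemma linear_functional_bounded_on_span:
  fixes S :: "'a::real_normed_vector set" and l :: "'a \<Rightarrow> real"
  assumes "finite S" "linear l"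
  shows "\<exists>M. \<forall>x\<in>span S. \<bar>l x\<bar> \<le> M * norm x"
  using assms(1)
proof (induction S)
  case empty
  then show ?case using linear_0[OF assms(2)] by auto
next
  case (insert b S)
  show ?case
  proof (cases "b \<in> span S")
    case True
    then show ?thesis using insert by (simp add: span_redundant)
  next
    case False
    obtain M where M: "M > 0" "\<And>c s. s \<in> span S \<Longrightarrow> \<bar>c\<bar> \<le> M * norm (c *\<^sub>R b + s)"
      using coordinate_bound[OF subspace_span closed_span_finite[OF insert.hyps(1)] False] by blast
    obtain L where L: "\<And>x. x \<in> span S \<Longrightarrow> \<bar>l x\<bar> \<le> L * norm x" using insert.IH by blast
    have "\<bar>l x\<bar> \<le> (M * \<bar>l b\<bar> + \<bar>L\<bar> * (1 + M * norm b)) * norm x" if x: "x \<in> span (insert b S)" for x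
    proof -
      obtain c where c: "x - c *\<^sub>R b \<in> span S" using x unfolding span_insert by blast
      have cb: "\<bar>c\<bar> \<le> M * norm x" using M(2)[OF c, of c] by simp
      have "l x = c * l b + l (x - c *\<^sub>R b)"
        using assms(2) by (simp add: linear_diff linear_scale)
      also have "\<bar>\<dots>\<bar> \<le> \<bar>c\<bar> * \<bar>l b\<bar> + \<bar>l (x - c *\<^sub>R b)\<bar>" by (simp add: abs_mult[symmetric] abs_triangle_ineq)
      finally have 1: "\<bar>l x\<bar> \<le> \<bar>c\<bar> * \<bar>l b\<bar> + \<bar>l (x - c *\<^sub>R b)\<bar>" .
      have "norm (x - c *\<^sub>R b) \<le> norm x + \<bar>c\<bar> * norm b"
        by (metis norm_scaleR norm_triangle_ineq4)
      also have "\<bar>c\<bar> * norm b \<le> M * norm x * norm b" using cb by (simp add: mult_right_mono)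
      finally have "\<bar>L\<bar> * norm (x - c *\<^sub>R b) \<le> \<bar>L\<bar> * (norm x + M * norm x * norm b)"
        by (simp add: mult_left_mono)
      moreover have "\<bar>l (x - c *\<^sub>R b)\<bar> \<le> \<bar>L\<bar> * norm (x - c *\<^sub>R b)"
        using L[OF c] by (rule order_trans) (simp add: mult_right_mono)
      moreover have "\<bar>c\<bar> * \<bar>l b\<bar> \<le> M * norm x * \<bar>l b\<bar>" using cb by (simp add: mult_right_mono)
      ultimately have "\<bar>l x\<bar> \<le> M * norm x * \<bar>l b\<bar> + \<bar>L\<bar> * (norm x + M * norm x * norm b)"
        using 1 by linarith
      then show ?thesis by (simp add: algebra_simps)
    qed
    then show ?thesis by blast
  qed
qed

lemma closed_halfspace_in_span:
  fixes S :: "'a::real_normed_vector set" and l :: "'a \<Rightarrow> real"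
  assumes "finite S" "linear l"
  shows "closed {x \<in> span S. l x \<ge> 0}"
proof -
  obtain M where M: "\<And>x. x \<in> span S \<Longrightarrow> \<bar>l x\<bar> \<le> M * norm x"
    using linear_functional_bounded_on_span[OF assms] by blast
  have "continuous_on (span S) l"
  proof (rule lipschitz_on_continuous_on[of "\<bar>M\<bar>"], rule lipschitz_onI)
    fix x y assume "x \<in> span S" "y \<in> span S"
    then have "\<bar>l (x - y)\<bar> \<le> M * norm (x - y)" by (simp add: M span_diff)
    also have "\<dots> \<le> \<bar>M\<bar> * norm (x - y)" by (simp add: mult_right_mono)
    finally show "dist (l x) (l y) \<le> \<bar>M\<bar> * dist x y"
      by (simp add: dist_norm linear_diff[OF assms(2)])
  qed simp
  from continuous_closed_preimage[OF this closed_span_finite[OF assms(1)], of "{0..}"]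
  show ?thesis by (simp add: vimage_def Int_def)
qed

text \<open>
  For a convex cone with finite-dimensional span this is the relative interior
  (\<open>rel_interior_convex_cone\<close>). The description is free of topology, so linear isomorphisms
  carry it along without any continuity argument.
\<close>

definition cone_core :: "'a::real_vector set \<Rightarrow> 'a set" where
  "cone_core S = {x \<in> S. \<forall>v\<in>S. \<exists>\<epsilon>>0. x - \<epsilon> *\<^sub>R v \<in> S}"

text \<open>
  A small \<open>y\<close> in the span of \<open>insert b D\<close> is split as \<open>cb + v\<close>, where \<open>c\<close> is small by \<open>coordinate_bound\<close>;
  then \<open>x + y\<close> is the midpoint of \<open>x + 2cb\<close> and \<open>x + 2v\<close>.
\<close>

lemma cone_core_ball:
  fixes S :: "'a::real_normed_vector set"
  assumes S: "convex_cone S" and x: "x \<in> cone_core S" and D: "finite D" "D \<subseteq> S"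
  shows "\<exists>\<delta>>0. \<forall>y\<in>span D. norm y < \<delta> \<longrightarrow> x + y \<in> S"
  using D
proof (induction D)
  case empty
  then show ?case using x by (auto simp: cone_core_def intro: exI[of _ 1])
next
  case (insert b D)
  then obtain d where d: "d > 0" "\<And>y. y \<in> span D \<Longrightarrow> norm y < d \<Longrightarrow> x + y \<in> S" by auto
  show ?case
  proof (cases "b \<in> span D")
    case True
    then show ?thesis using insert by (simp add: span_redundant)
  next
    case False
    obtain M where M: "M > 0" "\<And>c s. s \<in> span D \<Longrightarrow> \<bar>c\<bar> \<le> M * norm (c *\<^sub>R b + s)"
      using coordinate_bound[OF subspace_span closed_span_finite[OF insert.hyps(1)] False] by blast
    obtain e where e: "e > 0" "x - e *\<^sub>R b \<in> S" using x insert.prems by (auto simp: cone_core_def)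
    have b: "b \<in> S" "x \<in> S" using insert.prems x by (auto simp: cone_core_def)
    have xb: "x + c *\<^sub>R b \<in> S" if "\<bar>c\<bar> \<le> e" for c
    proof -
      have "(x - e *\<^sub>R b) + (e + c) *\<^sub>R b \<in> S"
        using that by (intro convex_cone_add[OF S] convex_cone_scaleR[OF S] e b) auto
      then show ?thesis by (simp add: algebra_simps)
    qed
    define \<delta> where "\<delta> = min (e / (2*M)) (d / (2 * (1 + M * norm b)))"
    have pos: "1 + M * norm b > 0" using M by (simp add: add_pos_nonneg)
    have "\<delta> > 0" using e d M pos by (simp add: \<delta>_def)
    moreover have "x + y \<in> S" if y: "y \<in> span (insert b D)" "norm y < \<delta>" for y
    proof -
      obtain c where c: "y - c *\<^sub>R b \<in> span D" using y unfolding span_insert by blast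
      have cb: "\<bar>c\<bar> \<le> M * norm y" using M(2)[OF c, of c] by simp
      have "M * norm y < M * (e / (2*M))" using y M by (intro mult_strict_left_mono) (auto simp: \<delta>_def)
      then have "\<bar>2 * c\<bar> \<le> e" using cb M by simp
      then have 1: "x + (2*c) *\<^sub>R b \<in> S" by (rule xb)
      have "norm (y - c *\<^sub>R b) \<le> norm y + \<bar>c\<bar> * norm b" by (metis norm_scaleR norm_triangle_ineq4)
      also have "\<dots> \<le> norm y + M * norm y * norm b" using cb by (simp add: mult_right_mono)
      also have "\<dots> = (1 + M * norm b) * norm y" by (simp add: algebra_simps)
      also have "\<dots> < (1 + M * norm b) * (d / (2 * (1 + M * norm b)))"
        using y pos by (intro mult_strict_left_mono) (auto simp: \<delta>_def)
      also have "\<dots> = d / 2" using pos by (simp add: field_simps)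
      finally have "norm (2 *\<^sub>R (y - c *\<^sub>R b)) < d" by simp
      then have 2: "x + 2 *\<^sub>R (y - c *\<^sub>R b) \<in> S" using d(2) span_scale[OF c] by blast
      have "(1/2) *\<^sub>R (x + (2*c) *\<^sub>R b) + (1/2) *\<^sub>R (x + 2 *\<^sub>R (y - c *\<^sub>R b)) \<in> S"
        by (intro convex_cone_add[OF S] convex_cone_scaleR[OF S] 1 2) auto
      also have "(1/2) *\<^sub>R (x + (2*c) *\<^sub>R b) + (1/2) *\<^sub>R (x + 2 *\<^sub>R (y - c *\<^sub>R b)) = x + y"
        by (simp add: algebra_simps flip: scaleR_add_left)
      finally show ?thesis .
    qed
    ultimately show ?thesis by blast
  qed
qed

lemma rel_interior_convex_cone:
  fixes S :: "'a::real_normed_vector set"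
  assumes S: "convex_cone S" and fin: "finite D" "S \<subseteq> span D"
  shows "rel_interior S = cone_core S"
proof -
  have aff: "affine hull S = span S"
    using convex_cone_contains_0[OF S] by (intro affine_hull_span_0) (simp add: hull_inc)
  obtain B where B: "B \<subseteq> S" "independent B" "S \<subseteq> span B" by (meson maximal_independent_subset)
  have "finite B" using independent_span_bound[OF fin(1) B(2)] B(1) fin(2) by auto
  have spB: "span B = span S" using B by (meson span_mono span_minimal subspace_span subset_antisym)
  show ?thesis
  proof (intro equalityI subsetI)
    fix x assume "x \<in> rel_interior S"
    then obtain d where d: "x \<in> S" "d > 0" "ball x d \<inter> span S \<subseteq> S"
      unfolding mem_rel_interior_ball aff by blast
    have "\<exists>\<epsilon>>0. x - \<epsilon> *\<^sub>R v \<in> S" if "v \<in> S" for v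
    proof -
      have n: "norm v + 1 > 0" by (simp add: add_nonneg_pos)
      have "d / (norm v + 1) * norm v < d" using d(2) n by (simp add: divide_simps algebra_simps)
      then have "x - (d / (norm v + 1)) *\<^sub>R v \<in> ball x d" using d(2) n by (simp add: dist_norm)
      moreover have "x - (d / (norm v + 1)) *\<^sub>R v \<in> span S"
        using d(1) that by (intro span_diff span_scale span_base)
      ultimately show ?thesis using d n by (meson IntI divide_pos_pos subsetD)
    qed
    then show "x \<in> cone_core S" using d by (simp add: cone_core_def)
  next
    fix x assume x: "x \<in> cone_core S"
    obtain d where d: "d > 0" "\<And>y. y \<in> span S \<Longrightarrow> norm y < d \<Longrightarrow> x + y \<in> S"
      using cone_core_ball[OF S x \<open>finite B\<close> B(1)] spB by auto
    have xS: "x \<in> S" using x by (simp add: cone_core_def)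
    have "y \<in> S" if "y \<in> ball x d \<inter> span S" for y
    proof -
      have "y - x \<in> span S" using that xS by (auto intro: span_diff span_base)
      then show ?thesis using d(2)[of "y - x"] that by (simp add: dist_norm norm_minus_commute)
    qed
    then show "x \<in> rel_interior S" unfolding mem_rel_interior_ball aff using xS d(1) by blast
  qed
qed

section \<open>Matrix algebras with involution\<close>

locale matrix_algebra =
  fixes A :: "'a::real_vector matrix_alg"
  assumes matrix_algebra: "matrix_algebra_with_involution A"
begin

abbreviation I where "I \<equiv> indices A"
abbreviation C where "C \<equiv> carrier_of A"

lemma finite_I [simp]: "finite I"
  by (simp add: indices_def)

lemma matrix_algebra_axioms_unfolded:
  shows ax_subspace: "\<forall>i\<in>I. \<forall>j\<in>I. subspace (block A i j)"
    and ax_finite: "\<exists>S. finite S \<and> C \<subseteq> span S"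
    and ax_direct: "\<forall>x y. block_family A x \<and> block_family A y \<and> family_sum A x = family_sum A y \<longrightarrow> x = y"
    and ax_closed: "\<forall>a\<in>C. \<forall>b\<in>C. amult A a b \<in> C"
    and ax_lin_right: "\<forall>a\<in>C. linear_map_on C (\<lambda>b. amult A a b)"
    and ax_lin_left: "\<forall>b\<in>C. linear_map_on C (\<lambda>a. amult A a b)"
    and ax_block_mul: "\<forall>i\<in>I. \<forall>j\<in>I. \<forall>k\<in>I. \<forall>a\<in>block A i j. \<forall>b\<in>block A j k. amult A a b \<in> block A i k"
    and ax_block_mul_zero: "\<forall>i\<in>I. \<forall>j\<in>I. \<forall>k\<in>I. \<forall>l\<in>I. j \<noteq> k \<longrightarrow>
        (\<forall>a\<in>block A i j. \<forall>b\<in>block A k l. amult A a b = 0)"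
    and ax_star_bij: "bij_betw (star A) C C"
    and ax_star_lin: "linear_map_on C (star A)"
    and ax_star_star: "\<forall>a\<in>C. star A (star A a) = a"
    and ax_star_mul: "\<forall>a\<in>C. \<forall>b\<in>C. star A (amult A a b) = amult A (star A b) (star A a)"
    and ax_star_block: "\<forall>i\<in>I. \<forall>j\<in>I. star A ` block A i j = block A j i"
  by (insert matrix_algebra[unfolded matrix_algebra_with_involution_def]) (elim conjE, assumption)+

lemma subspace_block: "i \<in> I \<Longrightarrow> j \<in> I \<Longrightarrow> subspace (block A i j)"
  using ax_subspace by blast

lemma component_family_sum: "block_family A x \<Longrightarrow> component A (family_sum A x) = x"
  using ax_direct unfolding component_def by (intro the_equality) blast+

lemma carrierI: "block_family A x \<Longrightarrow> family_sum A x \<in> C"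
  by (auto simp: carrier_of_def)

lemma component_carrier:
  assumes "a \<in> C"
  shows "block_family A (component A a)" "family_sum A (component A a) = a"
  using assms component_family_sum by (auto simp: carrier_of_def)

lemma block_family_linear:
  assumes "block_family A x" "block_family A y"
  shows "block_family A (\<lambda>i j. c *\<^sub>R x i j + y i j)"
    "family_sum A (\<lambda>i j. c *\<^sub>R x i j + y i j) = c *\<^sub>R family_sum A x + family_sum A y"
  using assms subspace_block
  by (auto simp: block_family_def family_sum_def sum.distrib scaleR_sum_right subspace_add subspace_scale)

lemma carrier_comb: "a \<in> C \<Longrightarrow> b \<in> C \<Longrightarrow> c *\<^sub>R a + b \<in> C"
  using carrierI[OF block_family_linear(1)[OF component_carrier(1) component_carrier(1), of a b c]]
  by (simp add: block_family_linear(2) component_carrier)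

lemma zero_carrier: "0 \<in> C"
proof -
  have "block_family A (\<lambda>i j. 0)" using subspace_block by (auto simp: block_family_def subspace_0)
  moreover have "family_sum A (\<lambda>i j. 0) = 0" by (simp add: family_sum_def)
  ultimately show ?thesis unfolding carrier_of_def by force
qed

lemma subspace_carrier: "subspace C"
  unfolding subspace_def
  using carrier_comb[where c = 1] carrier_comb[OF _ zero_carrier] zero_carrier by auto

lemma component_comb:
  "a \<in> C \<Longrightarrow> b \<in> C \<Longrightarrow> component A (c *\<^sub>R a + b) i j = c *\<^sub>R component A a i j + component A b i j"
  using component_family_sum[OF block_family_linear(1)[OF component_carrier(1) component_carrier(1), of a b c]]
  by (simp add: block_family_linear(2) component_carrier)

text \<open>
  Composing the operations of the algebra with a linear projection onto the carrier makes them linear on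
  the whole ambient type, so that linear rewriting needs no membership conditions.
\<close>

definition proj :: "'a \<Rightarrow> 'a" where
  "proj = (SOME g. range g \<subseteq> C \<and> linear g \<and> (\<forall>v\<in>C. g v = v))"

lemma proj: "proj a \<in> C" "linear proj" "a \<in> C \<Longrightarrow> proj a = a"
proof -
  have "\<exists>g. g ` UNIV \<subseteq> C \<and> linear g \<and> (\<forall>v\<in>C. g (id v) = v)"
    by (rule linear_exists_left_inverse_on[OF linear_id subspace_carrier]) simp
  then have "range proj \<subseteq> C \<and> linear proj \<and> (\<forall>v\<in>C. proj v = v)"
    unfolding proj_def by (intro someI_ex[of "\<lambda>g. range g \<subseteq> C \<and> linear g \<and> (\<forall>v\<in>C. g v = v)"]) simp
  then show "proj a \<in> C" "linear proj" "a \<in> C \<Longrightarrow> proj a = a" by auto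
qed

definition mul (infixl "\<odot>" 70) where "a \<odot> b = amult A (proj a) (proj b)"
definition str ("_\<^sup>\<star>" [1000] 1000) where "a\<^sup>\<star> = star A (proj a)"
definition entry where "entry i j a = component A (proj a) i j"

lemma mul_carrier_eq: "a \<in> C \<Longrightarrow> b \<in> C \<Longrightarrow> amult A a b = a \<odot> b"
  by (simp add: mul_def proj)

lemma str_carrier_eq: "a \<in> C \<Longrightarrow> star A a = a\<^sup>\<star>"
  by (simp add: str_def proj)

lemma entry_carrier_eq: "a \<in> C \<Longrightarrow> component A a i j = entry i j a"
  by (simp add: entry_def proj)

lemma linear_entry: "linear (entry i j)"
proof -
  have "component A (c *\<^sub>R proj a) i j = c *\<^sub>R component A (proj a) i j" for c a
    using component_comb[OF proj(1)[of a] zero_carrier, of c i j]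
      component_comb[OF zero_carrier zero_carrier, of 1 i j] by simp
  then show ?thesis
    using component_comb[OF proj(1) proj(1), of 1]
    by (intro linearI) (simp_all add: entry_def linear_add[OF proj(2)] linear_scale[OF proj(2)])
qed

lemma bilinear_mul: "bilinear (\<odot>)"
  using ax_lin_left ax_lin_right proj(1) unfolding bilinear_def linear_iff
  by (auto simp: mul_def linear_add[OF proj(2)] linear_scale[OF proj(2)] linear_map_on_def)

lemma linear_str: "linear str"
  using ax_star_lin proj(1) unfolding linear_iff
  by (auto simp: str_def linear_add[OF proj(2)] linear_scale[OF proj(2)] linear_map_on_def)

lemmas mul_simps = bilinear_ladd[OF bilinear_mul] bilinear_radd[OF bilinear_mul]
  bilinear_lmul[OF bilinear_mul] bilinear_rmul[OF bilinear_mul]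
  bilinear_lsub[OF bilinear_mul] bilinear_rsub[OF bilinear_mul]
lemmas mul_zero [simp] = bilinear_lzero[OF bilinear_mul] bilinear_rzero[OF bilinear_mul]
lemmas str_simps = linear_add[OF linear_str] linear_diff[OF linear_str] linear_scale[OF linear_str]
lemmas str_zero [simp] = linear_0[OF linear_str]
lemmas entry_simps = linear_add[OF linear_entry] linear_diff[OF linear_entry] linear_scale[OF linear_entry]
lemmas entry_zero [simp] = linear_0[OF linear_entry]
lemmas entry_sum = linear_sum[OF linear_entry]
lemmas str_sum = linear_sum[OF linear_str]

lemma mul_sum_left: "sum f S \<odot> b = (\<Sum>i\<in>S. f i \<odot> b)"
  using bilinear_mul linear_sum[of "\<lambda>x. x \<odot> b" f S] by (simp add: bilinear_def)

lemma mul_sum_right: "a \<odot> sum f S = (\<Sum>i\<in>S. a \<odot> f i)"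
  using bilinear_mul linear_sum[of "\<lambda>x. a \<odot> x" f S] by (simp add: bilinear_def)

lemma mul_carrier [simp]: "a \<odot> b \<in> C"
  using ax_closed proj(1) by (simp add: mul_def)

lemma str_carrier [simp]: "a\<^sup>\<star> \<in> C"
  using bij_betwE[OF ax_star_bij] proj(1) by (simp add: str_def)

lemma str_str [simp]: "a \<in> C \<Longrightarrow> a\<^sup>\<star>\<^sup>\<star> = a"
  using ax_star_star str_carrier_eq[of a] str_carrier_eq[of "a\<^sup>\<star>"] by (metis str_carrier)

lemma str_mul: "(a \<odot> b)\<^sup>\<star> = b\<^sup>\<star> \<odot> a\<^sup>\<star>"
proof -
  have "star A (amult A (proj a) (proj b)) = amult A (star A (proj b)) (star A (proj a))"
    using ax_star_mul proj(1) by simp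
  moreover have "proj (amult A (proj a) (proj b)) = amult A (proj a) (proj b)"
    using mul_carrier[of a b] proj(3) by (simp only: mul_def)
  moreover have "proj (star A (proj x)) = star A (proj x)" for x
    using str_carrier[of x] proj(3) by (simp only: str_def)
  ultimately show ?thesis by (simp only: mul_def str_def)
qed

lemma entry_outside [simp]: "\<not> (i \<in> I \<and> j \<in> I) \<Longrightarrow> entry i j a = 0"
  using component_carrier(1)[OF proj(1)] by (auto simp: entry_def block_family_def)

lemma entry_block: "i \<in> I \<Longrightarrow> j \<in> I \<Longrightarrow> entry i j a \<in> block A i j"
  using component_carrier(1)[OF proj(1)] by (auto simp: entry_def block_family_def)

lemma sum_entries: "a \<in> C \<Longrightarrow> (\<Sum>i\<in>I. \<Sum>j\<in>I. entry i j a) = a"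
  using component_carrier(2)[of a] by (simp add: family_sum_def entry_def proj)

lemma entry_eqI:
  assumes "a \<in> C" "b \<in> C" "\<And>i j. i \<in> I \<Longrightarrow> j \<in> I \<Longrightarrow> entry i j a = entry i j b"
  shows "a = b"
proof -
  have "(\<Sum>i\<in>I. \<Sum>j\<in>I. entry i j a) = (\<Sum>i\<in>I. \<Sum>j\<in>I. entry i j b)"
    by (intro sum.cong refl assms(3))
  then show ?thesis unfolding sum_entries[OF assms(1)] sum_entries[OF assms(2)] .
qed

lemma
  assumes "i \<in> I" "j \<in> I" "x \<in> block A i j"
  shows block_carrier: "x \<in> C"
    and entry_of_block: "entry k l x = (if k = i \<and> l = j then x else 0)"
proof -
  let ?f = "\<lambda>k l. if k = i \<and> l = j then x else 0"
  have f: "block_family A ?f"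
    using assms(3) subspace_0[OF subspace_block]
    unfolding block_family_def by (simp add: assms(1,2))
  have "(\<Sum>k\<in>I. \<Sum>l\<in>I. ?f k l) = (\<Sum>k\<in>I. if k = i then x else 0)"
    by (intro sum.cong refl) (use assms(2) in simp)
  also have "\<dots> = x" using assms(1) by simp
  finally have s: "family_sum A ?f = x" unfolding family_sum_def .
  show x: "x \<in> C" using carrierI[OF f] unfolding s .
  show "entry k l x = (if k = i \<and> l = j then x else 0)"
    using component_family_sum[OF f] unfolding s by (simp only: entry_def proj(3)[OF x])
qed

lemma entry_carrier [simp]: "entry i j a \<in> C"
proof (cases "i \<in> I \<and> j \<in> I")
  case True
  then have "i \<in> I" "j \<in> I" by blast+
  then show ?thesis using block_carrier[OF _ _ entry_block] by blast
qed (simp add: zero_carrier)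

lemma entry_entry: "entry k l (entry i j a) = (if k = i \<and> l = j then entry i j a else 0)"
proof (cases "i \<in> I \<and> j \<in> I")
  case True
  then have "i \<in> I" "j \<in> I" by blast+
  then show ?thesis using entry_of_block[OF _ _ entry_block] by blast
qed simp

lemma block_iff: "i \<in> I \<Longrightarrow> j \<in> I \<Longrightarrow> x \<in> block A i j \<longleftrightarrow> x \<in> C \<and> entry i j x = x"
proof
  assume "i \<in> I" "j \<in> I" "x \<in> C \<and> entry i j x = x"
  then show "x \<in> block A i j" using entry_block[of i j x] by simp
qed (use block_carrier[of i j x] entry_of_block[of i j x i j] in simp)

lemma entry_str: "entry i j (a\<^sup>\<star>) = (entry j i a)\<^sup>\<star>"
proof (cases "i \<in> I \<and> j \<in> I")
  case True
  have blk: "(entry q p a)\<^sup>\<star> \<in> block A p q" if "p \<in> I" "q \<in> I" for p q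
  proof -
    have "star A (entry q p a) \<in> star A ` block A q p" using entry_block that by blast
    then show ?thesis
      using ax_star_block that str_carrier_eq[OF block_carrier[OF that(2,1) entry_block]] by simp
  qed
  have "a\<^sup>\<star> = (\<Sum>q\<in>I. \<Sum>p\<in>I. entry q p (proj a))\<^sup>\<star>"
    using sum_entries[OF proj(1)] by (simp add: str_def proj)
  also have "\<dots> = (\<Sum>q\<in>I. \<Sum>p\<in>I. (entry q p a)\<^sup>\<star>)"
    by (simp add: str_sum entry_def proj)
  finally have "entry i j (a\<^sup>\<star>) = (\<Sum>q\<in>I. \<Sum>p\<in>I. entry i j ((entry q p a)\<^sup>\<star>))"
    by (simp add: entry_sum)
  also have "\<dots> = (\<Sum>q\<in>I. \<Sum>p\<in>I. if p = i then (if q = j then (entry q p a)\<^sup>\<star> else 0) else 0)"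
    using blk by (intro sum.cong refl) (simp add: entry_of_block[OF _ _ blk])
  also have "\<dots> = (\<Sum>q\<in>I. if q = j then (entry q i a)\<^sup>\<star> else 0)"
    using True by simp
  also have "\<dots> = (entry j i a)\<^sup>\<star>" using True by simp
  finally show ?thesis .
qed auto

lemma mul_entries:
  "entry i j a \<odot> entry k l b = (if j = k then entry i l (entry i j a \<odot> entry k l b) else 0)"
proof (cases "i \<in> I \<and> j \<in> I \<and> k \<in> I \<and> l \<in> I")
  case True
  then have *: "entry i j a \<odot> entry k l b = amult A (entry i j a) (entry k l b)"
    by (simp add: mul_carrier_eq)
  show ?thesis
  proof (cases "j = k")
    case True
    then have "entry i j a \<odot> entry k l b \<in> block A i l"
      using bspec[OF bspec[OF bspec[OF bspec[OF bspec[OF ax_block_mul]]]]] \<open>i \<in> I \<and> _\<close>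
        entry_block unfolding * by blast
    then show ?thesis using True block_iff \<open>i \<in> I \<and> _\<close> by auto
  next
    case False
    then show ?thesis
      using ax_block_mul_zero True entry_block unfolding * by auto
  qed
next
  case False
  then have "entry i j a = 0 \<or> entry k l b = 0" using entry_outside by blast
  then show ?thesis by auto
qed

lemma mul_entries_neq: "j \<noteq> k \<Longrightarrow> entry i j a \<odot> entry k l b = 0"
  using mul_entries[of i j a k l b] by simp

lemma entry_mul_entries:
  "entry p q (entry i j a \<odot> entry k l b) =
     (if j = k \<and> p = i \<and> q = l then entry i j a \<odot> entry k l b else 0)"
proof (cases "j = k")
  case True
  then have "entry i j a \<odot> entry k l b = entry i l (entry i j a \<odot> entry k l b)"
    by (subst (1) mul_entries) simp
  then show ?thesis using True entry_entry by metis
qed (simp add: mul_entries_neq)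

lemma mul_proj: "proj a \<odot> proj b = a \<odot> b"
  by (simp add: mul_def proj)

lemma entry_proj: "entry i j (proj a) = entry i j a"
  by (simp add: entry_def proj)

lemma entry_mul: "entry i k (a \<odot> b) = (\<Sum>j\<in>I. entry i j a \<odot> entry j k b)"
proof (cases "i \<in> I \<and> k \<in> I")
  case True
  have "a \<odot> b = (\<Sum>p\<in>I. \<Sum>q\<in>I. entry p q a) \<odot> (\<Sum>s\<in>I. \<Sum>t\<in>I. entry s t b)"
    using sum_entries[OF proj(1)] mul_proj by (simp add: entry_proj)
  also have "\<dots> = (\<Sum>p\<in>I. \<Sum>q\<in>I. \<Sum>s\<in>I. \<Sum>t\<in>I. entry p q a \<odot> entry s t b)"
    unfolding mul_sum_left unfolding mul_sum_right ..
  finally have "entry i k (a \<odot> b) =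
      (\<Sum>p\<in>I. \<Sum>q\<in>I. \<Sum>s\<in>I. \<Sum>t\<in>I. entry i k (entry p q a \<odot> entry s t b))"
    by (simp add: entry_sum)
  also have "\<dots> = (\<Sum>p\<in>I. \<Sum>q\<in>I. \<Sum>s\<in>I. \<Sum>t\<in>I.
      if k = t then (if q = s then (if i = p then entry p q a \<odot> entry s t b else 0) else 0) else 0)"
    by (intro sum.cong refl) (simp add: entry_mul_entries)
  also have "\<dots> = (\<Sum>p\<in>I. \<Sum>q\<in>I. \<Sum>s\<in>I. if q = s then (if i = p then entry p q a \<odot> entry s k b else 0) else 0)"
    using True by simp
  also have "\<dots> = (\<Sum>p\<in>I. if i = p then (\<Sum>q\<in>I. entry p q a \<odot> entry q k b) else 0)"
    by (intro sum.cong refl) simp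
  also have "\<dots> = (\<Sum>q\<in>I. entry i q a \<odot> entry q k b)"
    using True by simp
  finally show ?thesis .
qed auto

lemma carrier_simps [simp]:
  "0 \<in> C" "a \<in> C \<Longrightarrow> b \<in> C \<Longrightarrow> a + b \<in> C" "a \<in> C \<Longrightarrow> b \<in> C \<Longrightarrow> a - b \<in> C"
  "a \<in> C \<Longrightarrow> c *\<^sub>R a \<in> C" "a \<in> C \<Longrightarrow> - a \<in> C"
  using subspace_carrier by (auto simp: subspace_0 subspace_add subspace_diff subspace_scale subspace_neg)

lemma carrier_sum: "(\<And>i. i \<in> S \<Longrightarrow> f i \<in> C) \<Longrightarrow> sum f S \<in> C"
  using subspace_sum[OF subspace_carrier] by blast

end

section \<open>The trace form and the triangular subalgebra\<close>

locale t_algebra =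
  fixes A :: "'a::real_vector matrix_alg"
  assumes t_algebra: "T_algebra A"

sublocale t_algebra \<subseteq> matrix_algebra
  using t_algebra by unfold_locales (simp add: T_algebra_def)

context t_algebra
begin

lemma t_algebra_axioms_unfolded:
  shows ax1: "\<forall>i\<in>I. bij_betw (rho A i) (block A i i) UNIV \<and> linear_map_on (block A i i) (rho A i) \<and>
        (\<forall>a\<in>block A i i. \<forall>b\<in>block A i i. rho A i (amult A a b) = rho A i a * rho A i b)"
    and ax2: "\<forall>a\<in>C. \<forall>i\<in>I. \<forall>j\<in>I. amult A (unit_of A i) (component A a i j) = component A a i j \<and>
        amult A (component A a j i) (unit_of A i) = component A a j i"
    and ax3: "\<forall>a\<in>C. \<forall>b\<in>C. tr A (amult A a b) = tr A (amult A b a)"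
    and ax4: "\<forall>a\<in>C. \<forall>b\<in>C. \<forall>c\<in>C. tr A (amult A (amult A a b) c) = tr A (amult A a (amult A b c))"
    and ax5: "\<forall>a\<in>C. tr A (amult A a (star A a)) \<ge> 0 \<and> (tr A (amult A a (star A a)) = 0 \<longleftrightarrow> a = 0)"
    and ax6: "\<forall>a\<in>C. \<forall>b\<in>C. \<forall>c\<in>C. \<forall>i\<in>I. \<forall>j\<in>I. \<forall>k\<in>I. \<forall>l\<in>I. i \<le> j \<and> j \<le> k \<and> k \<le> l \<longrightarrow>
          amult A (component A a i j) (amult A (component A b j k) (component A c k l)) =
          amult A (amult A (component A a i j) (component A b j k)) (component A c k l)"
    and ax7: "\<forall>a\<in>C. \<forall>b\<in>C. \<forall>i\<in>I. \<forall>j\<in>I. \<forall>k\<in>I. \<forall>l\<in>I. i \<le> j \<and> j \<le> k \<and> l \<le> k \<longrightarrow>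
          amult A (component A a i j) (amult A (component A b j k) (star A (component A b l k))) =
          amult A (amult A (component A a i j) (component A b j k)) (star A (component A b l k))"
  by (insert t_algebra[unfolded T_algebra_def]) (elim conjE, assumption)+

abbreviation unit where "unit \<equiv> unit_of A"

definition diag :: "nat \<Rightarrow> 'a \<Rightarrow> real" where
  "diag i a = (if i \<in> I then rho A i (entry i i a) else 0)"

definition trc :: "'a \<Rightarrow> real" where "trc a = (\<Sum>i\<in>I. diag i a)"

definition ip :: "'a \<Rightarrow> 'a \<Rightarrow> real" where "ip a b = trc (a \<odot> b\<^sup>\<star>)"

definition T :: "'a set" where "T = triangular A"

text \<open>
  Multiplication by \<open>E J\<close> from the left selects the rows with index in \<open>J\<close>, and from the right the
  columns. In particular \<open>E I\<close> is the identity of the algebra.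
\<close>

definition E :: "nat set \<Rightarrow> 'a" where "E J = (\<Sum>i\<in>J \<inter> I. unit i)"

lemma rho_linear:
  assumes "i \<in> I" "a \<in> block A i i" "b \<in> block A i i"
  shows "rho A i (a + b) = rho A i a + rho A i b" "rho A i (c *\<^sub>R a) = c * rho A i a"
  using ax1 assms unfolding linear_map_on_def by auto

lemma rho_zero: "i \<in> I \<Longrightarrow> rho A i 0 = 0"
  using rho_linear(2)[of i 0 0 0] subspace_0[OF subspace_block] by simp

lemma linear_diag: "linear (diag i)"
proof (cases "i \<in> I")
  case True
  then show ?thesis
    using rho_linear[OF True entry_block entry_block]
    by (intro linearI) (simp_all add: diag_def entry_simps)
next
  case False
  then show ?thesis by (intro linearI) (simp_all add: diag_def)
qed

lemmas diag_simps = linear_add[OF linear_diag] linear_diff[OF linear_diag] linear_scale[OF linear_diag]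
lemmas diag_zero [simp] = linear_0[OF linear_diag]
lemmas diag_sum = linear_sum[OF linear_diag]

lemma diag_outside [simp]: "i \<notin> I \<Longrightarrow> diag i a = 0"
  by (simp add: diag_def)

lemma
  assumes "i \<in> I"
  shows unit_block: "unit i \<in> block A i i" and rho_unit: "rho A i (unit i) = 1"
proof -
  have b: "bij_betw (rho A i) (block A i i) UNIV" using ax1 assms by blast
  show "unit i \<in> block A i i"
    unfolding unit_of_def using b by (intro the_inv_into_into) (auto simp: bij_betw_def)
  show "rho A i (unit i) = 1"
    unfolding unit_of_def using f_the_inv_into_f_bij_betw[OF b] by simp
qed

lemma unit_carrier: "i \<in> I \<Longrightarrow> unit i \<in> C"
  using block_carrier unit_block by blast

lemma entry_unit: "i \<in> I \<Longrightarrow> entry k l (unit i) = (if k = i \<and> l = i then unit i else 0)"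
  using entry_of_block unit_block by blast

lemma diag_unit: "i \<in> I \<Longrightarrow> diag k (unit i) = (if k = i then 1 else 0)"
  by (auto simp: diag_def entry_unit rho_unit rho_zero)

lemma entry_diag: "i \<in> I \<Longrightarrow> entry i i a = diag i a *\<^sub>R unit i"
proof -
  assume i: "i \<in> I"
  have b: "inj_on (rho A i) (block A i i)" using ax1 i by (auto simp: bij_betw_def)
  have "rho A i (entry i i a) = rho A i (diag i a *\<^sub>R unit i)"
    using i by (simp add: diag_def rho_linear(2)[OF i unit_block unit_block] rho_unit)
  then show ?thesis
    using b i by (auto dest!: inj_onD intro: entry_block subspace_scale[OF subspace_block] unit_block)
qed

lemma unit_mul_entry: "i \<in> I \<Longrightarrow> unit i \<odot> entry i j a = entry i j a"
proof (cases "j \<in> I")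
  case True
  assume i: "i \<in> I"
  have "amult A (unit i) (component A (proj a) i j) = component A (proj a) i j"
    using ax2 proj(1) i True by blast
  then show ?thesis
    unfolding entry_def[symmetric] mul_carrier_eq[OF unit_carrier[OF i] entry_carrier] .
qed simp

lemma entry_mul_unit: "i \<in> I \<Longrightarrow> entry j i a \<odot> unit i = entry j i a"
proof (cases "j \<in> I")
  case True
  assume i: "i \<in> I"
  have "amult A (component A (proj a) j i) (unit i) = component A (proj a) j i"
    using ax2 proj(1) i True by blast
  then show ?thesis
    unfolding entry_def[symmetric] mul_carrier_eq[OF entry_carrier unit_carrier[OF i]] .
qed simp

lemma unit_mul_unit: "i \<in> I \<Longrightarrow> unit i \<odot> unit i = unit i"
  using unit_mul_entry[of i i "unit i"] by (simp add: entry_unit)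

lemma linear_trc: "linear trc"
  by (intro linearI) (simp_all add: trc_def diag_simps sum.distrib sum_distrib_left)

lemma tr_eq: "a \<in> C \<Longrightarrow> tr A a = trc a"
  by (simp add: tr_def trc_def diag_def entry_carrier_eq)

lemma proj_mul [simp]: "proj a \<odot> b = a \<odot> b" "a \<odot> proj b = a \<odot> b"
  by (simp_all add: mul_def proj)

lemma str_str_proj: "b\<^sup>\<star>\<^sup>\<star> = proj b"
proof -
  have "b\<^sup>\<star> = (proj b)\<^sup>\<star>" by (simp add: str_def proj)
  then show ?thesis using str_str[OF proj(1)[of b]] by simp
qed

lemma trc_comm: "trc (a \<odot> b) = trc (b \<odot> a)"
proof -
  have "tr A (amult A (proj a) (proj b)) = tr A (amult A (proj b) (proj a))"
    using ax3 proj(1) by blast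
  then have "trc (proj a \<odot> proj b) = trc (proj b \<odot> proj a)"
    by (simp only: mul_carrier_eq[OF proj(1) proj(1)] tr_eq[OF mul_carrier])
  then show ?thesis by simp
qed

lemma trc_assoc: "trc ((a \<odot> b) \<odot> c) = trc (a \<odot> (b \<odot> c))"
proof -
  have "tr A (amult A (amult A (proj a) (proj b)) (proj c)) = tr A (amult A (proj a) (amult A (proj b) (proj c)))"
    using ax4 proj(1) by blast
  then have "trc ((proj a \<odot> proj b) \<odot> proj c) = trc (proj a \<odot> (proj b \<odot> proj c))"
    by (simp only: mul_carrier_eq[OF proj(1) proj(1)] mul_carrier_eq[OF mul_carrier proj(1)]
        mul_carrier_eq[OF proj(1) mul_carrier] tr_eq[OF mul_carrier])
  then show ?thesis by simp
qed

lemma bilinear_ip: "bilinear ip"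
  unfolding bilinear_def linear_iff
  by (simp add: ip_def mul_simps str_simps linear_add[OF linear_trc] linear_scale[OF linear_trc])

lemmas ip_simps = bilinear_ladd[OF bilinear_ip] bilinear_radd[OF bilinear_ip]
  bilinear_lmul[OF bilinear_ip, simplified] bilinear_rmul[OF bilinear_ip, simplified]
  bilinear_lsub[OF bilinear_ip] bilinear_rsub[OF bilinear_ip]
lemmas ip_zero [simp] = bilinear_lzero[OF bilinear_ip] bilinear_rzero[OF bilinear_ip]

lemma ip_sum_left: "ip (sum f S) b = (\<Sum>i\<in>S. ip (f i) b)"
  using bilinear_ip linear_sum[of "\<lambda>x. ip x b" f S] by (simp add: bilinear_def)

lemma ip_sum_right: "ip a (sum f S) = (\<Sum>i\<in>S. ip a (f i))"
  using bilinear_ip linear_sum[of "\<lambda>x. ip a x" f S] by (simp add: bilinear_def)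

lemma inner_of_eq: "a \<in> C \<Longrightarrow> b \<in> C \<Longrightarrow> inner_of A a b = ip a b"
  by (simp add: inner_of_def ip_def str_carrier_eq mul_carrier_eq tr_eq)

lemma ip_nonneg: "a \<in> C \<Longrightarrow> ip a a \<ge> 0"
  using ax5 by (simp add: ip_def str_carrier_eq mul_carrier_eq tr_eq)

lemma ip_eq_0: "a \<in> C \<Longrightarrow> ip a a = 0 \<longleftrightarrow> a = 0"
  using ax5 by (simp add: ip_def str_carrier_eq mul_carrier_eq tr_eq)

text \<open>
  The adjoint of a unit is a multiple of the unit and again idempotent. It is not zero because the
  involution is injective.
\<close>

lemma str_unit: "i \<in> I \<Longrightarrow> (unit i)\<^sup>\<star> = unit i"
proof -
  assume i: "i \<in> I"
  define c where "c = diag i ((unit i)\<^sup>\<star>)"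
  have e: "(unit i)\<^sup>\<star> = entry i i ((unit i)\<^sup>\<star>)" using i by (simp add: entry_str entry_unit)
  then have c: "(unit i)\<^sup>\<star> = c *\<^sub>R unit i" using entry_diag[OF i] unfolding c_def by metis
  have "(unit i \<odot> unit i)\<^sup>\<star> = (unit i)\<^sup>\<star> \<odot> (unit i)\<^sup>\<star>" by (simp add: str_mul)
  then have "c *\<^sub>R unit i = (c * c) *\<^sub>R unit i" using i by (simp add: unit_mul_unit c mul_simps)
  moreover have nz: "unit i \<noteq> 0" using diag_unit[OF i, of i] by auto
  ultimately have "c = 0 \<or> c = 1" by simp
  moreover have "c \<noteq> 0"
  proof
    assume "c = 0"
    then have "(unit i)\<^sup>\<star> = 0" using c by simp
    then have "(unit i)\<^sup>\<star>\<^sup>\<star> = 0" by simp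
    then show False using nz str_str[OF unit_carrier[OF i]] by simp
  qed
  ultimately show ?thesis using c by simp
qed

lemma diag_str: "diag i (a\<^sup>\<star>) = diag i a"
proof (cases "i \<in> I")
  case True
  have "diag i (a\<^sup>\<star>) *\<^sub>R unit i = (diag i a *\<^sub>R unit i)\<^sup>\<star>"
    using entry_str[of i i a] by (simp only: entry_diag[OF True])
  also have "\<dots> = diag i a *\<^sub>R unit i" by (simp add: str_simps str_unit True)
  finally show ?thesis using diag_unit[OF True, of i] by (metis diag_zero scaleR_cancel_right zero_neq_one)
qed simp

lemma trc_str: "trc (a\<^sup>\<star>) = trc a"
  by (simp add: trc_def diag_str)

lemma ip_commute: "ip a b = ip b a"
proof -
  have "ip a b = trc ((a \<odot> b\<^sup>\<star>)\<^sup>\<star>)" by (simp add: ip_def trc_str)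
  then show ?thesis by (simp add: ip_def str_mul str_str_proj)
qed

lemma ip_str: "ip (a\<^sup>\<star>) (b\<^sup>\<star>) = ip a b"
  using trc_comm[of "a\<^sup>\<star>" b] by (simp add: ip_def str_str_proj ip_commute[unfolded ip_def, of a b])

lemma ip_mul_left: "ip (a \<odot> b) c = ip b (a\<^sup>\<star> \<odot> c)"
proof -
  have "ip (a \<odot> b) c = trc ((b \<odot> c\<^sup>\<star>) \<odot> a)" by (simp add: ip_def trc_assoc trc_comm[of _ a])
  then show ?thesis by (simp add: ip_def trc_assoc str_mul str_str_proj)
qed

lemma ip_mul_right: "ip (a \<odot> b) c = ip a (c \<odot> b\<^sup>\<star>)"
  by (simp add: ip_def trc_assoc str_mul str_str_proj)

lemma diag_entry: "diag p (entry i j x) = (if p = i \<and> p = j then diag p x else 0)"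
  by (auto simp: diag_def entry_entry rho_zero)

lemma trc_entry: "trc (entry i j x) = (if i = j then diag i x else 0)"
proof -
  have "trc (entry i j x) = (\<Sum>p\<in>I. if p = i then (if i = j then diag i x else 0) else 0)"
    unfolding trc_def by (intro sum.cong refl) (auto simp: diag_entry)
  then show ?thesis by simp
qed

lemma ip_entry_entry:
  "ip (entry i j a) (entry k l b) = (if i = k \<and> j = l then diag i (entry i j a \<odot> entry j i (b\<^sup>\<star>)) else 0)"
proof -
  have "ip (entry i j a) (entry k l b) = trc (entry i j a \<odot> entry l k (b\<^sup>\<star>))"
    by (simp add: ip_def entry_str)
  also have "\<dots> = (if j = l then trc (entry i k (entry i j a \<odot> entry l k (b\<^sup>\<star>))) else 0)"
    using mul_entries[of i j a l k "b\<^sup>\<star>"] linear_0[OF linear_trc] by (auto simp: mul_entries_neq)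
  finally show ?thesis by (auto simp: trc_entry)
qed

lemma ip_expand: "ip a b = (\<Sum>i\<in>I. \<Sum>j\<in>I. ip (entry i j a) (entry i j b))"
proof -
  have "ip a b = (\<Sum>i\<in>I. diag i (entry i i (a \<odot> b\<^sup>\<star>)))" by (simp add: ip_def trc_def diag_entry)
  also have "\<dots> = (\<Sum>i\<in>I. \<Sum>j\<in>I. diag i (entry i j a \<odot> entry j i (b\<^sup>\<star>)))"
    by (simp only: entry_mul diag_sum)
  finally show ?thesis by (simp add: ip_entry_entry)
qed

lemma ip_entry_left: "ip (entry i j a) b = ip (entry i j a) (entry i j b)"
proof (cases "i \<in> I \<and> j \<in> I")
  case True
  have "ip (entry i j a) b = (\<Sum>p\<in>I. \<Sum>q\<in>I. if q = j then (if p = i then ip (entry i j a) (entry i j b) else 0) else 0)"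
    unfolding ip_expand[of "entry i j a" b]
    by (intro sum.cong refl) (auto simp: entry_entry)
  then show ?thesis using True by simp
qed simp

lemma entry_assoc:
  assumes "i \<le> j" "j \<le> k" "k \<le> l"
  shows "entry i j a \<odot> (entry j k b \<odot> entry k l c) = (entry i j a \<odot> entry j k b) \<odot> entry k l c"
proof (cases "i \<in> I \<and> j \<in> I \<and> k \<in> I \<and> l \<in> I")
  case True
  then have "amult A (component A (proj a) i j) (amult A (component A (proj b) j k) (component A (proj c) k l)) =
      amult A (amult A (component A (proj a) i j) (component A (proj b) j k)) (component A (proj c) k l)"
    using ax6[rule_format, OF proj(1) proj(1) proj(1), of i j k l] assms by simp
  then show ?thesis
    by (simp only: entry_def[symmetric] mul_carrier_eq[OF entry_carrier entry_carrier]
        mul_carrier_eq[OF entry_carrier mul_carrier] mul_carrier_eq[OF mul_carrier entry_carrier])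
next
  case False
  then have "entry i j a = 0 \<or> entry j k b = 0 \<or> entry k l c = 0" using entry_outside by blast
  then show ?thesis by auto
qed

lemma entry_assoc_str:
  assumes "i \<le> j" "j \<le> k" "l \<le> k"
  shows "entry i j a \<odot> (entry j k b \<odot> entry k l (b\<^sup>\<star>)) = (entry i j a \<odot> entry j k b) \<odot> entry k l (b\<^sup>\<star>)"
proof (cases "i \<in> I \<and> j \<in> I \<and> k \<in> I \<and> l \<in> I")
  case True
  have "star A (entry l k b) = entry k l (b\<^sup>\<star>)" by (simp add: str_carrier_eq entry_str)
  moreover have "amult A (component A (proj a) i j) (amult A (component A (proj b) j k) (star A (component A (proj b) l k))) =
      amult A (amult A (component A (proj a) i j) (component A (proj b) j k)) (star A (component A (proj b) l k))"
    using ax7[rule_format, OF proj(1) proj(1), of i j k l] assms True by simp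
  ultimately show ?thesis
    by (simp only: entry_def[symmetric] mul_carrier_eq[OF entry_carrier entry_carrier]
        mul_carrier_eq[OF entry_carrier mul_carrier] mul_carrier_eq[OF mul_carrier entry_carrier])
next
  case False
  then have "entry i j a = 0 \<or> entry j k b = 0 \<or> entry k l (b\<^sup>\<star>) = 0" using entry_outside by blast
  then show ?thesis by auto
qed

lemma T_iff: "a \<in> T \<longleftrightarrow> a \<in> C \<and> (\<forall>i j. j < i \<longrightarrow> entry i j a = 0)"
proof -
  have "(\<forall>i\<in>I. \<forall>j\<in>I. j < i \<longrightarrow> component A a i j = 0) \<longleftrightarrow> (\<forall>i j. j < i \<longrightarrow> entry i j a = 0)" if "a \<in> C"
    using entry_outside[of _ _ a] entry_carrier_eq[OF that] by metis
  then show ?thesis unfolding T_def triangular_def by blast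
qed

lemma T_carrier [simp]: "a \<in> T \<Longrightarrow> a \<in> C"
  by (simp add: T_iff)

lemma T_entry: "a \<in> T \<Longrightarrow> j < i \<Longrightarrow> entry i j a = 0"
  by (simp add: T_iff)

lemma T_simps [simp]:
  "0 \<in> T" "a \<in> T \<Longrightarrow> b \<in> T \<Longrightarrow> a + b \<in> T" "a \<in> T \<Longrightarrow> b \<in> T \<Longrightarrow> a - b \<in> T"
  "a \<in> T \<Longrightarrow> c *\<^sub>R a \<in> T"
  by (simp_all add: T_iff entry_simps)

lemma T_entry_T [simp]: "a \<in> T \<Longrightarrow> entry i j a \<in> T"
  by (auto simp: T_iff entry_entry)

lemma T_mul [simp]: "a \<in> T \<Longrightarrow> b \<in> T \<Longrightarrow> a \<odot> b \<in> T"
proof -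
  assume ab: "a \<in> T" "b \<in> T"
  have "entry i k (a \<odot> b) = 0" if "k < i" for i k
    unfolding entry_mul
  proof (rule sum.neutral, rule ballI)
    fix j
    show "entry i j a \<odot> entry j k b = 0"
      using T_entry[OF ab(1), of j i] T_entry[OF ab(2), of k j] that by (cases "j < i") auto
  qed
  then show ?thesis by (simp add: T_iff)
qed

lemma assoc_of_entries:
  assumes "\<And>i j k l. (entry i j a \<odot> entry j k b) \<odot> entry k l c = entry i j a \<odot> (entry j k b \<odot> entry k l c)"
  shows "(a \<odot> b) \<odot> c = a \<odot> (b \<odot> c)"
proof (rule entry_eqI)
  fix i l
  have "entry i l ((a \<odot> b) \<odot> c) = (\<Sum>k\<in>I. \<Sum>j\<in>I. (entry i j a \<odot> entry j k b) \<odot> entry k l c)"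
    unfolding entry_mul mul_sum_left ..
  also have "\<dots> = (\<Sum>j\<in>I. \<Sum>k\<in>I. entry i j a \<odot> (entry j k b \<odot> entry k l c))"
    unfolding assms by (rule sum.swap)
  also have "\<dots> = entry i l (a \<odot> (b \<odot> c))"
    unfolding entry_mul mul_sum_right ..
  finally show "entry i l ((a \<odot> b) \<odot> c) = entry i l (a \<odot> (b \<odot> c))" .
qed simp_all

lemma T_assoc:
  assumes "a \<in> T" "b \<in> T" "c \<in> T"
  shows "(a \<odot> b) \<odot> c = a \<odot> (b \<odot> c)"
proof (rule assoc_of_entries)
  fix i j k l
  show "(entry i j a \<odot> entry j k b) \<odot> entry k l c = entry i j a \<odot> (entry j k b \<odot> entry k l c)"
    using entry_assoc[of i j k l a b c] T_entry[OF assms(1), of j i] T_entry[OF assms(2), of k j]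
      T_entry[OF assms(3), of l k]
    by (cases "i \<le> j"; cases "j \<le> k"; cases "k \<le> l") simp_all
qed

text \<open>
  Axiom (a7) summed over all entries. It applies because the last two factors come from the same
  element \<open>t\<close>.
\<close>

lemma T_assoc_str:
  assumes "u \<in> T" "t \<in> T"
  shows "(u \<odot> t) \<odot> t\<^sup>\<star> = u \<odot> (t \<odot> t\<^sup>\<star>)"
proof (rule assoc_of_entries)
  fix i j k l
  show "(entry i j u \<odot> entry j k t) \<odot> entry k l (t\<^sup>\<star>) = entry i j u \<odot> (entry j k t \<odot> entry k l (t\<^sup>\<star>))"
    using entry_assoc_str[of i j k l u t] T_entry[OF assms(1), of j i] T_entry[OF assms(2), of k j]
      T_entry[OF assms(2), of k l]
    by (cases "i \<le> j"; cases "j \<le> k"; cases "l \<le> k") (simp_all add: entry_str)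
qed

text \<open>
  Moving \<open>u\<close> across the inner product and applying \<open>T_assoc_str\<close> replaces \<open>u(tt\<^sup>*)\<close> by \<open>(ut)t\<^sup>*\<close>; then
  \<open>t\<^sup>*\<close> is moved across on the other side.
\<close>

lemma pairing:
  assumes "t \<in> T" "u \<in> T"
  shows "ip (t \<odot> t\<^sup>\<star>) (u\<^sup>\<star> \<odot> u) = ip (u \<odot> t) (u \<odot> t)"
proof -
  have "ip (t \<odot> t\<^sup>\<star>) (u\<^sup>\<star> \<odot> u) = ip ((u \<odot> t) \<odot> t\<^sup>\<star>) u"
    by (simp only: ip_mul_left[symmetric] T_assoc_str[OF assms(2,1)])
  also have "\<dots> = ip (u \<odot> t) (u \<odot> t)"
    using assms by (simp add: ip_mul_right)
  finally show ?thesis .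
qed

lemma E_carrier [simp]: "E J \<in> C"
  unfolding E_def by (intro carrier_sum unit_carrier) blast

lemma entry_E: "entry i j (E J) = (if i = j \<and> i \<in> J \<inter> I then unit i else 0)"
proof -
  have "entry i j (E J) = (\<Sum>k\<in>J \<inter> I. entry i j (unit k))" by (simp add: E_def entry_sum)
  also have "\<dots> = (\<Sum>k\<in>J \<inter> I. if k = i then (if i = j then unit i else 0) else 0)"
    by (intro sum.cong refl) (auto simp: entry_unit)
  also have "\<dots> = (if i = j \<and> i \<in> J \<inter> I then unit i else 0)" by auto
  finally show ?thesis .
qed

lemma entry_E_mul: "entry i j (E J \<odot> a) = (if i \<in> J then entry i j a else 0)"
proof (cases "i \<in> I")
  case True
  have "entry i j (E J \<odot> a) = (\<Sum>k\<in>I. if k = i then (if i \<in> J then entry i j a else 0) else 0)"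
    unfolding entry_mul by (intro sum.cong refl) (use True in \<open>auto simp: entry_E unit_mul_entry\<close>)
  then show ?thesis using True by simp
qed simp

lemma entry_mul_E: "entry i j (a \<odot> E J) = (if j \<in> J then entry i j a else 0)"
proof (cases "j \<in> I")
  case True
  have "entry i j (a \<odot> E J) = (\<Sum>k\<in>I. if k = j then (if j \<in> J then entry i j a else 0) else 0)"
    unfolding entry_mul by (intro sum.cong refl) (use True in \<open>auto simp: entry_E entry_mul_unit\<close>)
  then show ?thesis using True by simp
qed simp

lemma E_T [simp]: "E J \<in> T"
  by (simp add: T_iff entry_E)

lemma E_I_mul: "a \<in> C \<Longrightarrow> E I \<odot> a = a" "a \<in> C \<Longrightarrow> a \<odot> E I = a"
  by (rule entry_eqI; simp add: entry_E_mul entry_mul_E)+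

lemma str_E [simp]: "(E J)\<^sup>\<star> = E J"
  by (simp add: E_def str_sum str_unit)

lemma diag_E: "diag i (E J) = (if i \<in> J \<inter> I then 1 else 0)"
proof (cases "i \<in> I")
  case True
  then have "diag i (E J) = diag i (entry i i (E J))" by (simp add: diag_entry)
  also have "\<dots> = (if i \<in> J \<inter> I then 1 else 0)" using True by (simp add: entry_E diag_unit)
  finally show ?thesis .
qed simp

lemma E_mul_E: "E J \<odot> E K = E (J \<inter> K)"
  by (rule entry_eqI) (auto simp: entry_E_mul entry_E)

lemma unit_eq_E: "i \<in> I \<Longrightarrow> unit i = E {i}"
  by (simp add: E_def)

lemma diag_mul:
  assumes "a \<in> T" "b \<in> T"
  shows "diag i (a \<odot> b) = diag i a * diag i b"
proof (cases "i \<in> I")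
  case True
  have "entry i i (a \<odot> b) = (\<Sum>k\<in>I. if k = i then entry i i a \<odot> entry i i b else 0)"
    unfolding entry_mul
  proof (intro sum.cong refl)
    fix k
    show "entry i k a \<odot> entry k i b = (if k = i then entry i i a \<odot> entry i i b else 0)"
      using T_entry[OF assms(1), of k i] T_entry[OF assms(2), of i k] by (cases i k rule: linorder_cases) simp_all
  qed
  also have "\<dots> = entry i i a \<odot> entry i i b" using True by simp
  finally have "diag i (a \<odot> b) *\<^sub>R unit i = (diag i a *\<^sub>R unit i) \<odot> (diag i b *\<^sub>R unit i)"
    by (simp only: entry_diag[OF True])
  also have "\<dots> = (diag i a * diag i b) *\<^sub>R unit i" by (simp add: mul_simps unit_mul_unit True)
  finally show ?thesis
    using diag_unit[OF True, of i] by (metis diag_zero scaleR_cancel_right zero_neq_one)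
qed simp

section \<open>Cholesky elimination\<close>

abbreviation H where "H \<equiv> hermitian A"

lemma H_iff: "y \<in> H \<longleftrightarrow> y \<in> C \<and> y\<^sup>\<star> = y"
  by (auto simp: hermitian_def str_carrier_eq)

lemma H_entry: "y \<in> H \<Longrightarrow> (entry i j y)\<^sup>\<star> = entry j i y"
  using entry_str[of j i y] by (simp add: H_iff)

lemma H_simps:
  "x \<in> H \<Longrightarrow> x \<in> C" "0 \<in> H" "x \<in> H \<Longrightarrow> y \<in> H \<Longrightarrow> x + y \<in> H" "x \<in> H \<Longrightarrow> y \<in> H \<Longrightarrow> x - y \<in> H"
  "x \<in> H \<Longrightarrow> c *\<^sub>R x \<in> H" "t \<in> C \<Longrightarrow> t \<odot> t\<^sup>\<star> \<in> H" "t \<in> C \<Longrightarrow> t\<^sup>\<star> \<odot> t \<in> H"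
  by (auto simp: H_iff str_simps str_mul)

lemma entry_mul_str_self:
  assumes "j \<in> I"
  shows "entry j k t \<odot> (entry j k t)\<^sup>\<star> = ip (entry j k t) (entry j k t) *\<^sub>R unit j"
proof -
  let ?x = "entry j k t \<odot> entry k j (t\<^sup>\<star>)"
  have "?x = entry j j ?x" by (subst mul_entries) simp
  also have "\<dots> = diag j ?x *\<^sub>R unit j" by (rule entry_diag[OF assms])
  also have "diag j ?x = ip (entry j k t) (entry j k t)" by (simp add: ip_entry_entry)
  finally show ?thesis by (simp add: entry_str)
qed

lemma ip_unit: "i \<in> I \<Longrightarrow> ip (unit i) y = diag i y"
proof -
  assume i: "i \<in> I"
  have "ip (unit i) y = ip (entry i i (unit i)) (entry i i y)"
    using ip_entry_left[of i i "unit i" y] i by (simp add: entry_unit)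
  also have "\<dots> = diag i (entry i i (unit i) \<odot> entry i i (y\<^sup>\<star>))" unfolding ip_entry_entry by simp
  also have "\<dots> = diag i (unit i \<odot> entry i i (y\<^sup>\<star>))" using i by (simp add: entry_unit)
  also have "\<dots> = diag i y" using i by (simp add: unit_mul_entry diag_entry diag_str)
  finally show ?thesis .
qed

lemma ip_E_mono: "u \<in> C \<Longrightarrow> ip (u \<odot> E J) u \<le> ip u u"
  unfolding ip_expand[of "u \<odot> E J" u] ip_expand[of u u]
  by (intro sum_mono) (auto simp: entry_mul_E intro: ip_nonneg)

text \<open>
  The inequality \<open>2\<langle>a, b\<rangle> \<le> \<bar>a\<bar>\<^sup>2 + \<bar>b\<bar>\<^sup>2\<close>, applied to all pairs of summands.
\<close>

lemma ip_sum_bound: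
  assumes "finite S" "\<And>s. s \<in> S \<Longrightarrow> f s \<in> C"
  shows "ip (sum f S) (sum f S) \<le> real (card S) * (\<Sum>s\<in>S. ip (f s) (f s))"
proof -
  have "ip (f a) (f b) \<le> (ip (f a) (f a) + ip (f b) (f b)) / 2" if "a \<in> S" "b \<in> S" for a b
  proof -
    have "0 \<le> ip (f a - f b) (f a - f b)" using assms that by (intro ip_nonneg) simp
    then show ?thesis by (simp add: ip_simps ip_commute[of "f b" "f a"])
  qed
  then have "ip (sum f S) (sum f S) \<le> (\<Sum>a\<in>S. \<Sum>b\<in>S. (ip (f a) (f a) + ip (f b) (f b)) / 2)"
    unfolding ip_sum_left unfolding ip_sum_right by (intro sum_mono) auto
  also have "\<dots> = (\<Sum>a\<in>S. \<Sum>b\<in>S. ip (f a) (f a) / 2) + (\<Sum>a\<in>S. \<Sum>b\<in>S. ip (f b) (f b) / 2)"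
    by (simp add: add_divide_distrib sum.distrib)
  also have "(\<Sum>a\<in>S. \<Sum>b\<in>S. ip (f b) (f b) / 2) = (\<Sum>a\<in>S. \<Sum>b\<in>S. ip (f a) (f a) / 2)"
    by (rule sum.swap)
  also have "(\<Sum>a\<in>S. \<Sum>b\<in>S. ip (f a) (f a) / 2) + (\<Sum>a\<in>S. \<Sum>b\<in>S. ip (f a) (f a) / 2)
      = real (card S) * (\<Sum>s\<in>S. ip (f s) (f s))"
    by (simp add: sum_distrib_left flip: sum.distrib)
  finally show ?thesis .
qed

text \<open>
  For a single entry \<open>z = t\<^sub>j\<^sub>k\<close> the product \<open>zz\<^sup>*\<close> is a multiple of the unit \<open>e\<^sub>j\<close>, so that \<open>pairing\<close> gives
  \<open>\<bar>uz\<bar>\<^sup>2 = \<bar>z\<bar>\<^sup>2\<langle>ue\<^sub>j, u\<rangle> \<le> \<bar>z\<bar>\<^sup>2\<bar>u\<bar>\<^sup>2\<close>.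
\<close>

lemma right_mul_bounded:
  assumes t: "t \<in> T"
  shows "\<exists>M>0. \<forall>u\<in>T. ip (u \<odot> t) (u \<odot> t) \<le> M * ip u u"
proof -
  define m where "m = (\<lambda>(j, k). ip (entry j k t) (entry j k t))"
  have m: "m p \<ge> 0" for p by (auto simp: m_def ip_nonneg split: prod.split)
  define M where "M = 1 + real (card (I \<times> I)) * (\<Sum>p\<in>I \<times> I. m p)"
  have "M > 0" unfolding M_def using m by (intro add_pos_nonneg mult_nonneg_nonneg sum_nonneg) auto
  moreover have "ip (u \<odot> t) (u \<odot> t) \<le> M * ip u u" if u: "u \<in> T" for u
  proof -
    have b: "ip (u \<odot> entry j k t) (u \<odot> entry j k t) \<le> m (j, k) * ip u u" if j: "j \<in> I" for j k
    proof -
      have "ip (u \<odot> entry j k t) (u \<odot> entry j k t) = ip (entry j k t \<odot> (entry j k t)\<^sup>\<star>) (u\<^sup>\<star> \<odot> u)"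
        using pairing[OF T_entry_T[OF t] u] by simp
      also have "\<dots> = m (j, k) * ip (u \<odot> E {j}) u"
        using j by (simp add: entry_mul_str_self ip_simps m_def unit_eq_E ip_mul_left)
      also have "\<dots> \<le> m (j, k) * ip u u" using u m by (intro mult_left_mono ip_E_mono) simp_all
      finally show ?thesis .
    qed
    have "t = (\<Sum>p\<in>I \<times> I. entry (fst p) (snd p) t)"
      using sum_entries[of t] t by (simp add: sum.cartesian_product case_prod_beta')
    then have "u \<odot> t = (\<Sum>p\<in>I \<times> I. u \<odot> entry (fst p) (snd p) t)" by (metis mul_sum_right)
    then have "ip (u \<odot> t) (u \<odot> t) \<le> real (card (I \<times> I)) *
        (\<Sum>p\<in>I \<times> I. ip (u \<odot> entry (fst p) (snd p) t) (u \<odot> entry (fst p) (snd p) t))"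
      using ip_sum_bound[of "I \<times> I" "\<lambda>p. u \<odot> entry (fst p) (snd p) t"] by simp
    also have "\<dots> \<le> real (card (I \<times> I)) * (\<Sum>p\<in>I \<times> I. m p * ip u u)"
      using b by (intro mult_left_mono sum_mono) (auto simp del: card_cartesian_product)
    also have "\<dots> \<le> M * ip u u"
      using ip_nonneg[of u] u by (simp add: M_def sum_distrib_right[symmetric] distrib_right)
    finally show ?thesis .
  qed
  ultimately show ?thesis by blast
qed

text \<open>
  Elements with nonnegative diagonal are limits of elements with positive diagonal, so this is the
  condition that defines the dual cone (\<open>dual_cone_eq\<close>). The diagonal must be allowed to vanish because
  \<open>cholesky_step\<close> clears diagonal entries of the test elements.
\<close>

definition dual_nonneg :: "'a \<Rightarrow> bool" where
  "dual_nonneg y \<longleftrightarrow> (\<forall>t\<in>T. (\<forall>i. diag i t \<ge> 0) \<longrightarrow> ip (t \<odot> t\<^sup>\<star>) y \<ge> 0)"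

lemma dual_nonneg_diag:
  assumes "dual_nonneg y" "i \<in> I" shows "diag i y \<ge> 0"
proof -
  have "ip (unit i \<odot> (unit i)\<^sup>\<star>) y \<ge> 0"
    using assms(1) E_T[of "{i}"] diag_unit[OF assms(2)]
    unfolding dual_nonneg_def unit_eq_E[OF assms(2), symmetric] by simp
  then show ?thesis using assms by (simp add: str_unit unit_mul_unit ip_unit)
qed

text \<open>
  Testing \<open>y\<close> with \<open>t = e\<^sub>j - cy\<^sub>k\<^sub>j\<close> yields \<open>2c\<bar>y\<^sub>k\<^sub>j\<bar>\<^sup>2 \<le> y\<^sub>j\<^sub>j\<close> for every \<open>c \<ge> 0\<close>, since the quadratic term in \<open>c\<close>
  is a multiple of \<open>y\<^sub>k\<^sub>k = 0\<close>.
\<close>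

lemma dual_nonneg_row_zero:
  assumes y: "y \<in> H" "dual_nonneg y" and k: "k \<in> I" "diag k y = 0" and kj: "k \<le> j"
  shows "entry k j y = 0"
proof (cases "j = k \<or> j \<notin> I")
  case True
  then show ?thesis using k entry_diag[of k y] by auto
next
  case False
  then have j: "j \<in> I" "k < j" using kj by auto
  define e where "e = entry k j y"
  have e_T: "e \<in> T" using j by (auto simp: e_def T_iff entry_entry)
  define n where "n = ip e e"
  have "2 * c * n \<le> diag j y" if "c \<ge> 0" for c
  proof -
    define t where "t = (- c) *\<^sub>R e + unit j"
    have "t \<in> T" using e_T E_T[of "{j}"] unit_eq_E[OF j(1)] by (simp add: t_def)
    moreover have "diag i t \<ge> 0" for i
      using j by (simp add: t_def diag_simps diag_unit e_def diag_entry)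
    ultimately have "ip (t \<odot> t\<^sup>\<star>) y \<ge> 0" using y(2) by (simp add: dual_nonneg_def)
    moreover have "t \<odot> t\<^sup>\<star> = (c * c) *\<^sub>R (e \<odot> e\<^sup>\<star>) - c *\<^sub>R (e \<odot> unit j) - c *\<^sub>R (unit j \<odot> e\<^sup>\<star>) + unit j"
      unfolding t_def by (simp add: str_simps mul_simps str_unit j unit_mul_unit algebra_simps)
    moreover have "e \<odot> e\<^sup>\<star> = n *\<^sub>R unit k" unfolding e_def n_def by (rule entry_mul_str_self[OF k(1)])
    moreover have "e \<odot> unit j = e" unfolding e_def by (rule entry_mul_unit[OF j(1)])
    moreover have "unit j \<odot> e\<^sup>\<star> = e\<^sup>\<star>"
      unfolding e_def entry_str[symmetric] by (rule unit_mul_entry[OF j(1)])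
    moreover have "ip e y = n" unfolding e_def n_def by (rule ip_entry_left)
    moreover have "ip (e\<^sup>\<star>) y = n" using ip_str[of e y] y(1) \<open>ip e y = n\<close> by (simp add: H_iff)
    ultimately show ?thesis using k j by (simp add: ip_simps ip_unit)
  qed note le = this
  have "n \<ge> 0" by (simp add: n_def e_def ip_nonneg)
  have "n = 0"
  proof (rule ccontr)
    assume "n \<noteq> 0"
    then have "n > 0" using \<open>n \<ge> 0\<close> by simp
    have dj: "diag j y \<ge> 0" by (rule dual_nonneg_diag[OF y(2) j(1)])
    have "2 * ((diag j y + 1) / n) * n \<le> diag j y" by (rule le) (use dj \<open>n > 0\<close> in simp)
    then show False using \<open>n > 0\<close> dj by simp
  qed
  then show ?thesis using ip_eq_0[of e] by (simp add: n_def e_def)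
qed

definition lower_rows :: "nat \<Rightarrow> 'a \<Rightarrow> bool" where
  "lower_rows k u \<longleftrightarrow> (\<forall>i j. i < k \<longrightarrow> entry i j u = 0)"

lemma ip_disjoint_row:
  assumes "\<And>i j. i \<noteq> k \<Longrightarrow> entry i j x = 0" "\<And>j. entry k j y = 0"
  shows "ip x y = 0"
  unfolding ip_expand[of x y] 
proof (intro sum.neutral ballI)
  fix i j
  show "ip (entry i j x) (entry i j y) = 0" using assms(1)[of i j] assms(2)[of j] by (cases "i = k") simp_all
qed

text \<open>
  One elimination step with the row \<open>u = e\<^sub>ky / \<surd>y\<^sub>k\<^sub>k\<close>. To see that the remainder \<open>y' = y - u\<^sup>*u\<close> is again
  nonnegative at \<open>t\<close>, row \<open>k\<close> of \<open>t\<close> is changed by \<open>w\<close> such that \<open>u(t + w) = 0\<close>. This does not affect the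
  pairing with \<open>y'\<close>, whose row \<open>k\<close> vanishes, and \<open>y\<close> and \<open>y'\<close> have the same pairing with
  \<open>(t + w)(t + w)\<^sup>*\<close> by \<open>pairing\<close>. The new diagonal entry of \<open>t + w\<close> in row \<open>k\<close> is zero.
\<close>

lemma cholesky_step:
  assumes y: "y \<in> H" "dual_nonneg y" and low: "lower_rows k y" and k: "k \<in> I"
  shows "\<exists>u\<in>T. (\<forall>i j. i \<noteq> k \<longrightarrow> entry i j u = 0) \<and> diag k u \<ge> 0 \<and> (diag k u = 0 \<longrightarrow> u = 0) \<and>
      y - u\<^sup>\<star> \<odot> u \<in> H \<and> dual_nonneg (y - u\<^sup>\<star> \<odot> u) \<and> lower_rows (Suc k) (y - u\<^sup>\<star> \<odot> u)"
proof (cases "diag k y = 0")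
  case True
  have "entry k j y = 0" for j
  proof (cases "k \<le> j")
    case False
    then show ?thesis using low H_entry[OF y(1), of j k] by (auto simp: lower_rows_def)
  qed (rule dual_nonneg_row_zero[OF y k True])
  then have "lower_rows (Suc k) y" using low by (auto simp: lower_rows_def less_Suc_eq)
  then show ?thesis using y by (intro bexI[of _ 0]) auto
next
  case False
  then have pos: "diag k y > 0" using dual_nonneg_diag[OF y(2) k] by simp
  define s where "s = sqrt (diag k y)"
  have s: "s > 0" "s * s = diag k y" using pos by (simp_all add: s_def)
  define u where "u = (1 / s) *\<^sub>R (E {k} \<odot> y)"
  have u_entry: "entry i j u = (if i = k then (1 / s) *\<^sub>R entry k j y else 0)" for i j
    by (simp add: u_def entry_simps entry_E_mul)
  have uT: "u \<in> T"
  proof -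
    have "entry k j y = 0" if "j < k" for j
    proof -
      have "entry j k y = 0" using low that unfolding lower_rows_def by blast
      then show ?thesis using H_entry[OF y(1), of j k] by (metis str_zero)
    qed
    moreover have "u \<in> C" by (simp add: u_def)
    ultimately show ?thesis unfolding T_iff u_entry by simp
  qed
  have "diag k u = diag k ((1 / s) *\<^sub>R entry k k y)"
    using diag_entry[of k k k u] u_entry[of k k] by simp
  also have "\<dots> = diag k y / s" using diag_entry[of k k k y] by (simp add: diag_simps)
  also have "\<dots> = s" unfolding s(2)[symmetric] using s(1) by simp
  finally have du: "diag k u = s" .
  have du0: "diag i u = 0" if "i \<noteq> k" for i using that u_entry[of i i] diag_entry[of i i i u] by simp
  define y' where "y' = y - u\<^sup>\<star> \<odot> u"
  have y'H: "y' \<in> H" unfolding y'_def by (rule H_simps(4)[OF y(1) H_simps(7)[OF T_carrier[OF uT]]])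
  have uu: "entry i j (u\<^sup>\<star> \<odot> u) = (entry k i u)\<^sup>\<star> \<odot> entry k j u" for i j
  proof -
    have "entry i j (u\<^sup>\<star> \<odot> u) = (\<Sum>l\<in>I. if l = k then (entry k i u)\<^sup>\<star> \<odot> entry k j u else 0)"
      unfolding entry_mul by (intro sum.cong refl) (auto simp: entry_str u_entry)
    then show ?thesis using k by simp
  qed
  have row_k: "entry k j y' = 0" for j
  proof -
    have "entry k k u = s *\<^sub>R unit k" using entry_diag[OF k, of u] du by simp
    then have "entry k j (u\<^sup>\<star> \<odot> u) = s *\<^sub>R (unit k \<odot> entry k j u)"
      by (simp add: uu str_simps str_unit k mul_simps)
    also have "\<dots> = entry k j y" using s by (simp add: unit_mul_entry k u_entry mul_simps)
    finally show ?thesis by (simp add: y'_def entry_simps)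
  qed
  have low': "lower_rows (Suc k) y'"
    unfolding lower_rows_def
  proof (intro allI impI)
    fix i j assume "i < Suc k"
    show "entry i j y' = 0"
    proof (cases "i = k")
      case False
      then have "i < k" using \<open>i < Suc k\<close> by simp
      then have "entry k i u = 0" by (rule T_entry[OF uT])
      then show ?thesis using low \<open>i < k\<close> by (simp add: y'_def entry_simps uu lower_rows_def)
    qed (simp add: row_k)
  qed
  have "dual_nonneg y'"
    unfolding dual_nonneg_def
  proof (intro ballI impI)
    fix t assume t: "t \<in> T" "\<forall>i. diag i t \<ge> 0"
    \<comment> \<open>chosen so that \<open>u(t + w) = 0\<close>, because \<open>uu = su\<close>\<close>
    define w where "w = (- 1 / s) *\<^sub>R (u \<odot> t)"
    have w: "w \<in> T" unfolding w_def by (intro T_simps(4) T_mul uT t(1))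
    have w_entry: "entry i j w = 0" if "i \<noteq> k" for i j
    proof -
      have "entry i j (u \<odot> t) = 0" unfolding entry_mul using that by (simp add: u_entry)
      then show ?thesis unfolding w_def linear_scale[OF linear_entry] by simp
    qed
    have "u \<odot> u = s *\<^sub>R u"
    proof (rule entry_eqI)
      fix i j
      have "entry i j (u \<odot> u) = (\<Sum>l\<in>I. if l = k then entry i k u \<odot> entry k j u else 0)"
        unfolding entry_mul by (intro sum.cong refl) (auto simp: u_entry[of _ j])
      also have "\<dots> = entry i k u \<odot> entry k j u" using k by simp
      also have "\<dots> = s *\<^sub>R entry i j u"
      proof (cases "i = k")
        case True
        have "entry k k u = s *\<^sub>R unit k" using entry_diag[OF k, of u] du by simp
        then show ?thesis by (simp add: True mul_simps unit_mul_entry k)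
      qed (simp add: u_entry)
      finally show "entry i j (u \<odot> u) = entry i j (s *\<^sub>R u)" by (simp add: entry_simps)
    qed (use uT in simp_all)
    then have "u \<odot> (u \<odot> t) = s *\<^sub>R (u \<odot> t)"
      using T_assoc[OF uT uT t(1)] by (simp add: mul_simps)
    then have uz: "u \<odot> (t + w) = 0" using s by (simp add: w_def mul_simps)
    have tw: "t + w \<in> T" using t w by simp
    have dtw: "diag i (t + w) \<ge> 0" for i
      using t(2) s du du0[of i] by (cases "i = k") (simp_all add: w_def diag_simps diag_mul uT t(1))
    have "0 \<le> ip ((t + w) \<odot> (t + w)\<^sup>\<star>) y" using y(2) tw dtw by (simp add: dual_nonneg_def)
    also have "\<dots> = ip ((t + w) \<odot> (t + w)\<^sup>\<star>) y'"
      using pairing[OF tw uT] uz by (simp add: y'_def ip_simps)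
    also have "(t + w) \<odot> (t + w)\<^sup>\<star> = t \<odot> t\<^sup>\<star> + (w \<odot> t\<^sup>\<star>)\<^sup>\<star> + w \<odot> (t + w)\<^sup>\<star>"
      using t w by (simp add: str_simps mul_simps str_mul)
    also have "ip \<dots> y' = ip (t \<odot> t\<^sup>\<star>) y'"
    proof -
      have z: "ip (w \<odot> x) y' = 0" for x
      proof (rule ip_disjoint_row[where k = k])
        show "entry i j (w \<odot> x) = 0" if "i \<noteq> k" for i j
          unfolding entry_mul using that by (simp add: w_entry)
      qed (rule row_k)
      moreover have "ip ((w \<odot> t\<^sup>\<star>)\<^sup>\<star>) y' = 0"
        using ip_str[of "w \<odot> t\<^sup>\<star>" y'] z y'H by (simp add: H_iff)
      ultimately show ?thesis by (simp add: ip_simps)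
    qed
    finally show "0 \<le> ip (t \<odot> t\<^sup>\<star>) y'" .
  qed
  then show ?thesis
    using uT u_entry s du y'H low' unfolding y'_def by (intro bexI[of _ u]) auto
qed

text \<open>
  The rows produced by successive steps have disjoint support, so the mixed products vanish and the
  sum of the squares \<open>u\<^sup>*u\<close> is the square of the sum.
\<close>

lemma cholesky_from_row:
  assumes "y \<in> H" "dual_nonneg y" "lower_rows k y" "1 \<le> k"
  shows "\<exists>u\<in>T. y = u\<^sup>\<star> \<odot> u \<and> lower_rows k u \<and> (\<forall>i. diag i u \<ge> 0) \<and>
      (\<forall>i\<in>I. diag i u = 0 \<longrightarrow> (\<forall>j. entry i j u = 0))"
  using assms
proof (induction "Suc (alg_rank A) - k" arbitrary: k y)
  case 0
  have "entry i j y = entry i j 0" if "i \<in> I" for i j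
  proof -
    have "i < k" using 0(1) that by (simp add: indices_def)
    then show ?thesis using 0(4) by (simp add: lower_rows_def)
  qed
  then have "y = 0" using entry_eqI[OF H_simps(1)[OF 0(2)] carrier_simps(1)] by blast
  then show ?case by (intro bexI[of _ 0]) (auto simp: lower_rows_def)
next
  case (Suc n)
  then have k: "k \<in> I" by (auto simp: indices_def)
  obtain u where u: "u \<in> T" "\<And>i j. i \<noteq> k \<Longrightarrow> entry i j u = 0" "diag k u \<ge> 0" "diag k u = 0 \<Longrightarrow> u = 0"
    "y - u\<^sup>\<star> \<odot> u \<in> H" "dual_nonneg (y - u\<^sup>\<star> \<odot> u)" "lower_rows (Suc k) (y - u\<^sup>\<star> \<odot> u)"
    using cholesky_step[OF Suc.prems(1-3) k] by blast
  have n: "n = Suc (alg_rank A) - Suc k" "1 \<le> Suc k" using Suc.hyps(2) by simp_all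
  from Suc.hyps(1)[OF n(1) u(5-7) n(2)]
  obtain v where v: "v \<in> T" "y - u\<^sup>\<star> \<odot> u = v\<^sup>\<star> \<odot> v" "lower_rows (Suc k) v" "\<forall>i. diag i v \<ge> 0"
    "\<forall>i\<in>I. diag i v = 0 \<longrightarrow> (\<forall>j. entry i j v = 0)"
    by blast
  have v0: "entry i j v = 0" if "i \<le> k" for i j using v(3) that by (simp add: lower_rows_def)
  have du: "diag i u = 0" if "i \<noteq> k" for i using diag_entry[of i i i u] u(2)[OF that] by simp
  have dv: "diag i v = 0" if "i \<le> k" for i using diag_entry[of i i i v] v0[OF that] by simp
  have uv: "u\<^sup>\<star> \<odot> v = 0"
  proof (rule entry_eqI)
    fix i j
    have "(entry l i u)\<^sup>\<star> \<odot> entry l j v = 0" for l using u(2)[of l i] v0[of l j] by (cases "l = k") simp_all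
    then show "entry i j (u\<^sup>\<star> \<odot> v) = entry i j 0" by (simp add: entry_mul entry_str)
  qed simp_all
  then have "(u\<^sup>\<star> \<odot> v)\<^sup>\<star> = 0" by simp
  then have "v\<^sup>\<star> \<odot> u = 0" using u(1) by (simp add: str_mul)
  then have "y = (u + v)\<^sup>\<star> \<odot> (u + v)"
    using uv v(2) by (simp add: str_simps mul_simps algebra_simps)
  moreover have "lower_rows k (u + v)" using u(2) v0 by (auto simp: lower_rows_def entry_simps)
  moreover have "diag i (u + v) \<ge> 0" for i
    using u(3) v(4) du[of i] by (cases "i = k") (simp_all add: diag_simps)
  moreover have "entry i j (u + v) = 0" if "i \<in> I" "diag i (u + v) = 0" for i j
    using u(2)[of i j] u(4) bspec[OF v(5) that(1)] v0[of i j] du[of i] dv[of i] that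
    by (cases "i = k") (simp_all add: entry_simps diag_simps)
  ultimately show ?case using u(1) v(1) by (intro bexI[of _ "u + v"]) auto
qed

theorem cholesky:
  assumes "y \<in> H" "dual_nonneg y"
  shows "\<exists>u\<in>T. y = u\<^sup>\<star> \<odot> u \<and> (\<forall>i. diag i u \<ge> 0) \<and> (\<forall>i\<in>I. diag i u = 0 \<longrightarrow> (\<forall>j. entry i j u = 0))"
proof -
  have "lower_rows 1 y" by (auto simp: lower_rows_def indices_def intro: entry_outside)
  then show ?thesis using cholesky_from_row[OF assms] by blast
qed

section \<open>Associativity for decreasing indices\<close>

lemma str_eq_iff: "a \<in> C \<Longrightarrow> b \<in> C \<Longrightarrow> a\<^sup>\<star> = b\<^sup>\<star> \<longleftrightarrow> a = b"
  by (metis str_str)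

lemma polarised_pairing:
  assumes "s \<in> T" "t \<in> T" "u \<in> T"
  shows "ip (s \<odot> t\<^sup>\<star>) (u\<^sup>\<star> \<odot> u) = ip (u \<odot> s) (u \<odot> t)"
proof -
  have "ip ((s \<odot> t\<^sup>\<star>)\<^sup>\<star>) ((u\<^sup>\<star> \<odot> u)\<^sup>\<star>) = ip (s \<odot> t\<^sup>\<star>) (u\<^sup>\<star> \<odot> u)" by (rule ip_str)
  then have "ip (t \<odot> s\<^sup>\<star>) (u\<^sup>\<star> \<odot> u) = ip (s \<odot> t\<^sup>\<star>) (u\<^sup>\<star> \<odot> u)"
    using assms by (simp add: str_mul)
  moreover have "ip ((s + t) \<odot> (s + t)\<^sup>\<star>) (u\<^sup>\<star> \<odot> u) = ip (u \<odot> (s + t)) (u \<odot> (s + t))"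
    using assms by (intro pairing) simp_all
  ultimately show ?thesis
    using pairing[OF assms(1,3)] pairing[OF assms(2,3)]
    by (simp add: str_simps mul_simps ip_simps ip_commute[of "u \<odot> t" "u \<odot> s"])
qed

lemma orthogonal_triangular_eq_0:
  assumes "X \<in> C" "\<And>d. d \<in> T \<Longrightarrow> ip X d = 0" "\<And>d. d\<^sup>\<star> \<in> T \<Longrightarrow> ip X d = 0"
  shows "X = 0"
proof (rule entry_eqI)
  fix i j
  have "entry i j X \<in> T \<or> (entry i j X)\<^sup>\<star> \<in> T"
  proof (cases "i \<le> j")
    case True
    then have "entry i j X \<in> T" by (simp add: T_iff entry_entry)
    then show ?thesis ..
  next
    case False
    then have "entry j i (X\<^sup>\<star>) \<in> T" by (simp add: T_iff entry_entry)
    then show ?thesis unfolding entry_str by blast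
  qed
  then have "ip X (entry i j X) = 0" using assms(2,3) by blast
  then have "ip (entry i j X) (entry i j X) = 0"
    unfolding ip_entry_left[of i j X X, symmetric] by (simp add: ip_commute)
  then show "entry i j X = entry i j 0" using ip_eq_0[OF entry_carrier] by simp
qed (simp_all add: assms(1))

text \<open>
  The mirror image of \<open>T_assoc_str\<close>, which reversing the index order requires. The difference of
  both sides is orthogonal to \<open>T\<close> by \<open>polarised_pairing\<close>, and to the adjoints of \<open>T\<close> by the associativity of
  \<open>T\<close> and of the trace. Together these span the algebra.
\<close>

lemma lower_assoc:
  assumes "u \<in> T" "s \<in> T"
  shows "(u\<^sup>\<star> \<odot> u) \<odot> s = u\<^sup>\<star> \<odot> (u \<odot> s)"
proof -
  let ?X = "(u\<^sup>\<star> \<odot> u) \<odot> s - u\<^sup>\<star> \<odot> (u \<odot> s)"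
  have upper: "ip ?X d = 0" if "d \<in> T" for d
  proof -
    have "ip ((u\<^sup>\<star> \<odot> u) \<odot> s) d = ip (d \<odot> s\<^sup>\<star>) (u\<^sup>\<star> \<odot> u)"
      unfolding ip_mul_right[of "u\<^sup>\<star> \<odot> u" s d] by (rule ip_commute)
    also have "\<dots> = ip (u \<odot> d) (u \<odot> s)" using assms that by (intro polarised_pairing)
    also have "\<dots> = ip (u \<odot> s) (u \<odot> d)" by (rule ip_commute)
    also have "\<dots> = ip (u\<^sup>\<star> \<odot> (u \<odot> s)) d" using assms by (simp add: ip_mul_left)
    finally show ?thesis by (simp add: ip_simps)
  qed
  have lower: "ip ?X d = 0" if "d\<^sup>\<star> \<in> T" for d
  proof -
    have "trc (((u\<^sup>\<star> \<odot> u) \<odot> s) \<odot> d\<^sup>\<star>) = trc (u\<^sup>\<star> \<odot> (u \<odot> (s \<odot> d\<^sup>\<star>)))" by (simp only: trc_assoc)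
    also have "u \<odot> (s \<odot> d\<^sup>\<star>) = (u \<odot> s) \<odot> d\<^sup>\<star>" using T_assoc[OF assms that] by simp
    also have "trc (u\<^sup>\<star> \<odot> ((u \<odot> s) \<odot> d\<^sup>\<star>)) = trc ((u\<^sup>\<star> \<odot> (u \<odot> s)) \<odot> d\<^sup>\<star>)" by (simp only: trc_assoc)
    finally have "ip ((u\<^sup>\<star> \<odot> u) \<odot> s) d = ip (u\<^sup>\<star> \<odot> (u \<odot> s)) d" by (simp only: ip_def)
    then show ?thesis by (simp add: ip_simps)
  qed
  have "?X = 0" by (rule orthogonal_triangular_eq_0) (use upper lower in simp_all)
  then show ?thesis by simp
qed

lemma entry_assoc_antitone:
  assumes "j \<le> i" "k \<le> j" "l \<le> k"
  shows "entry i j a \<odot> (entry j k b \<odot> entry k l c) = (entry i j a \<odot> entry j k b) \<odot> entry k l c"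
proof -
  have "(entry i j a \<odot> (entry j k b \<odot> entry k l c))\<^sup>\<star> = ((entry i j a \<odot> entry j k b) \<odot> entry k l c)\<^sup>\<star>"
    unfolding str_mul entry_str[symmetric] using assms by (simp add: entry_assoc)
  then show ?thesis unfolding str_eq_iff[OF mul_carrier mul_carrier] .
qed

text \<open>
  Up to an adjoint this is the \<open>(l, i)\<close> entry of \<open>lower_assoc\<close> for \<open>u = x + y\<close>. If \<open>l \<noteq> j\<close>, the terms other
  than \<open>(x\<^sup>*x)s\<close> and \<open>(y\<^sup>*x)s\<close> vanish for index reasons; if \<open>l = j\<close>, then \<open>x = y\<close>.
\<close>

lemma entry_assoc_str_antitone:
  assumes "j \<le> i" "k \<le> j" "k \<le> l"
  shows "entry i j a \<odot> (entry j k b \<odot> entry k l (b\<^sup>\<star>)) = (entry i j a \<odot> entry j k b) \<odot> entry k l (b\<^sup>\<star>)"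
proof -
  define x where "x = entry k j (b\<^sup>\<star>)"
  define y where "y = entry k l (b\<^sup>\<star>)"
  define s where "s = entry j i (a\<^sup>\<star>)"
  have T: "x \<in> T" "y \<in> T" "s \<in> T"
    using assms by (auto simp: x_def y_def s_def T_iff entry_entry)
  have xs: "x\<^sup>\<star> = entry j k (b\<^sup>\<star>\<^sup>\<star>)" "y\<^sup>\<star> = entry l k (b\<^sup>\<star>\<^sup>\<star>)" by (simp_all add: x_def y_def entry_str)
  have key: "(y\<^sup>\<star> \<odot> x) \<odot> s = y\<^sup>\<star> \<odot> (x \<odot> s)"
  proof (cases "l = j")
    case True
    then have "y = x" by (simp add: x_def y_def)
    then show ?thesis using lower_assoc[OF T(1,3)] by simp
  next
    case False
    have z: "y \<odot> s = 0" using False unfolding y_def s_def by (simp add: mul_entries_neq)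
    have "(x\<^sup>\<star> \<odot> y) \<odot> s = 0"
      unfolding xs unfolding y_def s_def
      by (subst mul_entries) (simp add: mul_entries_neq False)
    moreover have "(y\<^sup>\<star> \<odot> y) \<odot> s = 0"
      unfolding xs unfolding y_def s_def
      by (subst mul_entries) (simp add: mul_entries_neq False)
    moreover have "((x + y)\<^sup>\<star> \<odot> (x + y)) \<odot> s = (x + y)\<^sup>\<star> \<odot> ((x + y) \<odot> s)"
      using T by (intro lower_assoc) simp_all
    ultimately show ?thesis
      using lower_assoc[OF T(1,3)] z by (simp add: str_simps mul_simps)
  qed
  have lhs: "(entry i j a \<odot> (entry j k b \<odot> entry k l (b\<^sup>\<star>)))\<^sup>\<star> = (y\<^sup>\<star> \<odot> x) \<odot> s"
    by (simp add: str_mul x_def y_def s_def entry_str)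
  have rhs: "((entry i j a \<odot> entry j k b) \<odot> entry k l (b\<^sup>\<star>))\<^sup>\<star> = y\<^sup>\<star> \<odot> (x \<odot> s)"
    by (simp add: str_mul x_def y_def s_def entry_str)
  have "(entry i j a \<odot> (entry j k b \<odot> entry k l (b\<^sup>\<star>)))\<^sup>\<star>
      = ((entry i j a \<odot> entry j k b) \<odot> entry k l (b\<^sup>\<star>))\<^sup>\<star>"
    unfolding lhs rhs by (rule key)
  then show ?thesis unfolding str_eq_iff[OF mul_carrier mul_carrier] .
qed

end

section \<open>Subalgebras and renumbering\<close>

text \<open>
  The blocks with indices in the range of \<open>\<sigma>\<close>, renumbered along \<open>\<sigma>\<close> and carried to another space by
  \<open>\<phi>\<close>. An increasing \<open>\<sigma>\<close> produces the T-algebras that describe faces, a decreasing one the T-algebra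
  that describes the dual cone.
\<close>

locale t_algebra_transport = t_algebra A
  for A :: "'a::real_vector matrix_alg" +
  fixes m :: nat and \<sigma> :: "nat \<Rightarrow> nat" and \<phi> :: "'a \<Rightarrow> 'b::real_vector" and \<psi> :: "'b \<Rightarrow> 'a"
  assumes \<sigma>: "inj_on \<sigma> {1..m}" "\<sigma> ` {1..m} \<subseteq> indices A"
    and monotone: "(\<forall>i\<in>{1..m}. \<forall>j\<in>{1..m}. i \<le> j \<longrightarrow> \<sigma> i \<le> \<sigma> j) \<or>
                   (\<forall>i\<in>{1..m}. \<forall>j\<in>{1..m}. i \<le> j \<longrightarrow> \<sigma> j \<le> \<sigma> i)"
    and \<phi>: "linear \<phi>" and \<psi>: "linear \<psi>" and inv: "\<And>x. x \<in> carrier_of A \<Longrightarrow> \<psi> (\<phi> x) = x"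
begin

definition B :: "'b matrix_alg" where
  "B = \<lparr>alg_rank = m, block = \<lambda>i j. \<phi> ` block A (\<sigma> i) (\<sigma> j),
    amult = \<lambda>x y. \<phi> (amult A (\<psi> x) (\<psi> y)), star = \<lambda>x. \<phi> (star A (\<psi> x)),
    rho = \<lambda>i x. rho A (\<sigma> i) (\<psi> x)\<rparr>"

definition J where "J = \<sigma> ` {1..m}"

definition S where "S = {x \<in> C. \<forall>i j. \<not> (i \<in> J \<and> j \<in> J) \<longrightarrow> entry i j x = 0}"

lemma indices_B: "indices B = {1..m}"
  by (simp add: indices_def B_def)

lemma J_I: "J \<subseteq> I" using \<sigma>(2) by (simp add: J_def)

lemma \<sigma>_J: "i \<in> indices B \<Longrightarrow> \<sigma> i \<in> J" and \<sigma>_I: "i \<in> indices B \<Longrightarrow> \<sigma> i \<in> I"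
  using \<sigma>(2) by (auto simp: J_def indices_B)

lemma \<sigma>_eq: "i \<in> indices B \<Longrightarrow> j \<in> indices B \<Longrightarrow> \<sigma> i = \<sigma> j \<longleftrightarrow> i = j"
  unfolding indices_B by (rule inj_on_eq_iff[OF \<sigma>(1)])

lemma S_carrier: "x \<in> S \<Longrightarrow> x \<in> C"
  unfolding S_def by blast

lemma S_entry: "\<not> (i \<in> J \<and> j \<in> J) \<Longrightarrow> x \<in> S \<Longrightarrow> entry i j x = 0"
  unfolding S_def by blast

lemma S_I: "x \<in> C \<Longrightarrow> (\<And>i j. \<not> (i \<in> J \<and> j \<in> J) \<Longrightarrow> entry i j x = 0) \<Longrightarrow> x \<in> S"
  unfolding S_def by blast

lemma subspace_S: "subspace S"
proof (rule subspaceI)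
  show "0 \<in> S" by (rule S_I) simp_all
  show "x + y \<in> S" if "x \<in> S" "y \<in> S" for x y
  proof (rule S_I)
    fix i j assume n: "\<not> (i \<in> J \<and> j \<in> J)"
    show "entry i j (x + y) = 0"
      unfolding entry_simps S_entry[OF n that(1)] S_entry[OF n that(2)] by simp
  qed (intro carrier_simps S_carrier that)
  show "c *\<^sub>R x \<in> S" if "x \<in> S" for x c
  proof (rule S_I)
    fix i j assume n: "\<not> (i \<in> J \<and> j \<in> J)"
    show "entry i j (c *\<^sub>R x) = 0" unfolding entry_simps S_entry[OF n that] by simp
  qed (intro carrier_simps S_carrier that)
qed

lemma S_mul: "a \<in> S \<Longrightarrow> b \<in> S \<Longrightarrow> a \<odot> b \<in> S"
proof -
  assume ab: "a \<in> S" "b \<in> S"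
  have "entry i k (a \<odot> b) = 0" if "\<not> (i \<in> J \<and> k \<in> J)" for i k
    unfolding entry_mul
  proof (intro sum.neutral ballI)
    fix j
    have "entry i j a = 0 \<or> entry j k b = 0" using S_entry ab that by blast
    then show "entry i j a \<odot> entry j k b = 0" by auto
  qed
  then show ?thesis using S_I[OF mul_carrier] by blast
qed

lemma S_str: "a \<in> S \<Longrightarrow> a\<^sup>\<star> \<in> S"
proof (rule S_I[OF str_carrier])
  fix i j assume "a \<in> S" "\<not> (i \<in> J \<and> j \<in> J)"
  then have "entry j i a = 0" using S_entry by blast
  then show "entry i j (a\<^sup>\<star>) = 0" by (simp add: entry_str)
qed

lemma amult_B: "a \<in> C \<Longrightarrow> b \<in> C \<Longrightarrow> amult B (\<phi> a) (\<phi> b) = \<phi> (a \<odot> b)"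
  by (simp add: B_def inv mul_carrier_eq)

lemma star_B: "a \<in> C \<Longrightarrow> star B (\<phi> a) = \<phi> (a\<^sup>\<star>)"
  by (simp add: B_def inv str_carrier_eq)

lemma rho_B: "a \<in> C \<Longrightarrow> rho B i (\<phi> a) = rho A (\<sigma> i) a"
  by (simp add: B_def inv)

lemma block_B: "block B i j = \<phi> ` block A (\<sigma> i) (\<sigma> j)"
  by (simp add: B_def)

lemma block_S: "i \<in> indices B \<Longrightarrow> j \<in> indices B \<Longrightarrow> x \<in> block A (\<sigma> i) (\<sigma> j) \<Longrightarrow> x \<in> S"
proof (rule S_I)
  assume *: "i \<in> indices B" "j \<in> indices B" "x \<in> block A (\<sigma> i) (\<sigma> j)"
  show "x \<in> C" by (rule block_carrier[OF \<sigma>_I[OF *(1)] \<sigma>_I[OF *(2)] *(3)])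
  show "entry p q x = 0" if "\<not> (p \<in> J \<and> q \<in> J)" for p q
    using entry_of_block[OF \<sigma>_I[OF *(1)] \<sigma>_I[OF *(2)] *(3), of p q] \<sigma>_J[OF *(1)] \<sigma>_J[OF *(2)] that by auto
qed

lemma \<phi>_inj: "a \<in> C \<Longrightarrow> b \<in> C \<Longrightarrow> \<phi> a = \<phi> b \<longleftrightarrow> a = b"
proof -
  assume ab: "a \<in> C" "b \<in> C"
  show ?thesis using arg_cong[of "\<phi> a" "\<phi> b" \<psi>] unfolding inv[OF ab(1)] inv[OF ab(2)] by blast
qed

text \<open>
  A family of blocks is recovered from its sum by taking components of the preimage; this gives
  directness and the components at once.
\<close>

lemma family_B:
  assumes x: "block_family B x"
  shows "family_sum B x \<in> \<phi> ` S"
    and "i \<in> indices B \<Longrightarrow> j \<in> indices B \<Longrightarrow> x i j = \<phi> (entry (\<sigma> i) (\<sigma> j) (\<psi> (family_sum B x)))"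
proof -
  have b: "\<exists>z. z \<in> block A (\<sigma> i) (\<sigma> j) \<and> x i j = \<phi> z" if "i \<in> indices B" "j \<in> indices B" for i j
  proof -
    have "x i j \<in> block B i j" using x that unfolding block_family_def by meson
    then show ?thesis by (auto simp: block_B)
  qed
  define z where "z i j = (SOME z. z \<in> block A (\<sigma> i) (\<sigma> j) \<and> x i j = \<phi> z)" for i j
  have z: "z i j \<in> block A (\<sigma> i) (\<sigma> j)" "x i j = \<phi> (z i j)" if "i \<in> indices B" "j \<in> indices B" for i j
    using someI_ex[OF b[OF that]] unfolding z_def by blast+
  define w where "w = (\<Sum>i\<in>indices B. \<Sum>j\<in>indices B. z i j)"
  have zS: "z i j \<in> S" if "i \<in> indices B" "j \<in> indices B" for i j
    by (rule block_S[OF that z(1)[OF that]])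
  have wS: "w \<in> S"
    unfolding w_def by (rule subspace_sum[OF subspace_S], rule subspace_sum[OF subspace_S], rule zS)
  have fw: "family_sum B x = \<phi> w"
    unfolding family_sum_def w_def linear_sum[OF \<phi>] by (intro sum.cong refl z)
  then show "family_sum B x \<in> \<phi> ` S" using wS by blast
  assume ij: "i \<in> indices B" "j \<in> indices B"
  have fin: "finite (indices B)" by (simp add: indices_B)
  have "entry (\<sigma> i) (\<sigma> j) w = (\<Sum>p\<in>indices B. \<Sum>q\<in>indices B. entry (\<sigma> i) (\<sigma> j) (z p q))"
    unfolding w_def entry_sum ..
  also have "\<dots> = (\<Sum>p\<in>indices B. \<Sum>q\<in>indices B. if q = j then (if p = i then z i j else 0) else 0)"
    by (intro sum.cong refl) (use ij in \<open>auto simp: entry_of_block[OF \<sigma>_I \<sigma>_I z(1)] \<sigma>_eq\<close>)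
  also have "\<dots> = z i j" using ij fin by simp
  finally show "x i j = \<phi> (entry (\<sigma> i) (\<sigma> j) (\<psi> (family_sum B x)))"
    unfolding fw inv[OF S_carrier[OF wS]] using z(2)[OF ij] by simp
qed

lemma family_of_S:
  assumes "z \<in> S"
  shows "block_family B (\<lambda>i j. if i \<in> indices B \<and> j \<in> indices B then \<phi> (entry (\<sigma> i) (\<sigma> j) z) else 0)"
    and "family_sum B (\<lambda>i j. if i \<in> indices B \<and> j \<in> indices B then \<phi> (entry (\<sigma> i) (\<sigma> j) z) else 0) = \<phi> z"
proof -
  show "block_family B (\<lambda>i j. if i \<in> indices B \<and> j \<in> indices B then \<phi> (entry (\<sigma> i) (\<sigma> j) z) else 0)"
    by (auto simp: block_family_def block_B intro: entry_block \<sigma>_I)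
  have inj: "inj_on \<sigma> (indices B)" "\<sigma> ` indices B = J" using \<sigma>(1) by (simp_all add: indices_B J_def)
  have "(\<Sum>i\<in>indices B. \<Sum>j\<in>indices B. entry (\<sigma> i) (\<sigma> j) z) = (\<Sum>i\<in>J. \<Sum>j\<in>J. entry i j z)"
    unfolding inj(2)[symmetric] by (simp add: sum.reindex[OF inj(1)])
  also have "\<dots> = (\<Sum>i\<in>J. \<Sum>j\<in>I. entry i j z)"
    by (intro sum.cong refl sum.mono_neutral_left finite_I J_I) (use S_entry[OF _ assms] in blast)
  also have "\<dots> = (\<Sum>i\<in>I. \<Sum>j\<in>I. entry i j z)"
    by (intro sum.mono_neutral_left finite_I J_I) (use S_entry[OF _ assms] in \<open>auto intro!: sum.neutral\<close>)
  also have "\<dots> = z" by (rule sum_entries[OF S_carrier[OF assms]])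
  finally have "\<phi> (\<Sum>i\<in>indices B. \<Sum>j\<in>indices B. entry (\<sigma> i) (\<sigma> j) z) = \<phi> z" by simp
  then show "family_sum B (\<lambda>i j. if i \<in> indices B \<and> j \<in> indices B then \<phi> (entry (\<sigma> i) (\<sigma> j) z) else 0) = \<phi> z"
    unfolding family_sum_def linear_sum[OF \<phi>] by simp
qed

lemma carrier_B: "carrier_of B = \<phi> ` S"
proof
  show "carrier_of B \<subseteq> \<phi> ` S" using family_B(1) by (auto simp: carrier_of_def)
  show "\<phi> ` S \<subseteq> carrier_of B"
  proof
    fix y assume "y \<in> \<phi> ` S"
    then obtain z where z: "z \<in> S" and y: "y = \<phi> z" by blast
    have "family_sum B f \<in> carrier_of B" if "block_family B f" for f
      using that unfolding carrier_of_def by blast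
    from this[OF family_of_S(1)[OF z]] show "y \<in> carrier_of B"
      unfolding family_of_S(2)[OF z] y .
  qed
qed

lemma direct_B:
  assumes "block_family B x" "block_family B y" "family_sum B x = family_sum B y"
  shows "x = y"
proof (intro ext)
  fix i j
  show "x i j = y i j"
  proof (cases "i \<in> indices B \<and> j \<in> indices B")
    case True
    then have ij: "i \<in> indices B" "j \<in> indices B" by blast+
    have "x i j = \<phi> (entry (\<sigma> i) (\<sigma> j) (\<psi> (family_sum B x)))" by (rule family_B(2)[OF assms(1) ij])
    also have "\<dots> = y i j" unfolding assms(3) by (rule family_B(2)[OF assms(2) ij, symmetric])
    finally show ?thesis .
  next
    case False
    have "x i j = 0" using assms(1) False unfolding block_family_def by meson
    moreover have "y i j = 0" using assms(2) False unfolding block_family_def by meson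
    ultimately show ?thesis by simp
  qed
qed

lemma component_B:
  assumes "z \<in> S" "i \<in> indices B" "j \<in> indices B"
  shows "component B (\<phi> z) i j = \<phi> (entry (\<sigma> i) (\<sigma> j) z)"
proof -
  let ?f = "\<lambda>i j. if i \<in> indices B \<and> j \<in> indices B then \<phi> (entry (\<sigma> i) (\<sigma> j) z) else 0"
  note f = family_of_S[OF assms(1)]
  have "component B (\<phi> z) = ?f"
    unfolding component_def
  proof (rule the_equality)
    show "block_family B ?f \<and> family_sum B ?f = \<phi> z" using f by blast
    fix x assume x: "block_family B x \<and> family_sum B x = \<phi> z"
    show "x = ?f" by (rule direct_B[OF conjunct1[OF x] f(1)]) (simp only: f(2) x)
  qed
  from fun_cong[OF fun_cong[OF this, of i], of j] show ?thesis by (simp only: assms if_True simp_thms)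
qed

lemma matrix_algebra_B: "matrix_algebra_with_involution B"
  unfolding matrix_algebra_with_involution_def
proof (intro conjI)
  show "\<forall>i\<in>indices B. \<forall>j\<in>indices B. subspace (block B i j)"
    using \<sigma>_I by (auto simp: block_B intro!: linear_subspace_image[OF \<phi>] subspace_block)
  obtain D where D: "finite D" "C \<subseteq> span D" using ax_finite by blast
  have "\<phi> ` S \<subseteq> span (\<phi> ` D)"
    using D(2) S_carrier by (auto simp: linear_span_image[OF \<phi>])
  then show "\<exists>D. finite D \<and> carrier_of B \<subseteq> span D" using D(1) by (auto simp: carrier_B)
  show "\<forall>x y. block_family B x \<and> block_family B y \<and> family_sum B x = family_sum B y \<longrightarrow> x = y"
    using direct_B by blast
  show "\<forall>a\<in>carrier_of B. \<forall>b\<in>carrier_of B. amult B a b \<in> carrier_of B"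
    by (auto simp: carrier_B amult_B S_carrier intro!: imageI S_mul)
  have add: "\<phi> a + \<phi> b = \<phi> (a + b)" "c *\<^sub>R \<phi> a = \<phi> (c *\<^sub>R a)" for a b c
    by (simp_all add: linear_add[OF \<phi>] linear_scale[OF \<phi>])
  show "\<forall>a\<in>carrier_of B. linear_map_on (carrier_of B) (\<lambda>b. amult B a b)"
    "\<forall>b\<in>carrier_of B. linear_map_on (carrier_of B) (\<lambda>a. amult B a b)"
    by (auto simp: linear_map_on_def carrier_B add amult_B S_carrier mul_simps)
  show "linear_map_on (carrier_of B) (star B)"
    by (auto simp: linear_map_on_def carrier_B add star_B S_carrier str_simps)
  show "\<forall>i\<in>indices B. \<forall>j\<in>indices B. \<forall>k\<in>indices B. \<forall>a\<in>block B i j. \<forall>b\<in>block B j k. amult B a b \<in> block B i k"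
  proof (intro ballI)
    fix i j k a b assume *: "i \<in> indices B" "j \<in> indices B" "k \<in> indices B" "a \<in> block B i j" "b \<in> block B j k"
    then obtain x y where xy: "a = \<phi> x" "b = \<phi> y" "x \<in> block A (\<sigma> i) (\<sigma> j)" "y \<in> block A (\<sigma> j) (\<sigma> k)"
      by (auto simp: block_B)
    have C: "x \<in> C" "y \<in> C" using xy * S_carrier block_S by blast+
    have "amult A x y \<in> block A (\<sigma> i) (\<sigma> k)" using ax_block_mul xy \<sigma>_I * by blast
    then show "amult B a b \<in> block B i k" by (simp add: xy amult_B C block_B mul_carrier_eq)
  qed
  show "\<forall>i\<in>indices B. \<forall>j\<in>indices B. \<forall>k\<in>indices B. \<forall>l\<in>indices B. j \<noteq> k \<longrightarrow>
        (\<forall>a\<in>block B i j. \<forall>b\<in>block B k l. amult B a b = 0)"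
  proof (intro ballI impI)
    fix i j k l a b assume *: "i \<in> indices B" "j \<in> indices B" "k \<in> indices B" "l \<in> indices B" "j \<noteq> k"
      "a \<in> block B i j" "b \<in> block B k l"
    then obtain x y where xy: "a = \<phi> x" "b = \<phi> y" "x \<in> block A (\<sigma> i) (\<sigma> j)" "y \<in> block A (\<sigma> k) (\<sigma> l)"
      by (auto simp: block_B)
    have C: "x \<in> C" "y \<in> C" using xy * S_carrier block_S by blast+
    have "\<sigma> j \<noteq> \<sigma> k" using * \<sigma>_eq by simp
    then have "amult A x y = 0" using ax_block_mul_zero xy \<sigma>_I * by blast
    then show "amult B a b = 0" by (simp add: xy amult_B C mul_carrier_eq[symmetric] linear_0[OF \<phi>])
  qed
  show "\<forall>a\<in>carrier_of B. star B (star B a) = a"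
    by (auto simp: carrier_B star_B S_carrier)
  have "star B ` carrier_of B \<subseteq> carrier_of B"
    by (auto simp: carrier_B star_B S_carrier S_str)
  then show "bij_betw (star B) (carrier_of B) (carrier_of B)"
    by (intro bij_betw_byWitness[where f' = "star B"]) (auto simp: carrier_B star_B S_carrier)
  show "\<forall>a\<in>carrier_of B. \<forall>b\<in>carrier_of B. star B (amult B a b) = amult B (star B b) (star B a)"
    by (auto simp: carrier_B star_B amult_B S_carrier str_mul)
  show "\<forall>i\<in>indices B. \<forall>j\<in>indices B. star B ` block B i j = block B j i"
  proof (intro ballI)
    fix i j assume ij: "i \<in> indices B" "j \<in> indices B"
    have "star B ` block B i j = (\<lambda>x. \<phi> (star A x)) ` block A (\<sigma> i) (\<sigma> j)"
      unfolding block_B image_image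
      by (intro image_cong refl) (use block_S[OF ij] S_carrier in \<open>simp add: star_B str_carrier_eq\<close>)
    also have "\<dots> = \<phi> ` (star A ` block A (\<sigma> i) (\<sigma> j))" by (simp add: image_image)
    also have "\<dots> = block B j i" using ax_star_block ij \<sigma>_I by (simp add: block_B)
    finally show "star B ` block B i j = block B j i" .
  qed
qed

lemma tr_B: "z \<in> S \<Longrightarrow> tr B (\<phi> z) = trc z"
proof -
  assume z: "z \<in> S"
  have inj: "inj_on \<sigma> (indices B)" "\<sigma> ` indices B = J" using \<sigma>(1) by (simp_all add: indices_B J_def)
  have "tr B (\<phi> z) = (\<Sum>i\<in>indices B. diag (\<sigma> i) z)"
    unfolding tr_def by (intro sum.cong refl) (simp add: component_B z rho_B diag_def \<sigma>_I)
  also have "\<dots> = (\<Sum>i\<in>J. diag i z)" unfolding inj(2)[symmetric] by (simp add: sum.reindex[OF inj(1)])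
  also have "\<dots> = trc z" unfolding trc_def
  proof (intro sum.mono_neutral_left finite_I J_I ballI)
    fix i assume "i \<in> I - J"
    then show "diag i z = 0" using S_entry[OF _ z, of i i] diag_entry[of i i i z] by simp
  qed
  finally show ?thesis .
qed

lemma unit_B: "i \<in> indices B \<Longrightarrow> unit_of B i = \<phi> (unit (\<sigma> i))"
proof -
  assume i: "i \<in> indices B"
  have b: "inj_on (rho A (\<sigma> i)) (block A (\<sigma> i) (\<sigma> i))" using ax1 \<sigma>_I[OF i] by (auto simp: bij_betw_def)
  have "inj_on (rho B i) (block B i i)"
  proof (rule inj_onI)
    fix x y assume xy: "x \<in> block B i i" "y \<in> block B i i" "rho B i x = rho B i y"
    then obtain p q where "x = \<phi> p" "y = \<phi> q" "p \<in> block A (\<sigma> i) (\<sigma> i)" "q \<in> block A (\<sigma> i) (\<sigma> i)"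
      by (auto simp: block_B)
    then show "x = y" using xy(3) b block_S[OF i i] S_carrier by (auto simp: rho_B dest: inj_onD)
  qed
  then show ?thesis unfolding unit_of_def[of B]
    using unit_block[OF \<sigma>_I[OF i]] rho_unit[OF \<sigma>_I[OF i]] unit_carrier[OF \<sigma>_I[OF i]]
    by (intro the_inv_into_f_eq) (auto simp: block_B rho_B)
qed

lemma monotone_cases:
  "i \<in> indices B \<Longrightarrow> j \<in> indices B \<Longrightarrow> k \<in> indices B \<Longrightarrow> l \<in> indices B \<Longrightarrow> i \<le> j \<Longrightarrow> j \<le> k \<Longrightarrow> k \<le> l \<Longrightarrow>
    \<sigma> i \<le> \<sigma> j \<and> \<sigma> j \<le> \<sigma> k \<and> \<sigma> k \<le> \<sigma> l \<or> \<sigma> j \<le> \<sigma> i \<and> \<sigma> k \<le> \<sigma> j \<and> \<sigma> l \<le> \<sigma> k"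
  "i \<in> indices B \<Longrightarrow> j \<in> indices B \<Longrightarrow> k \<in> indices B \<Longrightarrow> l \<in> indices B \<Longrightarrow> i \<le> j \<Longrightarrow> j \<le> k \<Longrightarrow> l \<le> k \<Longrightarrow>
    \<sigma> i \<le> \<sigma> j \<and> \<sigma> j \<le> \<sigma> k \<and> \<sigma> l \<le> \<sigma> k \<or> \<sigma> j \<le> \<sigma> i \<and> \<sigma> k \<le> \<sigma> j \<and> \<sigma> k \<le> \<sigma> l"
  using monotone unfolding indices_B by blast+

theorem T_algebra_B: "T_algebra B"
  unfolding T_algebra_def
proof (intro conjI)
  show "matrix_algebra_with_involution B" by (rule matrix_algebra_B)
  have add: "\<phi> a + \<phi> b = \<phi> (a + b)" "c *\<^sub>R \<phi> a = \<phi> (c *\<^sub>R a)" for a b c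
    by (simp_all add: linear_add[OF \<phi>] linear_scale[OF \<phi>])
  show "\<forall>i\<in>indices B. bij_betw (rho B i) (block B i i) UNIV \<and> linear_map_on (block B i i) (rho B i) \<and>
        (\<forall>a\<in>block B i i. \<forall>b\<in>block B i i. rho B i (amult B a b) = rho B i a * rho B i b)"
  proof (intro ballI conjI)
    fix i assume i: "i \<in> indices B"
    have C: "x \<in> C" if "x \<in> block A (\<sigma> i) (\<sigma> i)" for x using block_carrier[OF \<sigma>_I[OF i] \<sigma>_I[OF i] that] .
    have b: "bij_betw (rho A (\<sigma> i)) (block A (\<sigma> i) (\<sigma> i)) UNIV" using ax1 \<sigma>_I[OF i] by blast
    have "bij_betw \<psi> (block B i i) (block A (\<sigma> i) (\<sigma> i))"
      by (rule bij_betw_byWitness[where f' = \<phi>]) (auto simp: block_B inv C)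
    from bij_betw_trans[OF this b] show "bij_betw (rho B i) (block B i i) UNIV"
      by (simp add: B_def comp_def)
    show "linear_map_on (block B i i) (rho B i)"
      using rho_linear[OF \<sigma>_I[OF i]] by (auto simp: linear_map_on_def block_B add rho_B C)
    fix a b assume "a \<in> block B i i" "b \<in> block B i i"
    then obtain x y where xy: "a = \<phi> x" "b = \<phi> y" "x \<in> block A (\<sigma> i) (\<sigma> i)" "y \<in> block A (\<sigma> i) (\<sigma> i)"
      by (auto simp: block_B)
    have "rho A (\<sigma> i) (amult A x y) = rho A (\<sigma> i) x * rho A (\<sigma> i) y" using ax1 \<sigma>_I[OF i] xy by blast
    then show "rho B i (amult B a b) = rho B i a * rho B i b"
      by (simp add: xy(1,2) amult_B rho_B C xy(3,4) mul_carrier_eq)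
  qed
  show "\<forall>a\<in>carrier_of B. \<forall>i\<in>indices B. \<forall>j\<in>indices B. amult B (unit_of B i) (component B a i j) = component B a i j \<and>
        amult B (component B a j i) (unit_of B i) = component B a j i"
    by (auto simp: carrier_B component_B unit_B amult_B unit_carrier \<sigma>_I unit_mul_entry entry_mul_unit)
  show "\<forall>a\<in>carrier_of B. \<forall>b\<in>carrier_of B. tr B (amult B a b) = tr B (amult B b a)"
    by (auto simp: carrier_B amult_B S_carrier tr_B S_mul trc_comm)
  show "\<forall>a\<in>carrier_of B. \<forall>b\<in>carrier_of B. \<forall>c\<in>carrier_of B.
      tr B (amult B (amult B a b) c) = tr B (amult B a (amult B b c))"
    by (auto simp: carrier_B amult_B S_carrier tr_B S_mul trc_assoc)
  have "tr B (amult B (\<phi> z) (star B (\<phi> z))) = ip z z" if "z \<in> S" for z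
    using that by (simp add: star_B amult_B S_carrier tr_B S_mul S_str ip_def)
  moreover have "\<phi> z = 0 \<longleftrightarrow> z = 0" if "z \<in> S" for z
    using \<phi>_inj[OF S_carrier[OF that], of 0] linear_0[OF \<phi>] by simp
  ultimately show "\<forall>a\<in>carrier_of B. tr B (amult B a (star B a)) \<ge> 0 \<and> (tr B (amult B a (star B a)) = 0 \<longleftrightarrow> a = 0)"
    using ip_nonneg ip_eq_0 S_carrier unfolding carrier_B by simp
  show "\<forall>a\<in>carrier_of B. \<forall>b\<in>carrier_of B. \<forall>c\<in>carrier_of B. \<forall>i\<in>indices B. \<forall>j\<in>indices B. \<forall>k\<in>indices B. \<forall>l\<in>indices B.
      i \<le> j \<and> j \<le> k \<and> k \<le> l \<longrightarrow>
          amult B (component B a i j) (amult B (component B b j k) (component B c k l)) =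
          amult B (amult B (component B a i j) (component B b j k)) (component B c k l)"
  proof (intro ballI impI)
    fix a b c i j k l assume "a \<in> carrier_of B" "b \<in> carrier_of B" "c \<in> carrier_of B"
      and ijkl: "i \<in> indices B" "j \<in> indices B" "k \<in> indices B" "l \<in> indices B" and o: "i \<le> j \<and> j \<le> k \<and> k \<le> l"
    then obtain x y z where xyz: "a = \<phi> x" "b = \<phi> y" "c = \<phi> z" "x \<in> S" "y \<in> S" "z \<in> S"
      by (auto simp: carrier_B)
    have "entry (\<sigma> i) (\<sigma> j) x \<odot> (entry (\<sigma> j) (\<sigma> k) y \<odot> entry (\<sigma> k) (\<sigma> l) z) =
        (entry (\<sigma> i) (\<sigma> j) x \<odot> entry (\<sigma> j) (\<sigma> k) y) \<odot> entry (\<sigma> k) (\<sigma> l) z"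
      using monotone_cases(1)[OF ijkl] o entry_assoc entry_assoc_antitone by metis
    then show "amult B (component B a i j) (amult B (component B b j k) (component B c k l)) =
          amult B (amult B (component B a i j) (component B b j k)) (component B c k l)"
      by (simp add: xyz component_B ijkl amult_B)
  qed
  show "\<forall>a\<in>carrier_of B. \<forall>b\<in>carrier_of B. \<forall>i\<in>indices B. \<forall>j\<in>indices B. \<forall>k\<in>indices B. \<forall>l\<in>indices B.
      i \<le> j \<and> j \<le> k \<and> l \<le> k \<longrightarrow>
          amult B (component B a i j) (amult B (component B b j k) (star B (component B b l k))) =
          amult B (amult B (component B a i j) (component B b j k)) (star B (component B b l k))"
  proof (intro ballI impI)
    fix a b i j k l assume "a \<in> carrier_of B" "b \<in> carrier_of B"
      and ijkl: "i \<in> indices B" "j \<in> indices B" "k \<in> indices B" "l \<in> indices B" and o: "i \<le> j \<and> j \<le> k \<and> l \<le> k"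
    then obtain x y where xy: "a = \<phi> x" "b = \<phi> y" "x \<in> S" "y \<in> S"
      by (auto simp: carrier_B)
    have "entry (\<sigma> i) (\<sigma> j) x \<odot> (entry (\<sigma> j) (\<sigma> k) y \<odot> entry (\<sigma> k) (\<sigma> l) (y\<^sup>\<star>)) =
        (entry (\<sigma> i) (\<sigma> j) x \<odot> entry (\<sigma> j) (\<sigma> k) y) \<odot> entry (\<sigma> k) (\<sigma> l) (y\<^sup>\<star>)"
      using monotone_cases(2)[OF ijkl] o entry_assoc_str entry_assoc_str_antitone by metis
    then show "amult B (component B a i j) (amult B (component B b j k) (star B (component B b l k))) =
          amult B (amult B (component B a i j) (component B b j k)) (star B (component B b l k))"
      by (simp add: xy component_B ijkl amult_B star_B entry_str)
  qed
qed

end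

section \<open>Reversing the index order\<close>

text \<open>
  The T-algebra of the dual cone: its triangular elements are the adjoints of those of \<open>A\<close>, so its
  squares \<open>tt\<^sup>*\<close> are the \<open>u\<^sup>*u\<close> of \<open>A\<close>.
\<close>

definition reversed :: "'a::real_vector matrix_alg \<Rightarrow> 'a matrix_alg" where
  "reversed A = \<lparr>alg_rank = alg_rank A, block = \<lambda>i j. block A (Suc (alg_rank A) - i) (Suc (alg_rank A) - j),
    amult = amult A, star = star A, rho = \<lambda>i. rho A (Suc (alg_rank A) - i)\<rparr>"

context t_algebra
begin

abbreviation flip :: "nat \<Rightarrow> nat" where "flip i \<equiv> Suc (alg_rank A) - i"

lemma flip: "i \<in> I \<Longrightarrow> flip i \<in> I" "i \<in> I \<Longrightarrow> flip (flip i) = i"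
  by (auto simp: indices_def)

lemma bij_flip: "bij_betw flip I I"
  by (rule bij_betw_byWitness[where f' = flip]) (auto simp: indices_def)

lemma reversed_transport: "t_algebra_transport A (alg_rank A) flip id id"
  by unfold_locales (auto simp: indices_def inj_on_def linear_id)

lemma reversed_eq: "t_algebra_transport.B A (alg_rank A) flip id id = reversed A"
  unfolding t_algebra_transport.B_def[OF reversed_transport] reversed_def by simp

lemma T_algebra_reversed: "T_algebra (reversed A)"
  using t_algebra_transport.T_algebra_B[OF reversed_transport] unfolding reversed_eq .

lemma indices_reversed: "indices (reversed A) = I"
  by (simp add: indices_def reversed_def)

lemma reversed_S: "t_algebra_transport.S A (alg_rank A) flip = C"
proof -
  have "flip ` I = I" using bij_flip by (simp add: bij_betw_def)
  then have "flip ` {1..alg_rank A} = I" by (simp only: indices_def)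
  then show ?thesis
    unfolding t_algebra_transport.S_def[OF reversed_transport] t_algebra_transport.J_def[OF reversed_transport]
    using entry_outside by auto
qed

lemma carrier_reversed: "carrier_of (reversed A) = C"
  using t_algebra_transport.carrier_B[OF reversed_transport] unfolding reversed_eq reversed_S by simp

lemma component_reversed:
  assumes "z \<in> C" "i \<in> I" "j \<in> I"
  shows "component (reversed A) z i j = entry (flip i) (flip j) z"
  using t_algebra_transport.component_B[OF reversed_transport, of z i j] assms
  unfolding reversed_eq reversed_S indices_reversed by simp

interpretation R: t_algebra "reversed A"
  by unfold_locales (rule T_algebra_reversed)

text \<open>
  The projection depends on the carrier only. Hence product, involution and inner product of the
  reversed algebra agree with those of \<open>A\<close> everywhere.
\<close>

lemma reversed_proj: "R.proj = proj"
  unfolding R.proj_def proj_def carrier_reversed ..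

lemma reversed_mul: "R.mul = mul"
  by (intro ext) (simp add: R.mul_def mul_def reversed_proj, simp add: reversed_def)

lemma reversed_str: "R.str = str"
  by (intro ext) (simp add: R.str_def str_def reversed_proj, simp add: reversed_def)

lemma reversed_entry: "i \<in> I \<Longrightarrow> j \<in> I \<Longrightarrow> R.entry i j a = entry (flip i) (flip j) a"
  unfolding R.entry_def reversed_proj by (simp add: component_reversed proj entry_proj)

lemma reversed_diag: "i \<in> I \<Longrightarrow> R.diag i a = diag (flip i) a"
proof -
  assume i: "i \<in> I"
  have "rho (reversed A) i = rho A (flip i)" by (simp add: reversed_def)
  then show ?thesis using i flip(1)[OF i] by (simp add: R.diag_def diag_def indices_reversed reversed_entry)
qed

lemma reversed_trc: "R.trc a = trc a"
proof -
  have "R.trc a = (\<Sum>i\<in>I. diag (flip i) a)"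
    unfolding R.trc_def indices_reversed by (intro sum.cong refl reversed_diag)
  also have "\<dots> = (\<Sum>i\<in>I. diag i a)" by (rule sum.reindex_bij_betw[OF bij_flip])
  finally show ?thesis by (simp add: trc_def)
qed

lemma reversed_ip: "R.ip = ip"
  by (intro ext) (simp add: R.ip_def ip_def reversed_trc reversed_mul reversed_str)

lemma reversed_hermitian: "hermitian (reversed A) = H"
  unfolding hermitian_def carrier_reversed by (simp add: reversed_def)

lemma reversed_T: "a \<in> R.T \<longleftrightarrow> a \<in> C \<and> a\<^sup>\<star> \<in> T"
proof
  assume a: "a \<in> R.T"
  then have aC: "a \<in> C" using R.T_carrier carrier_reversed by blast
  have "entry i j (a\<^sup>\<star>) = 0" if "j < i" for i j
  proof (cases "i \<in> I \<and> j \<in> I")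
    case True
    then have "flip i < flip j" using that by (auto simp: indices_def)
    then have "R.entry (flip j) (flip i) a = 0" by (rule R.T_entry[OF a])
    then show ?thesis using True flip[of i] flip[of j] by (simp add: reversed_entry entry_str)
  qed simp
  then show "a \<in> C \<and> a\<^sup>\<star> \<in> T" using aC by (simp add: T_iff)
next
  assume a: "a \<in> C \<and> a\<^sup>\<star> \<in> T"
  have "R.entry i j a = 0" if "j < i" for i j
  proof (cases "i \<in> I \<and> j \<in> I")
    case True
    then have "flip i < flip j" using that by (auto simp: indices_def)
    then have "entry (flip j) (flip i) (a\<^sup>\<star>) = 0" using a T_entry by blast
    then have "(entry (flip i) (flip j) a)\<^sup>\<star>\<^sup>\<star> = 0" by (simp add: entry_str)
    then show ?thesis using True by (simp add: reversed_entry)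
  next
    case False
    then show ?thesis using R.entry_outside indices_reversed by blast
  qed
  then show "a \<in> R.T" using a by (simp add: R.T_iff carrier_reversed)
qed

lemma reversed_E: "J \<subseteq> I \<Longrightarrow> R.E (flip ` J) = E J"
proof -
  assume J: "J \<subseteq> I"
  have u: "unit_of (reversed A) i = unit (flip i)" for i
    by (simp add: unit_of_def reversed_def)
  have "inj_on flip J" using bij_flip J by (meson bij_betw_def inj_on_subset)
  moreover have "flip ` J \<inter> I = flip ` J" using J flip(1) by auto
  ultimately have "R.E (flip ` J) = (\<Sum>i\<in>J. unit (flip (flip i)))"
    unfolding R.E_def indices_reversed u by (simp add: sum.reindex)
  also have "\<dots> = (\<Sum>i\<in>J. unit i)" using J flip(2) by (intro sum.cong refl) (metis subsetD)
  also have "\<dots> = E J" using J by (simp add: E_def Int_absorb2)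
  finally show ?thesis .
qed

text \<open>
  \<open>cholesky\<close> for the reversed algebra, where rows become columns.
\<close>

lemma cholesky_upper:
  assumes x: "x \<in> H" and pos: "\<And>u. u \<in> T \<Longrightarrow> (\<forall>i. diag i u \<ge> 0) \<Longrightarrow> ip x (u\<^sup>\<star> \<odot> u) \<ge> 0"
  shows "\<exists>t\<in>T. x = t \<odot> t\<^sup>\<star> \<and> (\<forall>i. diag i t \<ge> 0) \<and> (\<forall>j\<in>I. diag j t = 0 \<longrightarrow> (\<forall>i. entry i j t = 0))"
proof -
  have "R.dual_nonneg x"
    unfolding R.dual_nonneg_def
  proof (intro ballI impI)
    fix a assume a: "a \<in> R.T" "\<forall>i. 0 \<le> R.diag i a"
    then have aT: "a \<in> C" "a\<^sup>\<star> \<in> T" using reversed_T by auto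
    have "diag i (a\<^sup>\<star>) \<ge> 0" for i
    proof (cases "i \<in> I")
      case True
      then show ?thesis using a(2)[rule_format, of "flip i"] reversed_diag[OF flip(1)[OF True], of a]
          flip(2)[OF True] by (simp add: diag_str)
    qed simp
    then have "ip x (a\<^sup>\<star>\<^sup>\<star> \<odot> a\<^sup>\<star>) \<ge> 0" using aT(2) by (intro pos) auto
    then show "0 \<le> R.ip (R.mul a (R.str a)) x"
      using aT(1) by (simp add: reversed_ip reversed_mul reversed_str ip_commute)
  qed
  then obtain a where a: "a \<in> R.T" "x = a\<^sup>\<star> \<odot> a" "\<forall>i. 0 \<le> R.diag i a"
    "\<forall>i\<in>I. R.diag i a = 0 \<longrightarrow> (\<forall>j. R.entry i j a = 0)"
    using R.cholesky[of x] x unfolding reversed_hermitian reversed_mul reversed_str indices_reversed by blast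
  have aT: "a \<in> C" "a\<^sup>\<star> \<in> T" using a reversed_T by auto
  have "x = a\<^sup>\<star> \<odot> a\<^sup>\<star>\<^sup>\<star>" using a(2) aT(1) by simp
  moreover have "diag i (a\<^sup>\<star>) \<ge> 0" for i
  proof (cases "i \<in> I")
    case True
    then show ?thesis using a(3)[rule_format, of "flip i"] reversed_diag[OF flip(1)[OF True], of a]
        flip(2)[OF True] by (simp add: diag_str)
  qed simp
  moreover have "entry i j (a\<^sup>\<star>) = 0" if j: "j \<in> I" and d: "diag j (a\<^sup>\<star>) = 0" for i j
  proof (cases "i \<in> I")
    case True
    have "R.diag (flip j) a = 0" using reversed_diag[OF flip(1)[OF j], of a] d flip(2)[OF j] by (simp add: diag_str)
    then have "R.entry (flip j) (flip i) a = 0" using a(4) flip(1)[OF j] by blast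
    then show ?thesis
      using reversed_entry[OF flip(1)[OF j] flip(1)[OF True], of a] flip(2)[OF j] flip(2)[OF True]
      by (simp add: entry_str)
  qed simp
  ultimately show ?thesis using aT(2) by blast
qed

end

section \<open>The closed cone and its normal form\<close>

lemma nonneg_of_perturbation:
  fixes a b c :: real
  assumes "\<And>e. e > 0 \<Longrightarrow> 0 \<le> a + e * b + e * e * c"
  shows "0 \<le> a"
proof (rule tendsto_lowerbound[of "\<lambda>e. a + e * b + e * e * c" a "at_right 0"])
  show "((\<lambda>e. a + e * b + e * e * c) \<longlongrightarrow> a) (at_right 0)"
    by (rule tendsto_eq_intros | simp)+
  show "\<forall>\<^sub>F e in at_right 0. 0 \<le> a + e * b + e * e * c"
    using assms by (auto simp: eventually_at_right_less eventually_at_filter)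
qed simp

context t_algebra
begin

text \<open>
  The closure of the cone (\<open>closure_cone\<close>); for the algebra of real symmetric matrices these are the positive
  semidefinite ones.
\<close>

definition psd :: "'a set" where "psd = {t \<odot> t\<^sup>\<star> | t. t \<in> T}"

abbreviation Tpos :: "'a set" where "Tpos \<equiv> triangular_pos A"

lemma Tpos_iff: "t \<in> Tpos \<longleftrightarrow> t \<in> T \<and> (\<forall>i\<in>I. diag i t > 0)"
proof -
  have "rho A i (component A t i i) = diag i t" if "t \<in> T" "i \<in> I" for i
    using that by (simp add: diag_def entry_carrier_eq)
  then show ?thesis unfolding triangular_pos_def T_def[symmetric] by auto
qed

lemma Tpos_T: "t \<in> Tpos \<Longrightarrow> t \<in> T"
  by (simp add: Tpos_iff)

lemma cone_of_eq: "cone_of A = {t \<odot> t\<^sup>\<star> | t. t \<in> Tpos}"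
proof -
  have eq: "amult A t (star A t) = t \<odot> t\<^sup>\<star>" if "t \<in> Tpos" for t
    using Tpos_T[OF that] by (simp add: str_carrier_eq mul_carrier_eq)
  show ?thesis unfolding cone_of_def by (intro Collect_cong) (metis eq)
qed

lemma psdI: "t \<in> T \<Longrightarrow> t \<odot> t\<^sup>\<star> \<in> psd"
  by (auto simp: psd_def)

lemma psd_H: "x \<in> psd \<Longrightarrow> x \<in> H"
  by (auto simp: psd_def H_simps)

lemma psd_pairing_nonneg: "x \<in> psd \<Longrightarrow> u \<in> T \<Longrightarrow> ip x (u\<^sup>\<star> \<odot> u) \<ge> 0"
  by (auto simp: psd_def pairing ip_nonneg)

text \<open>
  Half of the duality between squares \<open>tt\<^sup>*\<close> and \<open>u\<^sup>*u\<close>: nonnegativity is \<open>pairing\<close>, and sufficiency is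
  \<open>cholesky_upper\<close>. Convexity is visible only in this form.
\<close>

lemma psd_iff: "x \<in> psd \<longleftrightarrow> x \<in> H \<and> (\<forall>u\<in>T. ip x (u\<^sup>\<star> \<odot> u) \<ge> 0)"
  using psd_H psd_pairing_nonneg cholesky_upper psdI by metis

lemma convex_cone_psd: "convex_cone psd"
  unfolding convex_cone_iff by (auto simp: psd_iff H_simps ip_simps)

text \<open>
  Columns are corrected from left to right. A multiple of column \<open>k\<close> of \<open>E I - ug\<close> is added to \<open>u\<close>; as \<open>g\<close> is
  triangular, this leaves the columns of \<open>ug\<close> to the left of \<open>k\<close> unchanged.
\<close>

lemma left_inverse_upto:
  assumes g: "g \<in> Tpos"
  shows "\<exists>u\<in>T. \<forall>j\<in>I. j \<le> k \<longrightarrow> (\<forall>i. entry i j (u \<odot> g) = entry i j (E I))"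
proof (induction k)
  case 0
  show ?case by (rule bexI[of _ 0]) (auto simp: indices_def)
next
  case (Suc k)
  then obtain u where u: "u \<in> T" "\<And>i j. j \<in> I \<Longrightarrow> j \<le> k \<Longrightarrow> entry i j (u \<odot> g) = entry i j (E I)" by blast
  show ?case
  proof (cases "Suc k \<in> I")
    case False
    then show ?thesis using u by (intro bexI[of _ u]) (auto simp: le_Suc_eq)
  next
    case True
    let ?k = "Suc k"
    have gT: "g \<in> T" using g by (rule Tpos_T)
    have d: "diag ?k g > 0" using g True by (auto simp: Tpos_iff)
    \<comment> \<open>what is missing in column \<open>Suc k\<close>\<close>
    define w where "w = (E I - u \<odot> g) \<odot> E {?k}"
    have wT: "w \<in> T" using u(1) gT by (simp add: w_def)
    have w_entry: "entry i j w = (if j = ?k then entry i j (E I) - entry i j (u \<odot> g) else 0)" for i j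
      by (simp add: w_def entry_mul_E entry_simps)
    have wg: "entry i j (w \<odot> g) = entry i ?k w \<odot> entry ?k j g" for i j
    proof -
      have "entry i j (w \<odot> g) = (\<Sum>l\<in>I. if l = ?k then entry i ?k w \<odot> entry ?k j g else 0)"
        unfolding entry_mul by (intro sum.cong refl) (auto simp: w_entry)
      then show ?thesis using True by simp
    qed
    define v where "v = u + (1 / diag ?k g) *\<^sub>R w"
    have v_entry: "entry i j (v \<odot> g) = entry i j (u \<odot> g) + (1 / diag ?k g) *\<^sub>R (entry i ?k w \<odot> entry ?k j g)" for i j
      by (simp add: v_def mul_simps entry_simps wg)
    have "entry i j (v \<odot> g) = entry i j (E I)" if j: "j \<in> I" "j \<le> ?k" for i j
    proof (cases "j = ?k")
      case False
      then have "entry ?k j g = 0" using j by (intro T_entry[OF gT]) simp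
      then show ?thesis using u(2)[OF j(1), of i] j False unfolding v_entry by simp
    next
      case True
      have "entry i ?k w \<odot> entry ?k ?k g = diag ?k g *\<^sub>R entry i ?k w"
        using \<open>?k \<in> I\<close> by (simp add: entry_diag mul_simps entry_mul_unit)
      then show ?thesis using d unfolding v_entry True by (simp add: w_entry)
    qed
    moreover have "v \<in> T" using u(1) wT by (simp add: v_def)
    ultimately show ?thesis by blast
  qed
qed

lemma E_disjoint: "J \<inter> I = {} \<Longrightarrow> E J = 0"
  by (simp add: E_def)

lemma E_I_T_mul: "t \<in> T \<Longrightarrow> E I \<odot> t = t" "t \<in> T \<Longrightarrow> t \<odot> E I = t"
  by (simp_all add: E_I_mul)

lemma left_inverse:
  assumes g: "g \<in> Tpos"
  shows "\<exists>u\<in>Tpos. u \<odot> g = E I"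
proof -
  obtain u where u: "u \<in> T" "\<And>i j. j \<in> I \<Longrightarrow> j \<le> alg_rank A \<Longrightarrow> entry i j (u \<odot> g) = entry i j (E I)"
    using left_inverse_upto[OF g, of "alg_rank A"] by blast
  have ug: "u \<odot> g = E I" by (rule entry_eqI) (use u in \<open>simp_all add: indices_def\<close>)
  have "diag i u > 0" if i: "i \<in> I" for i
  proof -
    have "diag i u * diag i g = 1" using diag_mul[OF u(1) Tpos_T[OF g], of i] i unfolding ug by (simp add: diag_E)
    moreover have "diag i g > 0" using g i by (simp add: Tpos_iff)
    ultimately show ?thesis by (metis zero_less_mult_pos2 zero_less_one)
  qed
  then show ?thesis using u(1) ug by (auto simp: Tpos_iff)
qed

lemma inverse_exists:
  assumes g: "g \<in> Tpos"
  obtains h where "h \<in> Tpos" "h \<odot> g = E I" "g \<odot> h = E I"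
proof -
  obtain h where h: "h \<in> Tpos" "h \<odot> g = E I" using left_inverse[OF g] by blast
  obtain k where k: "k \<in> Tpos" "k \<odot> h = E I" using left_inverse[OF h(1)] by blast
  note T = Tpos_T[OF g] Tpos_T[OF h(1)] Tpos_T[OF k(1)]
  have "k = k \<odot> (h \<odot> g)" using T by (simp add: h(2) E_I_T_mul)
  also have "\<dots> = g" using T by (simp add: T_assoc[symmetric] k(2) E_I_T_mul)
  finally show ?thesis using that h k(2) by blast
qed

text \<open>
  Take \<open>t\<close> from \<open>cholesky_upper\<close>, and let \<open>J\<close> be the set of indices of its nonzero diagonal entries. The
  other columns of \<open>t\<close> vanish, and putting units on their diagonal places makes \<open>t\<close> invertible.
\<close>

lemma normal_form:
  assumes "x \<in> psd"
  obtains g J where "g \<in> Tpos" "J \<subseteq> I" "x = (g \<odot> E J) \<odot> (g \<odot> E J)\<^sup>\<star>"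
proof -
  obtain t where t: "t \<in> T" "x = t \<odot> t\<^sup>\<star>" "\<forall>i. diag i t \<ge> 0" "\<And>i j. j \<in> I \<Longrightarrow> diag j t = 0 \<Longrightarrow> entry i j t = 0"
    using cholesky_upper[of x] assms psd_iff by blast
  define J where "J = {i\<in>I. diag i t \<noteq> 0}"
  define g where "g = t + E (I - J)"
  have "diag i g > 0" if "i \<in> I" for i
    using that t(3)[rule_format, of i] by (auto simp: g_def diag_simps diag_E J_def less_le)
  then have "g \<in> Tpos" using t(1) by (simp add: Tpos_iff g_def)
  moreover have "g \<odot> E J = t"
  proof -
    have "t \<odot> E J = t"
      by (rule entry_eqI) (use t(1,4) in \<open>auto simp: entry_mul_E J_def\<close>)
    moreover have "E (I - J) \<odot> E J = 0"
      by (rule entry_eqI) (auto simp: entry_mul_E entry_E)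
    ultimately show ?thesis by (simp add: g_def mul_simps)
  qed
  moreover have "J \<subseteq> I" by (auto simp: J_def)
  ultimately show ?thesis using that t(2) by blast
qed

section \<open>Domination and null sets\<close>

definition null :: "'a \<Rightarrow> 'a set" where
  "null x = {u \<in> T. ip x (u\<^sup>\<star> \<odot> u) = 0}"

definition dominates :: "'a \<Rightarrow> 'a \<Rightarrow> bool" where
  "dominates x y \<longleftrightarrow> (\<exists>\<epsilon>>0. x - \<epsilon> *\<^sub>R y \<in> psd)"

lemma null_square: "t \<in> T \<Longrightarrow> null (t \<odot> t\<^sup>\<star>) = {u \<in> T. u \<odot> t = 0}"
  by (auto simp: null_def pairing ip_eq_0)

text \<open>
  The left annihilator of \<open>gE\<^sub>J\<close> is generated by the idempotent \<open>gE\<^sub>I\<^sub>-\<^sub>Jg\<^sup>-\<^sup>1\<close>.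
\<close>

lemma null_normal_form:
  assumes g: "g \<in> T" "h \<in> T" "g \<odot> h = E I" "h \<odot> g = E I" and J: "J \<subseteq> I" and u: "u \<in> T"
  shows "u \<in> null ((g \<odot> E J) \<odot> (g \<odot> E J)\<^sup>\<star>) \<longleftrightarrow> u \<odot> (g \<odot> (E (I - J) \<odot> h)) = u"
proof -
  have E: "E (I - J) = E I - E J"
    by (rule entry_eqI) (use J in \<open>auto simp: entry_E entry_simps\<close>)
  define w where "w = u \<odot> (g \<odot> E J)"
  have wT: "w \<in> T" using g u by (simp add: w_def)
  have "E (I - J) \<odot> h = h - E J \<odot> h" using g by (simp add: E mul_simps E_I_T_mul)
  then have "u \<odot> (g \<odot> (E (I - J) \<odot> h)) = u \<odot> (g \<odot> h) - u \<odot> (g \<odot> (E J \<odot> h))"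
    by (simp add: mul_simps)
  also have "u \<odot> (g \<odot> h) = u" using g u by (simp add: E_I_T_mul)
  also have "u \<odot> (g \<odot> (E J \<odot> h)) = w \<odot> h" using g u by (simp add: w_def T_assoc)
  finally have 1: "u \<odot> (g \<odot> (E (I - J) \<odot> h)) = u \<longleftrightarrow> w \<odot> h = 0" by auto
  have "w = 0" if "w \<odot> h = 0"
  proof -
    have "w = w \<odot> (h \<odot> g)" using wT g by (simp add: E_I_T_mul)
    also have "\<dots> = (w \<odot> h) \<odot> g" using wT g by (simp add: T_assoc)
    finally show ?thesis using that by simp
  qed
  then have 2: "w \<odot> h = 0 \<longleftrightarrow> w = 0" by auto
  have "g \<odot> E J \<in> T" using g by simp
  from null_square[OF this] show ?thesis using u 1 2 by (simp add: w_def)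
qed

text \<open>
  The element \<open>E\<^sub>I\<^sub>-\<^sub>Jg\<^sup>-\<^sup>1\<close> lies in the null set of \<open>(gE\<^sub>J)(gE\<^sub>J)\<^sup>*\<close>. That it annihilates \<open>t\<close> means that
  the rows of \<open>g\<^sup>-\<^sup>1t\<close> outside \<open>J\<close> vanish.
\<close>

lemma factor_of_null_subset:
  assumes g: "g \<in> Tpos" and t: "t \<in> T"
    and sub: "null ((g \<odot> E J) \<odot> (g \<odot> E J)\<^sup>\<star>) \<subseteq> null (t \<odot> t\<^sup>\<star>)"
  shows "\<exists>s\<in>T. E J \<odot> s = s \<and> t = g \<odot> s"
proof -
  obtain h where h: "h \<in> Tpos" "h \<odot> g = E I" "g \<odot> h = E I" using inverse_exists[OF g] .
  note T = Tpos_T[OF g] Tpos_T[OF h(1)]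
  have gJ: "g \<odot> E J \<in> T" using T by simp
  define s where "s = h \<odot> t"
  have sT: "s \<in> T" using T t by (simp add: s_def)
  have "(E (I - J) \<odot> h) \<odot> (g \<odot> E J) = E (I - J) \<odot> ((h \<odot> g) \<odot> E J)" using T by (simp add: T_assoc)
  also have "\<dots> = 0" unfolding h(2) E_mul_E by (rule E_disjoint) blast
  finally have "E (I - J) \<odot> h \<in> null (t \<odot> t\<^sup>\<star>)" using sub T unfolding null_square[OF gJ] by auto
  then have "(E (I - J) \<odot> h) \<odot> t = 0" unfolding null_square[OF t] by simp
  then have z: "E (I - J) \<odot> s = 0" using T_assoc[OF E_T T(2) t] by (simp add: s_def)
  have "E J \<odot> s = s"
  proof (rule entry_eqI)
    fix i j assume i: "i \<in> I" "j \<in> I"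
    have "entry i j (E (I - J) \<odot> s) = 0" unfolding z by simp
    then show "entry i j (E J \<odot> s) = entry i j s" using i by (auto simp: entry_E_mul split: if_splits)
  qed (use sT in simp_all)
  moreover have "g \<odot> s = t"
    unfolding s_def T_assoc[OF T(1,2) t, symmetric] h(3) by (rule E_I_T_mul(1)[OF t])
  ultimately show ?thesis using sT by metis
qed

text \<open>
  Domination is an inequality between the forms \<open>\<langle>x, u\<^sup>*u\<rangle>\<close> and \<open>\<langle>y, u\<^sup>*u\<rangle>\<close>, so it enlarges the null set.
  Conversely, for \<open>x = (gE\<^sub>J)(gE\<^sub>J)\<^sup>*\<close> and \<open>y = tt\<^sup>*\<close> the factorisation \<open>t = gE\<^sub>Js\<close> from \<open>factor_of_null_subset\<close> gives
  \<open>\<bar>ut\<bar>\<^sup>2 \<le> M\<bar>ugE\<^sub>J\<bar>\<^sup>2\<close>, and \<open>\<epsilon> = 1/M\<close> works.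
\<close>

lemma dominates_iff_null:
  assumes x: "x \<in> psd" and y: "y \<in> psd"
  shows "dominates x y \<longleftrightarrow> null x \<subseteq> null y"
proof
  assume "dominates x y"
  then obtain e where e: "e > 0" "x - e *\<^sub>R y \<in> psd" by (auto simp: dominates_def)
  show "null x \<subseteq> null y"
  proof
    fix u assume u: "u \<in> null x"
    then have uT: "u \<in> T" by (simp add: null_def)
    have "0 \<le> ip (x - e *\<^sub>R y) (u\<^sup>\<star> \<odot> u)" by (rule psd_pairing_nonneg[OF e(2) uT])
    also have "\<dots> = - e * ip y (u\<^sup>\<star> \<odot> u)" using u by (simp add: null_def ip_simps)
    finally have "ip y (u\<^sup>\<star> \<odot> u) \<le> 0" using e(1) by (simp add: mult_le_0_iff)
    then have "ip y (u\<^sup>\<star> \<odot> u) = 0" using psd_pairing_nonneg[OF y uT] by simp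
    then show "u \<in> null y" using uT by (simp add: null_def)
  qed
next
  assume sub: "null x \<subseteq> null y"
  obtain g J where g: "g \<in> Tpos" "J \<subseteq> I" "x = (g \<odot> E J) \<odot> (g \<odot> E J)\<^sup>\<star>" using normal_form[OF x] .
  obtain t where t: "t \<in> T" "y = t \<odot> t\<^sup>\<star>" using y by (auto simp: psd_def)
  have gT: "g \<in> T" by (rule Tpos_T[OF g(1)])
  then have gJ: "g \<odot> E J \<in> T" by simp
  obtain s where s: "s \<in> T" "E J \<odot> s = s" "t = g \<odot> s"
    using factor_of_null_subset[OF g(1) t(1), of J] sub unfolding g(3) t(2) by blast
  have sT: "s \<in> T" by (rule s(1))
  have tt: "t = (g \<odot> E J) \<odot> s" unfolding T_assoc[OF gT E_T s(1)] s(2) by (rule s(3))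
  obtain M where M: "M > 0" "\<And>u. u \<in> T \<Longrightarrow> ip (u \<odot> s) (u \<odot> s) \<le> M * ip u u"
    using right_mul_bounded[OF sT] by blast
  have "x - (1 / M) *\<^sub>R y \<in> psd"
    unfolding psd_iff
  proof (intro conjI ballI)
    show "x - (1 / M) *\<^sub>R y \<in> H" using psd_H[OF x] psd_H[OF y] by (intro H_simps)
    fix u assume u: "u \<in> T"
    have "ip y (u\<^sup>\<star> \<odot> u) = ip ((u \<odot> (g \<odot> E J)) \<odot> s) ((u \<odot> (g \<odot> E J)) \<odot> s)"
      unfolding t(2) pairing[OF t(1) u] using tt u gJ sT by (simp add: T_assoc)
    also have "\<dots> \<le> M * ip (u \<odot> (g \<odot> E J)) (u \<odot> (g \<odot> E J))" using u gJ by (intro M) simp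
    also have "\<dots> = M * ip x (u\<^sup>\<star> \<odot> u)" unfolding g(3) pairing[OF gJ u] ..
    finally show "0 \<le> ip (x - (1 / M) *\<^sub>R y) (u\<^sup>\<star> \<odot> u)" using M(1) by (simp add: ip_simps field_simps)
  qed
  then show "dominates x y" unfolding dominates_def using M(1) by (intro exI[of _ "1 / M"]) simp
qed

section \<open>The rank as length of chains\<close>

text \<open>
  If the entries vanish up to the \<open>d\<close>-th diagonal above the main one, then those of \<open>q\<^sup>2 = q\<close> vanish at least
  one diagonal further.
\<close>

lemma idempotent_zero_diag:
  assumes q: "q \<in> T" "q \<odot> q = q" "\<And>i. diag i q = 0"
  shows "q = 0"
proof -
  have z: "entry i j q = 0" if "j \<le> i + d" for i j d
    using that
  proof (induction d arbitrary: i j)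
    case 0
    then show ?case
      using T_entry[OF q(1), of j i] entry_diag[of i q] q(3)[of i] entry_outside[of i i q]
      by (cases "i = j"; cases "i \<in> I") auto
  next
    case (Suc d)
    have "entry i k q = 0 \<or> entry k j q = 0" for k
      using Suc.IH[of k i] Suc.IH[of j k] Suc.prems by (cases "k \<le> i + d") auto
    then have "entry i j (q \<odot> q) = 0" unfolding entry_mul by (intro sum.neutral ballI) (metis mul_zero)
    then show ?case using q(2) by simp
  qed
  have "entry i j q = entry i j 0" for i j using z[of j i j] by simp
  then show ?thesis using entry_eqI[OF T_carrier[OF q(1)] carrier_simps(1)] by blast
qed

lemma null_idempotent:
  assumes "x \<in> psd"
  obtains p K where "p \<in> T" "K \<subseteq> I" "\<And>u. u \<in> T \<Longrightarrow> u \<in> null x \<longleftrightarrow> u \<odot> p = u" "p \<odot> p = p"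
    "\<And>i. diag i p = (if i \<in> K then 1 else 0)"
proof -
  obtain g J where g: "g \<in> Tpos" "J \<subseteq> I" "x = (g \<odot> E J) \<odot> (g \<odot> E J)\<^sup>\<star>" using normal_form[OF assms] .
  obtain h where h: "h \<in> Tpos" "h \<odot> g = E I" "g \<odot> h = E I" using inverse_exists[OF g(1)] .
  note T = Tpos_T[OF g(1)] Tpos_T[OF h(1)]
  define p where "p = g \<odot> (E (I - J) \<odot> h)"
  have pT: "p \<in> T" using T by (simp add: p_def)
  have "p \<odot> p = g \<odot> (E (I - J) \<odot> ((h \<odot> g) \<odot> (E (I - J) \<odot> h)))" using T by (simp add: p_def T_assoc)
  also have "\<dots> = g \<odot> ((E (I - J) \<odot> E (I - J)) \<odot> h)" using T h by (simp add: E_I_T_mul T_assoc)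
  also have "\<dots> = p" by (simp add: E_mul_E p_def)
  finally have "p \<odot> p = p" .
  moreover have "diag i p = (if i \<in> I - J then 1 else 0)" for i
  proof (cases "i \<in> I")
    case True
    have "diag i g * diag i h = 1" using diag_mul[OF T, of i] True unfolding h(3) by (simp add: diag_E)
    then show ?thesis using T True by (simp add: p_def diag_mul diag_E)
  qed simp
  ultimately show ?thesis
    using that[OF pT, of "I - J"] null_normal_form[OF T h(3,2) g(2)] unfolding g(3) p_def by blast
qed

text \<open>
  The number of ones on the diagonal of an idempotent that generates the null set as a left ideal.
\<close>

definition null_rank :: "'a \<Rightarrow> nat \<Rightarrow> bool" where
  "null_rank x n \<longleftrightarrow> (\<exists>p\<in>T. \<exists>K\<subseteq>I. (\<forall>u\<in>T. u \<in> null x \<longleftrightarrow> u \<odot> p = u) \<and> p \<odot> p = p \<and>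
     (\<forall>i. diag i p = (if i \<in> K then 1 else 0)) \<and> n = card K)"

lemma null_rank_exists: "x \<in> psd \<Longrightarrow> \<exists>n. null_rank x n"
proof -
  assume "x \<in> psd"
  then obtain p K where "p \<in> T" "K \<subseteq> I" "\<And>u. u \<in> T \<Longrightarrow> u \<in> null x \<longleftrightarrow> u \<odot> p = u" "p \<odot> p = p"
    "\<And>i. diag i p = (if i \<in> K then 1 else 0)" using null_idempotent by blast
  then have "null_rank x (card K)" unfolding null_rank_def by blast
  then show ?thesis ..
qed

lemma null_rank_le: "null_rank x n \<Longrightarrow> n \<le> alg_rank A"
  using card_mono[OF finite_I] by (auto simp: null_rank_def indices_def)

text \<open>
  Let \<open>p\<close> and \<open>q\<close> generate the null sets of \<open>x\<close> and \<open>y\<close>. Then \<open>qp = q\<close>, so the diagonal of \<open>q\<close> is bounded by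
  that of \<open>p\<close>. If both diagonals agree, \<open>p - pq\<close> is an idempotent with zero diagonal, hence \<open>p = pq\<close>, and
  the null sets coincide.
\<close>

lemma null_rank_strict:
  assumes "null_rank x m" "null_rank y n" and sub: "null y \<subset> null x"
  shows "n < m"
proof -
  obtain p K where T1: "p \<in> T" and K: "K \<subseteq> I" "m = card K"
    and p: "\<forall>u\<in>T. u \<in> null x \<longleftrightarrow> u \<odot> p = u" "p \<odot> p = p" "\<forall>i. diag i p = (if i \<in> K then 1 else 0)"
    using assms(1) unfolding null_rank_def by blast
  obtain q L where T2: "q \<in> T" and L: "L \<subseteq> I" "n = card L"
    and q: "\<forall>u\<in>T. u \<in> null y \<longleftrightarrow> u \<odot> q = u" "q \<odot> q = q" "\<forall>i. diag i q = (if i \<in> L then 1 else 0)"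
    using assms(2) unfolding null_rank_def by blast
  note T = T1 T2
  have qp: "q \<odot> p = q" using sub p(1) q(1) q(2) T by blast
  have "L \<subseteq> K"
  proof
    fix i assume "i \<in> L"
    then have "diag i p = 1" using diag_mul[OF T(2,1), of i] qp q(3) by simp
    then show "i \<in> K" using p(3) by (metis zero_neq_one)
  qed
  moreover have "L \<noteq> K"
  proof
    assume "L = K"
    define r where "r = p - p \<odot> q"
    have rT: "r \<in> T" using T by (simp add: r_def)
    have pq: "p \<odot> (p \<odot> q) = p \<odot> q" "(p \<odot> q) \<odot> p = p \<odot> q" "(p \<odot> q) \<odot> (p \<odot> q) = p \<odot> q"
    proof -
      show 1: "p \<odot> (p \<odot> q) = p \<odot> q" using T p(2) by (simp flip: T_assoc)
      show 2: "(p \<odot> q) \<odot> p = p \<odot> q" using T qp by (simp add: T_assoc)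
      have "(p \<odot> q) \<odot> (p \<odot> q) = ((p \<odot> q) \<odot> p) \<odot> q" using T by (simp add: T_assoc)
      also have "\<dots> = p \<odot> q" unfolding 2 using T q(2) by (simp add: T_assoc)
      finally show "(p \<odot> q) \<odot> (p \<odot> q) = p \<odot> q" .
    qed
    have "r \<odot> r = r" by (simp add: r_def mul_simps p(2) pq)
    moreover have "diag i r = 0" for i
      using \<open>L = K\<close> T by (simp add: r_def diag_simps diag_mul p(3) q(3))
    ultimately have "r = 0" by (rule idempotent_zero_diag[OF rT])
    then have ppq: "p \<odot> q = p" by (simp add: r_def)
    have "null x \<subseteq> null y"
    proof
      fix u assume u: "u \<in> null x"
      then have uT: "u \<in> T" by (simp add: null_def)
      have up: "u \<odot> p = u" using u p(1) uT by blast
      have "u \<odot> q = (u \<odot> p) \<odot> q" by (simp add: up)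
      also have "\<dots> = u \<odot> (p \<odot> q)" by (rule T_assoc[OF uT T])
      also have "\<dots> = u" unfolding ppq by (rule up)
      finally show "u \<in> null y" using q(1) uT by blast
    qed
    then show False using sub by blast
  qed
  ultimately have "L \<subset> K" by blast
  then show ?thesis unfolding K(2) L(2) using psubset_card_mono finite_subset[OF K(1) finite_I] by blast
qed

lemma chain_length:
  assumes X: "\<And>k. k \<le> n \<Longrightarrow> X k \<in> psd"
    and up: "\<And>k. k < n \<Longrightarrow> dominates (X (Suc k)) (X k)" "\<And>k. k < n \<Longrightarrow> \<not> dominates (X k) (X (Suc k))"
  shows "n \<le> alg_rank A"
proof -
  have "m + k \<le> alg_rank A" if "k \<le> n" "null_rank (X k) m" for k m
    using that
  proof (induction k arbitrary: m)
    case 0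
    then show ?case using null_rank_le by simp
  next
    case (Suc k)
    then have k: "k < n" by simp
    obtain l where l: "null_rank (X k) l" using null_rank_exists[OF X[of k]] k by auto
    have "null (X (Suc k)) \<subset> null (X k)"
      using up[OF k] dominates_iff_null[OF X X, of "Suc k" k] dominates_iff_null[OF X X, of k "Suc k"] k
      by auto
    then have "m < l" using null_rank_strict l Suc.prems(2) by blast
    then show ?case using Suc.IH[OF _ l] k by simp
  qed
  moreover obtain m where "null_rank (X n) m" using null_rank_exists[OF X[of n]] by auto
  ultimately show ?thesis by fastforce
qed

lemma E_psd: "E J \<in> psd"
  using psdI[OF E_T[of J]] by (simp add: E_mul_E)

lemma null_E: "null (E J) = {u \<in> T. u \<odot> E J = 0}"
  using null_square[OF E_T[of J]] by (simp add: E_mul_E)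

lemma unit_chain:
  shows "E {1..k} \<in> psd" "dominates (E {1..Suc k}) (E {1..k})"
    "k < alg_rank A \<Longrightarrow> \<not> dominates (E {1..k}) (E {1..Suc k})"
proof -
  show P: "E {1..k} \<in> psd" for k by (rule E_psd)
  show "dominates (E {1..Suc k}) (E {1..k})"
    unfolding dominates_iff_null[OF P P] null_E
  proof clarify
    fix u assume u: "u \<in> T" "u \<odot> E {1..Suc k} = 0"
    have "u \<odot> E {1..k} = (u \<odot> E {1..Suc k}) \<odot> E {1..k}"
      using u(1) by (simp add: T_assoc E_mul_E Int_absorb1 atLeastatMost_subset_iff)
    then show "u \<odot> E {1..k} = 0" using u(2) by simp
  qed
  assume k: "k < alg_rank A"
  have "E {Suc k} \<odot> E {1..k} = 0"
    by (rule entry_eqI) (auto simp: entry_mul_E entry_E)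
  moreover have "diag (Suc k) (E {Suc k} \<odot> E {1..Suc k}) = 1"
    using k by (simp add: E_mul_E diag_E indices_def)
  ultimately have "E {Suc k} \<in> null (E {1..k})" "E {Suc k} \<notin> null (E {1..Suc k})"
    unfolding null_E by auto
  then show "\<not> dominates (E {1..k}) (E {1..Suc k})" unfolding dominates_iff_null[OF P P] by blast
qed

text \<open>
  By \<open>dominates_iff_null\<close>, the core consists of the points whose null set is contained in every other
  one, that is, in the null set \<open>{0}\<close> of the identity.
\<close>

lemma cone_core_psd: "cone_core psd = cone_of A"
proof -
  have core: "cone_core psd = {x \<in> psd. \<forall>v\<in>psd. null x \<subseteq> null v}"
    using dominates_iff_null unfolding cone_core_def dominates_def by blast
  have nI: "null (E I) = {0}" unfolding null_E by (auto simp: E_I_T_mul)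
  show ?thesis
  proof (intro equalityI subsetI)
    fix x assume "x \<in> cone_core psd"
    then have x: "x \<in> psd" "null x \<subseteq> {0}" using core E_psd nI by blast+
    obtain g J where g: "g \<in> Tpos" "J \<subseteq> I" "x = (g \<odot> E J) \<odot> (g \<odot> E J)\<^sup>\<star>" using normal_form[OF x(1)] .
    obtain h where h: "h \<in> Tpos" "h \<odot> g = E I" "g \<odot> h = E I" using inverse_exists[OF g(1)] .
    note T = Tpos_T[OF g(1)] Tpos_T[OF h(1)]
    have gJ: "g \<odot> E J \<in> T" using T by simp
    have "J = I"
    proof (rule ccontr)
      assume "J \<noteq> I"
      then obtain j where j: "j \<in> I" "j \<notin> J" using g(2) by blast
      have "(E {j} \<odot> h) \<odot> (g \<odot> E J) = E {j} \<odot> ((h \<odot> g) \<odot> E J)" using T by (simp add: T_assoc)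
      also have "\<dots> = 0" unfolding h(2) E_mul_E by (rule E_disjoint) (use j in blast)
      finally have "E {j} \<odot> h \<in> null x" unfolding g(3) null_square[OF gJ] using T by simp
      then have "E {j} \<odot> h = 0" using x(2) by blast
      then have "(E {j} \<odot> h) \<odot> g = 0" by simp
      then have "E {j} = 0" using T h by (simp add: T_assoc E_I_T_mul)
      then have "diag j (E {j}) = 0" by simp
      then show False using j by (simp add: diag_E)
    qed
    then show "x \<in> cone_of A" using g T by (auto simp: cone_of_eq E_I_T_mul)
  next
    fix x assume "x \<in> cone_of A"
    then obtain t where t: "t \<in> Tpos" "x = t \<odot> t\<^sup>\<star>" by (auto simp: cone_of_eq)
    obtain h where h: "h \<in> Tpos" "h \<odot> t = E I" "t \<odot> h = E I" using inverse_exists[OF t(1)] .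
    note T = Tpos_T[OF t(1)] Tpos_T[OF h(1)]
    have "null x \<subseteq> {0}"
    proof
      fix u assume "u \<in> null x"
      then have u: "u \<in> T" "u \<odot> t = 0" unfolding t(2) null_square[OF T(1)] by auto
      have "u = u \<odot> (t \<odot> h)" using u T h by (simp add: E_I_T_mul)
      also have "\<dots> = (u \<odot> t) \<odot> h" by (rule T_assoc[OF u(1) T, symmetric])
      finally show "u \<in> {0}" using u by simp
    qed
    moreover have "0 \<in> null v" for v by (simp add: null_def)
    ultimately have "\<forall>v\<in>psd. null x \<subseteq> null v" by blast
    then show "x \<in> cone_core psd" using psdI[OF T(1)] t(2) core by blast
  qed
qed

lemma E_I_cone: "E I \<in> cone_of A"
  unfolding cone_of_eq by (auto intro!: exI[of _ "E I"] simp: E_mul_E Tpos_iff diag_E)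

lemma cone_psd: "cone_of A \<subseteq> psd"
  using cone_core_psd by (auto simp: cone_core_def)

lemma psd_add_cone: "x \<in> psd \<Longrightarrow> k \<in> cone_of A \<Longrightarrow> x + k \<in> cone_of A"
  unfolding cone_core_psd[symmetric] cone_core_def
proof safe
  assume x: "x \<in> psd" and k: "k \<in> psd" "\<forall>v\<in>psd. \<exists>\<epsilon>>0. k - \<epsilon> *\<^sub>R v \<in> psd"
  show "x + k \<in> psd" using convex_cone_psd x k convex_cone_add by blast
  fix v assume "v \<in> psd"
  then obtain e where "e > 0" "k - e *\<^sub>R v \<in> psd" using k by blast
  then have "e > 0" "x + (k - e *\<^sub>R v) \<in> psd" using convex_cone_psd x convex_cone_add by blast+
  then show "\<exists>\<epsilon>>0. x + k - \<epsilon> *\<^sub>R v \<in> psd" by (metis add_diff_eq)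
qed

lemma cone_scale: "k \<in> cone_of A \<Longrightarrow> c > 0 \<Longrightarrow> c *\<^sub>R k \<in> cone_of A"
  unfolding cone_core_psd[symmetric] cone_core_def
proof safe
  assume c: "c > 0" and k: "k \<in> psd" "\<forall>v\<in>psd. \<exists>\<epsilon>>0. k - \<epsilon> *\<^sub>R v \<in> psd"
  show "c *\<^sub>R k \<in> psd" using convex_cone_psd k c convex_cone_scaleR by (metis less_imp_le)
  fix v assume "v \<in> psd"
  then obtain e where "e > 0" "k - e *\<^sub>R v \<in> psd" using k by blast
  then have "c * e > 0" "c *\<^sub>R (k - e *\<^sub>R v) \<in> psd"
    using c convex_cone_scaleR[OF convex_cone_psd less_imp_le[OF c]] by simp_all
  then show "\<exists>\<epsilon>>0. c *\<^sub>R k - \<epsilon> *\<^sub>R v \<in> psd" by (metis scaleR_diff_right scaleR_scaleR)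
qed

lemma subspace_H: "subspace H"
  unfolding subspace_def by (auto intro: H_simps)

lemma span_cone_H: "span (cone_of A) \<subseteq> H"
  using span_minimal[OF _ subspace_H] cone_psd psd_H by blast

lemma psd_span: "x \<in> psd \<Longrightarrow> x \<in> span (cone_of A)"
  using span_diff[OF span_base[OF psd_add_cone[OF _ E_I_cone]] span_base[OF E_I_cone], of x] by simp

text \<open>
  Describes the closed cone by the open one and the linear structure alone, so that linear isomorphisms
  of open cones also match the closed ones.
\<close>

lemma psd_intrinsic: "x \<in> psd \<longleftrightarrow> x \<in> span (cone_of A) \<and> (\<forall>k\<in>cone_of A. x + k \<in> cone_of A)"
proof
  assume "x \<in> psd"
  then show "x \<in> span (cone_of A) \<and> (\<forall>k\<in>cone_of A. x + k \<in> cone_of A)"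
    using psd_span psd_add_cone by blast
next
  assume x: "x \<in> span (cone_of A) \<and> (\<forall>k\<in>cone_of A. x + k \<in> cone_of A)"
  show "x \<in> psd"
    unfolding psd_iff
  proof (intro conjI ballI)
    show "x \<in> H" using x span_cone_H by blast
    fix u assume u: "u \<in> T"
    show "0 \<le> ip x (u\<^sup>\<star> \<odot> u)"
    proof (rule nonneg_of_perturbation)
      fix e :: real assume "e > 0"
      then have "x + e *\<^sub>R E I \<in> psd" using x cone_scale[OF E_I_cone] cone_psd by blast
      then have "0 \<le> ip (x + e *\<^sub>R E I) (u\<^sup>\<star> \<odot> u)" using psd_pairing_nonneg u by blast
      then show "0 \<le> ip x (u\<^sup>\<star> \<odot> u) + e * ip (E I) (u\<^sup>\<star> \<odot> u) + e * e * 0" by (simp add: ip_simps)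
    qed
  qed
qed

end

lemma linear_image_psd:
  assumes "T_algebra A" "T_algebra B" and f: "linear f" "f ` cone_of A = cone_of B" and x: "x \<in> t_algebra.psd A"
  shows "f x \<in> t_algebra.psd B"
proof -
  interpret A: t_algebra A by unfold_locales fact
  interpret B: t_algebra B by unfold_locales fact
  have xA: "x \<in> span (cone_of A)" "\<forall>k\<in>cone_of A. x + k \<in> cone_of A"
    using A.psd_intrinsic[of x] x by blast+
  have "f x \<in> span (cone_of B)"
    using imageI[OF xA(1), of f] unfolding linear_span_image[OF f(1), symmetric] f(2) .
  moreover have "f x + k \<in> cone_of B" if "k \<in> cone_of B" for k
  proof -
    obtain k' where k': "k' \<in> cone_of A" "k = f k'" using \<open>k \<in> cone_of B\<close> unfolding f(2)[symmetric] by (rule imageE)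
    have "f (x + k') \<in> f ` cone_of A" using xA(2) k'(1) by (intro imageI) (rule bspec)
    then show ?thesis unfolding f(2) k'(2) linear_add[OF f(1)] .
  qed
  ultimately show ?thesis using B.psd_intrinsic[of "f x"] by blast
qed

text \<open>
  The chain \<open>E {1..k}\<close> is mapped to a strict chain; the inverse map is needed for strictness.
\<close>

lemma rank_le_of_linear_image:
  fixes f :: "'a::real_vector \<Rightarrow> 'b::real_vector" and A :: "'a matrix_alg" and B :: "'b matrix_alg"
  assumes TA: "T_algebra A" and TB: "T_algebra B"
    and f: "linear f" "f ` cone_of A = cone_of B"
    and g: "linear g" "g ` cone_of B = cone_of A" and gf: "\<And>x. x \<in> cone_of A \<Longrightarrow> g (f x) = x"
  shows "alg_rank A \<le> alg_rank B"
proof -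
  interpret A: t_algebra A by unfold_locales fact
  interpret B: t_algebra B by unfold_locales fact
  have gf': "g (f x) = x" if "x \<in> span (cone_of A)" for x
  proof -
    have "(g \<circ> f) x = id x"
      by (rule linear_eq_on[OF linear_compose[OF f(1) g(1)] linear_id that]) (simp add: gf)
    then show ?thesis by simp
  qed
  let ?X = "\<lambda>k. A.E {1..k}"
  show ?thesis
  proof (rule B.chain_length[of _ "\<lambda>k. f (?X k)"])
    show "f (?X k) \<in> B.psd" for k by (rule linear_image_psd[OF TA TB f A.unit_chain(1)])
    show "B.dominates (f (?X (Suc k))) (f (?X k))" for k
    proof -
      obtain e where "e > 0" "?X (Suc k) - e *\<^sub>R ?X k \<in> A.psd"
        using A.unit_chain(2)[of k] by (auto simp: A.dominates_def)
      then show ?thesis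
        using linear_image_psd[OF TA TB f, of "?X (Suc k) - e *\<^sub>R ?X k"] f(1)
        by (auto simp: B.dominates_def linear_diff linear_scale)
    qed
    fix k assume k: "k < alg_rank A"
    show "\<not> B.dominates (f (?X k)) (f (?X (Suc k)))"
    proof
      assume "B.dominates (f (?X k)) (f (?X (Suc k)))"
      then obtain e where e: "e > 0" "f (?X k) - e *\<^sub>R f (?X (Suc k)) \<in> B.psd" by (auto simp: B.dominates_def)
      have "g (f (?X k) - e *\<^sub>R f (?X (Suc k))) \<in> A.psd"
        by (rule linear_image_psd[OF TB TA g e(2)])
      then have "?X k - e *\<^sub>R ?X (Suc k) \<in> A.psd"
        using gf'[OF A.psd_span[OF A.unit_chain(1)]] g(1) by (simp add: linear_diff linear_scale)
      then show False using A.unit_chain(3)[OF k] e(1) by (auto simp: A.dominates_def)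
    qed
  qed
qed

section \<open>Faces and their ranks\<close>

lemma ordered_enumeration:
  fixes J :: "nat set"
  assumes "finite J"
  obtains \<sigma> where "\<sigma> ` {1..card J} = J" "strict_mono_on {1..card J} \<sigma>"
proof -
  define xs where "xs = sorted_list_of_set J"
  have xs: "set xs = J" "length xs = card J" "sorted_wrt (<) xs"
    using assms by (simp_all add: xs_def strict_sorted_iff)
  define \<sigma> where "\<sigma> i = xs ! (i - 1)" for i
  have "strict_mono_on {1..card J} \<sigma>"
    unfolding strict_mono_on_def \<sigma>_def
  proof (intro allI impI)
    fix i j assume "i \<in> {1..card J} \<and> j \<in> {1..card J} \<and> i < j"
    then have "i - 1 < j - 1" "j - 1 < length xs" using xs(2) by auto
    then show "xs ! (i - 1) < xs ! (j - 1)" by (rule sorted_wrt_nth_less[OF xs(3)])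
  qed
  moreover have "\<sigma> ` {1..card J} = J"
  proof
    show "\<sigma> ` {1..card J} \<subseteq> J" using xs(1,2) by (auto simp: \<sigma>_def intro!: nth_mem)
    show "J \<subseteq> \<sigma> ` {1..card J}"
    proof
      fix j assume "j \<in> J"
      then obtain k where "k < length xs" "xs ! k = j" using xs(1) by (auto simp: in_set_conv_nth)
      then show "j \<in> \<sigma> ` {1..card J}" using xs(2) by (intro image_eqI[of _ _ "Suc k"]) (auto simp: \<sigma>_def)
    qed
  qed
  ultimately show ?thesis using that by blast
qed

text \<open>
  A basis is sent to distinct unit sequences. The left inverse \<open>\<psi>\<close> is what transporting a T-algebra
  along \<open>\<phi>\<close> requires.
\<close>

lemma embedding_into_sequences:
  fixes V :: "'a::real_vector set"
  assumes V: "subspace V" and D: "finite D" "V \<subseteq> span D"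
  obtains \<phi> :: "'a \<Rightarrow> (nat \<Rightarrow>\<^sub>0 real)" and \<psi> where "linear \<phi>" "linear \<psi>" "\<And>x. x \<in> V \<Longrightarrow> \<psi> (\<phi> x) = x"
proof -
  obtain B where B: "B \<subseteq> V" "independent B" "V \<subseteq> span B" by (meson maximal_independent_subset)
  have fin: "finite B" using independent_span_bound[OF D(1) B(2)] B(1) D(2) by blast
  obtain idx :: "'a \<Rightarrow> nat" where idx: "inj_on idx B" using finite_imp_inj_to_nat_seg[OF fin] by blast
  obtain \<phi> where \<phi>: "linear \<phi>" "\<forall>b\<in>B. \<phi> b = Poly_Mapping.single (idx b) (1::real)"
    using linear_independent_extend[OF B(2), of "\<lambda>b. Poly_Mapping.single (idx b) (1::real)"] by blast
  have scale: "Poly_Mapping.lookup (c *\<^sub>R f) i = c * Poly_Mapping.lookup f i" for c and f :: "nat \<Rightarrow>\<^sub>0 real" and i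
  proof -
    have "finite {i. c *\<^sub>R Poly_Mapping.lookup f i \<noteq> 0}"
      by (rule finite_subset[OF _ finite_lookup[of f]]) auto
    then show ?thesis unfolding scaleR_poly_mapping_def by (simp add: Abs_poly_mapping_inverse)
  qed
  have "inj_on \<phi> V"
    unfolding linear_injective_on_subspace_0[OF \<phi>(1) V]
  proof (intro ballI impI)
    fix x assume x: "x \<in> V" "\<phi> x = 0"
    then obtain u where u: "x = (\<Sum>b\<in>B. u b *\<^sub>R b)" using B(3) span_finite[OF fin] by blast
    have "u c = 0" if c: "c \<in> B" for c
    proof -
      have "\<phi> x = (\<Sum>b\<in>B. u b *\<^sub>R Poly_Mapping.single (idx b) 1)"
        unfolding u linear_sum[OF \<phi>(1)] by (intro sum.cong refl) (simp add: linear_scale[OF \<phi>(1)] \<phi>(2))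
      then have "Poly_Mapping.lookup (\<phi> x) (idx c) = (\<Sum>b\<in>B. u b * (if b = c then 1 else 0))"
        unfolding lookup_sum scale using idx c
        by (simp add: lookup_sum scale lookup_single when_def inj_on_eq_iff[OF idx] cong: sum.cong)
      then show ?thesis using x(2) c fin by (simp add: if_distrib cong: if_cong)
    qed
    then show "x = 0" unfolding u by simp
  qed
  then obtain \<psi> where "linear \<psi>" "\<forall>v\<in>V. \<psi> (\<phi> v) = v"
    using linear_exists_left_inverse_on[OF \<phi>(1) V] by blast
  then show ?thesis using that \<phi>(1) by blast
qed

lemma cone_core_linear_image:
  assumes f: "linear f" and g: "linear g" "\<And>x. x \<in> S \<Longrightarrow> g (f x) = x"
  shows "cone_core (f ` S) = f ` cone_core S"
proof (intro equalityI subsetI)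
  fix y assume "y \<in> cone_core (f ` S)"
  then have y: "y \<in> f ` S" "\<forall>v\<in>f ` S. \<exists>\<epsilon>>0. y - \<epsilon> *\<^sub>R v \<in> f ` S" unfolding cone_core_def by blast+
  obtain x where x: "x \<in> S" "y = f x" using y(1) by blast
  have "\<exists>\<epsilon>>0. x - \<epsilon> *\<^sub>R v \<in> S" if v: "v \<in> S" for v
  proof -
    obtain e where "e > 0" "f x - e *\<^sub>R f v \<in> f ` S"
      using bspec[OF y(2) imageI[OF v]] unfolding x(2) by blast
    then obtain w where e: "e > 0" "w \<in> S" "f x - e *\<^sub>R f v = f w" by blast
    have "x - e *\<^sub>R v = g (f x - e *\<^sub>R f v)" using x(1) v g by (simp add: linear_diff linear_scale)
    also have "\<dots> = w" unfolding e(3) by (rule g(2)[OF e(2)])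
    finally show ?thesis using e(1,2) by blast
  qed
  then have "x \<in> cone_core S" using x(1) unfolding cone_core_def by blast
  then show "y \<in> f ` cone_core S" unfolding x(2) by (rule imageI)
next
  fix y assume "y \<in> f ` cone_core S"
  then obtain x where x: "x \<in> S" "\<forall>v\<in>S. \<exists>\<epsilon>>0. x - \<epsilon> *\<^sub>R v \<in> S" "y = f x"
    unfolding cone_core_def by blast
  have "\<exists>\<epsilon>>0. y - \<epsilon> *\<^sub>R v \<in> f ` S" if "v \<in> f ` S" for v
  proof -
    obtain w where w: "w \<in> S" "v = f w" using \<open>v \<in> f ` S\<close> by blast
    then obtain e where e: "e > 0" "x - e *\<^sub>R w \<in> S" using x(2) by blast
    have "y - e *\<^sub>R v = f (x - e *\<^sub>R w)" unfolding x(3) w(2) linear_diff[OF f] linear_scale[OF f] ..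
    then show ?thesis using e by blast
  qed
  then show "y \<in> cone_core (f ` S)" using x(1) unfolding x(3) cone_core_def by blast
qed

context t_algebra
begin

definition half_weight :: "nat \<Rightarrow> nat \<Rightarrow> real" where
  "half_weight i j = (if i < j then 1 else if i = j then 1 / 2 else 0)"

text \<open>
  The triangular \<open>\<tau>\<close> with \<open>x = \<tau> + \<tau>\<^sup>*\<close> for Hermitian \<open>x\<close>.
\<close>

definition upper_half :: "'a \<Rightarrow> 'a" where
  "upper_half x = (\<Sum>i\<in>I. \<Sum>j\<in>I. half_weight i j *\<^sub>R entry i j x)"

lemma linear_upper_half: "linear upper_half"
  by (intro linearI)
    (simp_all add: upper_half_def entry_simps scaleR_add_right sum.distrib scaleR_sum_right mult.commute)

lemma upper_half_carrier: "upper_half x \<in> C"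
  unfolding upper_half_def by (intro carrier_sum) simp

lemma entry_upper_half: "entry p q (upper_half x) = half_weight p q *\<^sub>R entry p q x"
proof (cases "p \<in> I \<and> q \<in> I")
  case True
  have "entry p q (upper_half x) = (\<Sum>i\<in>I. \<Sum>j\<in>I. half_weight i j *\<^sub>R entry p q (entry i j x))"
    by (simp add: upper_half_def entry_sum linear_scale[OF linear_entry])
  also have "\<dots> = (\<Sum>i\<in>I. \<Sum>j\<in>I. if j = q then (if i = p then half_weight p q *\<^sub>R entry p q x else 0) else 0)"
    by (intro sum.cong refl) (auto simp: entry_entry)
  also have "\<dots> = half_weight p q *\<^sub>R entry p q x" using True by simp
  finally show ?thesis .
qed simp

lemma upper_half_T: "upper_half x \<in> T"
  by (simp add: T_iff upper_half_carrier entry_upper_half half_weight_def)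

lemma upper_half_sum: "x \<in> H \<Longrightarrow> upper_half x + (upper_half x)\<^sup>\<star> = x"
proof (rule entry_eqI)
  assume x: "x \<in> H"
  show "upper_half x + (upper_half x)\<^sup>\<star> \<in> C" by (simp add: upper_half_carrier)
  show "x \<in> C" using x by (rule H_simps(1))
  fix i j
  have "entry i j (upper_half x + (upper_half x)\<^sup>\<star>) = (half_weight i j + half_weight j i) *\<^sub>R entry i j x"
    by (simp add: entry_simps entry_str entry_upper_half str_simps H_entry[OF x] scaleR_add_left)
  also have "half_weight i j + half_weight j i = 1" by (simp add: half_weight_def)
  finally show "entry i j (upper_half x + (upper_half x)\<^sup>\<star>) = entry i j x" by simp
qed

text \<open>
  The linear extension of \<open>tt\<^sup>* \<mapsto> (gt)(gt)\<^sup>*\<close>. The product \<open>gxg\<^sup>*\<close> is not associative in general and does not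
  define it. The formula results from polarising the map at \<open>\<tau> + \<tau>\<^sup>* = \<tau>1\<^sup>* + 1\<tau>\<^sup>*\<close>.
\<close>

definition cone_aut :: "'a \<Rightarrow> 'a \<Rightarrow> 'a" where
  "cone_aut g x = g \<odot> (g \<odot> upper_half x)\<^sup>\<star> + (g \<odot> upper_half x) \<odot> g\<^sup>\<star>"

lemma linear_cone_aut: "linear (cone_aut g)"
  using linear_upper_half unfolding linear_iff
  by (simp add: cone_aut_def mul_simps str_simps scaleR_add_right)

text \<open>
  Hermitian elements are determined by such pairings (\<open>hermitian_eqI\<close>), so the effect on squares can be
  read off from this identity.
\<close>

lemma cone_aut_pairing:
  assumes g: "g \<in> T" and u: "u \<in> T" and x: "x \<in> H"
  shows "ip (cone_aut g x) (u\<^sup>\<star> \<odot> u) = ip x ((u \<odot> g)\<^sup>\<star> \<odot> (u \<odot> g))"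
proof -
  define \<tau> where "\<tau> = upper_half x"
  define v where "v = u \<odot> g"
  have T: "\<tau> \<in> T" "v \<in> T" "g \<odot> \<tau> \<in> T" "E I \<in> T" using g u by (simp_all add: \<tau>_def v_def upper_half_T)
  have v\<tau>: "u \<odot> (g \<odot> \<tau>) = v \<odot> \<tau>" unfolding v_def by (rule T_assoc[OF u g T(1), symmetric])
  have "ip (cone_aut g x) (u\<^sup>\<star> \<odot> u) = ip (g \<odot> (g \<odot> \<tau>)\<^sup>\<star>) (u\<^sup>\<star> \<odot> u) + ip ((g \<odot> \<tau>) \<odot> g\<^sup>\<star>) (u\<^sup>\<star> \<odot> u)"
    by (simp add: cone_aut_def \<tau>_def ip_simps)
  also have "\<dots> = ip v (v \<odot> \<tau>) + ip (v \<odot> \<tau>) v"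
    unfolding polarised_pairing[OF g T(3) u] polarised_pairing[OF T(3) g u] v\<tau> unfolding v_def ..
  also have "\<dots> = ip (\<tau> \<odot> (E I)\<^sup>\<star>) (v\<^sup>\<star> \<odot> v) + ip (E I \<odot> \<tau>\<^sup>\<star>) (v\<^sup>\<star> \<odot> v)"
    unfolding polarised_pairing[OF T(1,4,2)] polarised_pairing[OF T(4,1,2)]
    using T by (simp add: E_I_T_mul)
  also have "\<dots> = ip (\<tau> + \<tau>\<^sup>\<star>) (v\<^sup>\<star> \<odot> v)" using T by (simp add: E_I_mul ip_simps)
  also have "\<tau> + \<tau>\<^sup>\<star> = x" unfolding \<tau>_def by (rule upper_half_sum[OF x])
  finally show ?thesis by (simp add: v_def)
qed

lemma cone_aut_H: "g \<in> T \<Longrightarrow> cone_aut g x \<in> H"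
  by (simp add: cone_aut_def H_iff str_simps str_mul upper_half_carrier add.commute)

lemma hermitian_eqI:
  assumes "x \<in> H" "y \<in> H" and eq: "\<And>u. u \<in> T \<Longrightarrow> ip x (u\<^sup>\<star> \<odot> u) = ip y (u\<^sup>\<star> \<odot> u)"
  shows "x = y"
proof -
  have "x - y \<in> psd"
    unfolding psd_iff using assms(1,2) by (intro conjI ballI H_simps) (simp_all add: ip_simps eq)
  then obtain t where t: "t \<in> T" "x - y = t \<odot> t\<^sup>\<star>" by (auto simp: psd_def)
  have "ip t t = ip (t \<odot> t\<^sup>\<star>) ((E I)\<^sup>\<star> \<odot> E I)" using pairing[OF t(1) E_T[of I]] t(1) by (simp add: E_I_T_mul)
  also have "\<dots> = 0" unfolding t(2)[symmetric] using eq[OF E_T[of I]] by (simp add: ip_simps)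
  finally have "t = 0" using ip_eq_0[OF T_carrier[OF t(1)]] by blast
  then show ?thesis using t(2) by simp
qed

lemma cone_aut_square:
  assumes g: "g \<in> T" and t: "t \<in> T"
  shows "cone_aut g (t \<odot> t\<^sup>\<star>) = (g \<odot> t) \<odot> (g \<odot> t)\<^sup>\<star>"
proof (rule hermitian_eqI)
  show "cone_aut g (t \<odot> t\<^sup>\<star>) \<in> H" by (rule cone_aut_H[OF g])
  show "(g \<odot> t) \<odot> (g \<odot> t)\<^sup>\<star> \<in> H" by (rule H_simps(6)) simp
  fix u assume u: "u \<in> T"
  have ug: "u \<odot> g \<in> T" and gt: "g \<odot> t \<in> T" using u g t by simp_all
  have "ip (cone_aut g (t \<odot> t\<^sup>\<star>)) (u\<^sup>\<star> \<odot> u) = ip (t \<odot> t\<^sup>\<star>) ((u \<odot> g)\<^sup>\<star> \<odot> (u \<odot> g))"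
    by (rule cone_aut_pairing[OF g u H_simps(6)[OF T_carrier[OF t]]])
  also have "\<dots> = ip (u \<odot> (g \<odot> t)) (u \<odot> (g \<odot> t))"
    unfolding pairing[OF t ug] T_assoc[OF u g t] ..
  also have "\<dots> = ip ((g \<odot> t) \<odot> (g \<odot> t)\<^sup>\<star>) (u\<^sup>\<star> \<odot> u)" by (rule pairing[OF gt u, symmetric])
  finally show "ip (cone_aut g (t \<odot> t\<^sup>\<star>)) (u\<^sup>\<star> \<odot> u) = ip ((g \<odot> t) \<odot> (g \<odot> t)\<^sup>\<star>) (u\<^sup>\<star> \<odot> u)" .
qed

definition face_set :: "'a \<Rightarrow> nat set \<Rightarrow> 'a set" where
  "face_set g J = {(g \<odot> s) \<odot> (g \<odot> s)\<^sup>\<star> | s. s \<in> T \<and> E J \<odot> s = s}"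

text \<open>
  The triangular elements of the subalgebra formed by the blocks with both indices in \<open>J\<close>.
\<close>

definition corner :: "nat set \<Rightarrow> 'a set" where
  "corner J = {z \<in> T. \<forall>i j. \<not> (i \<in> J \<and> j \<in> J) \<longrightarrow> entry i j z = 0}"

lemma corner_left: "z \<in> corner J \<Longrightarrow> E J \<odot> z = z"
proof (rule entry_eqI)
  fix i j assume "z \<in> corner J"
  then have "i \<notin> J \<Longrightarrow> entry i j z = 0" unfolding corner_def by blast
  then show "entry i j (E J \<odot> z) = entry i j z" by (simp add: entry_E_mul)
qed (simp_all add: corner_def)

text \<open>
  The Cholesky factor \<open>z\<close> of \<open>ss\<^sup>*\<close> has the same row norms as \<open>s\<close>, so its rows outside \<open>J\<close> vanish. Then the
  diagonal entries outside \<open>J\<close> are zero, and so are the corresponding columns.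
\<close>

lemma corner_square:
  assumes s: "s \<in> T" "E J \<odot> s = s"
  shows "\<exists>z\<in>corner J. s \<odot> s\<^sup>\<star> = z \<odot> z\<^sup>\<star>"
proof -
  have "s \<odot> s\<^sup>\<star> \<in> psd" by (rule psdI[OF s(1)])
  then obtain z where z: "z \<in> T" "s \<odot> s\<^sup>\<star> = z \<odot> z\<^sup>\<star>" "\<forall>j\<in>I. diag j z = 0 \<longrightarrow> (\<forall>i. entry i j z = 0)"
    using cholesky_upper[of "s \<odot> s\<^sup>\<star>"] psd_iff by blast
  have row: "entry i j z = 0" if "i \<notin> J" for i j
  proof -
    have "E {i} \<odot> s = E {i} \<odot> (E J \<odot> s)" by (simp add: s(2))
    also have "\<dots> = E ({i} \<inter> J) \<odot> s" unfolding T_assoc[OF E_T E_T s(1), symmetric] E_mul_E ..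
    also have "E ({i} \<inter> J) = 0" by (rule E_disjoint) (use that in blast)
    finally have "ip (E {i} \<odot> s) (E {i} \<odot> s) = 0" by simp
    then have "ip (E {i} \<odot> z) (E {i} \<odot> z) = 0"
      unfolding pairing[OF s(1) E_T, symmetric] pairing[OF z(1) E_T, symmetric] z(2) .
    then have "E {i} \<odot> z = 0" using ip_eq_0[OF mul_carrier] by blast
    then have "entry i j (E {i} \<odot> z) = 0" by simp
    then show ?thesis by (simp add: entry_E_mul)
  qed
  have col: "entry i j z = 0" if "j \<notin> J" for i j
  proof (cases "j \<in> I")
    case True
    have "diag j z = 0" using row[OF that, of j] diag_entry[of j j j z] by simp
    then show ?thesis using z(3) True by blast
  qed simp
  have "z \<in> corner J" unfolding corner_def using z(1) row col by blast
  then show ?thesis using z(2) by blast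
qed

lemma face_set_corner:
  assumes "g \<in> T"
  shows "face_set g J = cone_aut g ` {z \<odot> z\<^sup>\<star> | z. z \<in> corner J}"
proof (intro equalityI subsetI)
  fix x assume "x \<in> face_set g J"
  then obtain s where s: "s \<in> T" "E J \<odot> s = s" "x = (g \<odot> s) \<odot> (g \<odot> s)\<^sup>\<star>" by (auto simp: face_set_def)
  obtain z where z: "z \<in> corner J" "s \<odot> s\<^sup>\<star> = z \<odot> z\<^sup>\<star>" using corner_square[OF s(1,2)] by blast
  have "x = cone_aut g (z \<odot> z\<^sup>\<star>)" unfolding s(3) z(2)[symmetric] by (rule cone_aut_square[OF assms s(1), symmetric])
  then show "x \<in> cone_aut g ` {z \<odot> z\<^sup>\<star> | z. z \<in> corner J}" using z(1) by blast
next
  fix x assume "x \<in> cone_aut g ` {z \<odot> z\<^sup>\<star> | z. z \<in> corner J}"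
  then obtain z where z: "z \<in> corner J" "x = cone_aut g (z \<odot> z\<^sup>\<star>)" by blast
  have zT: "z \<in> T" using z(1) by (simp add: corner_def)
  show "x \<in> face_set g J"
    unfolding z(2) cone_aut_square[OF assms zT] face_set_def using zT corner_left[OF z(1)] by blast
qed

end

context t_algebra_transport
begin

interpretation B: t_algebra B
  by unfold_locales (rule T_algebra_B)

text \<open>
  For increasing \<open>\<sigma>\<close> the renumbering respects triangularity.
\<close>

lemma psd_B:
  assumes "strict_mono_on {1..m} \<sigma>"
  shows "B.psd = \<phi> ` {z \<odot> z\<^sup>\<star> | z. z \<in> corner J}"
proof -
  have mono: "\<sigma> j < \<sigma> i \<longleftrightarrow> j < i" if "i \<in> indices B" "j \<in> indices B" for i j
    using strict_mono_onD[OF assms, of i j] strict_mono_onD[OF assms, of j i] that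
    unfolding indices_B by (metis less_asym' less_irrefl linorder_neqE_nat)
  have T: "\<phi> z \<in> B.T \<longleftrightarrow> z \<in> corner J" if z: "z \<in> S" for z
  proof -
    have "\<phi> z \<in> B.T \<longleftrightarrow> (\<forall>i\<in>indices B. \<forall>j\<in>indices B. j < i \<longrightarrow> component B (\<phi> z) i j = 0)"
      using z unfolding B.T_def triangular_def carrier_B by blast
    also have "\<dots> \<longleftrightarrow> (\<forall>i\<in>indices B. \<forall>j\<in>indices B. \<sigma> j < \<sigma> i \<longrightarrow> entry (\<sigma> i) (\<sigma> j) z = 0)"
      using mono component_B[OF z] \<phi>_inj[OF entry_carrier carrier_simps(1)] linear_0[OF \<phi>]
      by (intro ball_cong refl) simp
    also have "\<dots> \<longleftrightarrow> (\<forall>p\<in>J. \<forall>q\<in>J. q < p \<longrightarrow> entry p q z = 0)"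
      unfolding J_def indices_B by simp
    also have "\<dots> \<longleftrightarrow> (\<forall>p q. q < p \<longrightarrow> entry p q z = 0)" using S_entry[OF _ z] by blast
    also have "\<dots> \<longleftrightarrow> z \<in> corner J"
      unfolding corner_def T_iff using z S_carrier[OF z] S_entry[OF _ z] by blast
    finally show ?thesis .
  qed
  have sub: "z \<in> S" if "z \<in> corner J" for z using that unfolding corner_def S_def T_iff by blast
  have sq: "B.mul (\<phi> z) (B.str (\<phi> z)) = \<phi> (z \<odot> z\<^sup>\<star>)" if z: "z \<in> S" for z
  proof -
    have c: "\<phi> z \<in> carrier_of B" "\<phi> (z\<^sup>\<star>) \<in> carrier_of B" using z S_str unfolding carrier_B by blast+
    show ?thesis
      unfolding B.str_carrier_eq[OF c(1), symmetric] star_B[OF S_carrier[OF z]]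
        B.mul_carrier_eq[OF c, symmetric] amult_B[OF S_carrier[OF z] str_carrier] ..
  qed
  show ?thesis
  proof (intro equalityI subsetI)
    fix y assume "y \<in> B.psd"
    then obtain b where b: "b \<in> B.T" "y = B.mul b (B.str b)" by (auto simp: B.psd_def)
    then obtain z where z: "z \<in> S" "b = \<phi> z" using B.T_carrier[OF b(1)] carrier_B by blast
    then show "y \<in> \<phi> ` {z \<odot> z\<^sup>\<star> | z. z \<in> corner J}" using b T[OF z(1)] sq[OF z(1)] by blast
  next
    fix y assume "y \<in> \<phi> ` {z \<odot> z\<^sup>\<star> | z. z \<in> corner J}"
    then obtain z where z: "z \<in> corner J" "y = \<phi> (z \<odot> z\<^sup>\<star>)" by blast
    have "B.mul (\<phi> z) (B.str (\<phi> z)) \<in> B.psd" using B.psdI T[OF sub[OF z(1)]] z(1) by blast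
    then show "y \<in> B.psd" unfolding z(2) sq[OF sub[OF z(1)]] .
  qed
qed

end

text \<open>
  Undoing the automorphism that belongs to \<open>g\<close> leaves the squares from the corner \<open>J\<close>. They form the closed
  cone of the T-algebra obtained by numbering \<open>J\<close> in increasing order, and the relative interior is
  computed by \<open>cone_core_psd\<close> there.
\<close>

theorem face_set_rank:
  fixes A :: "'a::real_normed_vector matrix_alg"
  assumes A: "T_algebra A" and g: "g \<in> triangular_pos A" and J: "J \<subseteq> indices A"
  shows "has_cone_rank (t_algebra.face_set A g J) (card J)"
proof -
  interpret t_algebra A by unfold_locales (rule A)
  obtain D where D: "finite D" "C \<subseteq> span D" using ax_finite by blast
  obtain \<phi> :: "'a \<Rightarrow> (nat \<Rightarrow>\<^sub>0 real)" and \<psi>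
    where \<phi>: "linear \<phi>" "linear \<psi>" "\<And>x. x \<in> C \<Longrightarrow> \<psi> (\<phi> x) = x"
    using embedding_into_sequences[OF subspace_carrier D] by blast
  obtain \<sigma> where \<sigma>: "\<sigma> ` {1..card J} = J" "strict_mono_on {1..card J} \<sigma>"
    using ordered_enumeration[OF finite_subset[OF J finite_I]] .
  interpret X: t_algebra_transport A "card J" \<sigma> \<phi> \<psi>
  proof (intro t_algebra_transport.intro[OF t_algebra_axioms] t_algebra_transport_axioms.intro)
    show "inj_on \<sigma> {1..card J}" using \<sigma>(2) by (rule strict_mono_on_imp_inj_on)
    have "\<sigma> i \<le> \<sigma> j" if "i \<in> {1..card J}" "j \<in> {1..card J}" "i \<le> j" for i j
      using strict_mono_onD[OF \<sigma>(2) that(1,2)] that(3) by (cases "i = j") auto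
    then show "(\<forall>i\<in>{1..card J}. \<forall>j\<in>{1..card J}. i \<le> j \<longrightarrow> \<sigma> i \<le> \<sigma> j) \<or>
        (\<forall>i\<in>{1..card J}. \<forall>j\<in>{1..card J}. i \<le> j \<longrightarrow> \<sigma> j \<le> \<sigma> i)" by blast
  qed (simp_all only: \<sigma>(1) J \<phi>)
  have XJ: "X.J = J" unfolding X.J_def by (rule \<sigma>(1))
  interpret B: t_algebra X.B by unfold_locales (rule X.T_algebra_B)
  obtain h where h: "h \<in> Tpos" "h \<odot> g = E I" "g \<odot> h = E I" using inverse_exists[OF g] .
  note T = Tpos_T[OF g] Tpos_T[OF h(1)]
  let ?Z = "{z \<odot> z\<^sup>\<star> | z. z \<in> corner J}"
  have psdB: "B.psd = \<phi> ` ?Z" using X.psd_B[OF \<sigma>(2)] unfolding XJ .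
  have G: "face_set g J = cone_aut g ` ?Z" by (rule face_set_corner[OF T(1)])
  define f where "f = \<phi> \<circ> cone_aut h"
  define k where "k = cone_aut g \<circ> \<psi>"
  have lin: "linear f" "linear k"
    unfolding f_def k_def by (intro linear_compose \<phi> linear_cone_aut)+
  have hg: "cone_aut h (cone_aut g y) = y" if y: "y \<in> ?Z" for y
  proof -
    obtain z where z: "z \<in> T" "y = z \<odot> z\<^sup>\<star>" using y by (auto simp: corner_def)
    have gz: "g \<odot> z \<in> T" using T z by simp
    have "h \<odot> (g \<odot> z) = z" using T_assoc[OF T(2,1) z(1)] z(1) by (simp add: h(2) E_I_T_mul)
    then show ?thesis unfolding z(2) cone_aut_square[OF T(1) z(1)] cone_aut_square[OF T(2) gz] by simp
  qed
  have ZC: "y \<in> C" if "y \<in> ?Z" for y using that by auto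
  have fG: "f ` face_set g J = B.psd"
    unfolding G psdB f_def image_comp[symmetric] image_image by (intro image_cong refl) (simp add: hg)
  have kf: "k (f x) = x" if "x \<in> face_set g J" for x
  proof -
    obtain y where y: "y \<in> ?Z" "x = cone_aut g y" using \<open>x \<in> face_set g J\<close> unfolding G by (rule imageE)
    show ?thesis unfolding y(2) f_def k_def comp_def hg[OF y(1)] \<phi>(3)[OF ZC[OF y(1)]] ..
  qed
  have "k ` (f ` face_set g J) = face_set g J" unfolding image_image using kf by simp
  then have kB: "k ` B.psd = face_set g J" unfolding fG .
  have "convex_cone (face_set g J)"
    unfolding kB[symmetric] using convex_cone_linear_image B.convex_cone_psd lin(2) by blast
  moreover have "face_set g J \<subseteq> span D" using D(2) cone_aut_H[OF T(1)] H_simps(1) unfolding G by blast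
  ultimately have ri: "rel_interior (face_set g J) = cone_core (face_set g J)"
    using rel_interior_convex_cone D(1) by blast
  have img: "f ` cone_core (face_set g J) = cone_of X.B"
    using cone_core_linear_image[OF lin, of "face_set g J"] kf unfolding fG B.cone_core_psd by blast
  have inj: "inj_on f (span (cone_core (face_set g J)))"
  proof (rule inj_on_inverseI[of _ k])
    fix x assume "x \<in> span (cone_core (face_set g J))"
    moreover have "cone_core (face_set g J) \<subseteq> face_set g J" unfolding cone_core_def by blast
    ultimately have x: "x \<in> span (face_set g J)" using span_mono by blast
    have "(k \<circ> f) x = id x"
      by (rule linear_eq_on[OF linear_compose[OF lin] linear_id x]) (simp add: kf)
    then show "k (f x) = x" by simp
  qed
  have "linearly_isomorphic (rel_interior (face_set g J)) (cone_of X.B)"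
    unfolding linearly_isomorphic_def ri using lin(1) inj img by blast
  moreover have "alg_rank X.B = card J" by (simp add: X.B_def)
  ultimately show ?thesis unfolding has_cone_rank_def using X.T_algebra_B by blast
qed

section \<open>Uniqueness of the rank\<close>

lemma linear_isomorphic_rank_le:
  fixes X :: "'a::real_vector set" and A :: "'b::real_vector matrix_alg" and B :: "'c::real_vector matrix_alg"
  assumes A: "T_algebra A" "linearly_isomorphic X (cone_of A)"
    and B: "T_algebra B" "linearly_isomorphic X (cone_of B)"
  shows "alg_rank A \<le> alg_rank B"
proof -
  obtain f where f: "linear f" "inj_on f (span X)" "f ` X = cone_of A"
    using A(2) unfolding linearly_isomorphic_def by blast
  obtain g where g: "linear g" "inj_on g (span X)" "g ` X = cone_of B"
    using B(2) unfolding linearly_isomorphic_def by blast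
  obtain f' where f': "linear f'" "\<forall>x\<in>span X. f' (f x) = x"
    using linear_exists_left_inverse_on[OF f(1) subspace_span f(2)] by blast
  obtain g' where g': "linear g'" "\<forall>x\<in>span X. g' (g x) = x"
    using linear_exists_left_inverse_on[OF g(1) subspace_span g(2)] by blast
  have inv: "f' (f x) = x" "g' (g x) = x" if "x \<in> X" for x
    using f'(2) g'(2) span_base[OF that] by blast+
  show ?thesis
  proof (rule rank_le_of_linear_image[OF A(1) B(1)])
    show "linear (g \<circ> f')" "linear (f \<circ> g')" by (intro linear_compose f f' g g')+
    have "(g \<circ> f') ` f ` X = g ` X" unfolding image_image by (intro image_cong refl) (simp add: inv)
    then show "(g \<circ> f') ` cone_of A = cone_of B" unfolding f(3) g(3) .
    have "(f \<circ> g') ` g ` X = f ` X" unfolding image_image by (intro image_cong refl) (simp add: inv)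
    then show "(f \<circ> g') ` cone_of B = cone_of A" unfolding f(3) g(3) .
    fix y assume "y \<in> cone_of A"
    then obtain x where x: "x \<in> X" "y = f x" unfolding f(3)[symmetric] by (rule imageE) auto
    show "(f \<circ> g') ((g \<circ> f') y) = y" unfolding x(2) by (simp add: inv x(1))
  qed
qed

text \<open>
  The part of Vinberg's uniqueness theorem that concerns the rank.
\<close>

theorem has_cone_rank_unique:
  assumes "has_cone_rank X m" "has_cone_rank X n"
  shows "m = n"
  using assms linear_isomorphic_rank_le unfolding has_cone_rank_def by (metis order_antisym)

context t_algebra
begin

section \<open>Conjugate faces\<close>

lemma dual_cone_eq: "dual_cone A = {u\<^sup>\<star> \<odot> u | u. u \<in> T}"
proof (intro equalityI subsetI)
  fix y assume "y \<in> dual_cone A"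
  then have y: "y \<in> H" "\<forall>x\<in>cone_of A. inner_of A x y \<ge> 0" by (simp_all add: dual_cone_def)
  have "dual_nonneg y"
    unfolding dual_nonneg_def
  proof (intro ballI impI)
    fix t assume t: "t \<in> T" "\<forall>i. 0 \<le> diag i t"
    show "0 \<le> ip (t \<odot> t\<^sup>\<star>) y"
    proof (rule nonneg_of_perturbation)
      fix e :: real assume e: "e > 0"
      let ?s = "t + e *\<^sub>R E I"
      have "?s \<in> Tpos" using t e by (simp add: Tpos_iff diag_simps diag_E add_nonneg_pos)
      then have "?s \<odot> ?s\<^sup>\<star> \<in> cone_of A" unfolding cone_of_eq by blast
      then have "0 \<le> inner_of A (?s \<odot> ?s\<^sup>\<star>) y" using y(2) by blast
      also have "\<dots> = ip (?s \<odot> ?s\<^sup>\<star>) y" by (rule inner_of_eq[OF mul_carrier H_simps(1)[OF y(1)]])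
      also have "?s \<odot> ?s\<^sup>\<star> = t \<odot> t\<^sup>\<star> + e *\<^sub>R (t + t\<^sup>\<star>) + (e * e) *\<^sub>R E I"
        using t(1) by (simp add: str_simps mul_simps E_I_mul E_mul_E scaleR_add_right)
      finally show "0 \<le> ip (t \<odot> t\<^sup>\<star>) y + e * ip (t + t\<^sup>\<star>) y + e * e * ip (E I) y"
        by (simp add: ip_simps)
    qed
  qed
  then obtain u where "u \<in> T" "y = u\<^sup>\<star> \<odot> u" using cholesky[OF y(1)] by blast
  then show "y \<in> {u\<^sup>\<star> \<odot> u | u. u \<in> T}" by blast
next
  fix y assume "y \<in> {u\<^sup>\<star> \<odot> u | u. u \<in> T}"
  then obtain u where u: "u \<in> T" "y = u\<^sup>\<star> \<odot> u" by blast
  have "inner_of A x y \<ge> 0" if "x \<in> cone_of A" for x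
  proof -
    have x: "x \<in> psd" using cone_psd that by blast
    show ?thesis
      unfolding u(2) inner_of_eq[OF H_simps(1)[OF psd_H[OF x]] mul_carrier] by (rule psd_pairing_nonneg[OF x u(1)])
  qed
  moreover have "y \<in> H" unfolding u(2) by (rule H_simps(7)[OF T_carrier[OF u(1)]])
  ultimately show "y \<in> dual_cone A" by (simp add: dual_cone_def)
qed

lemma face_set_eq:
  assumes g: "g \<in> Tpos"
  shows "face_set g J = {z \<in> psd. null ((g \<odot> E J) \<odot> (g \<odot> E J)\<^sup>\<star>) \<subseteq> null z}"
proof (intro equalityI subsetI)
  have gT: "g \<in> T" by (rule Tpos_T[OF g])
  then have gJ: "g \<odot> E J \<in> T" by simp
  note null_x = null_square[OF gJ]
  {
    fix z assume "z \<in> face_set g J"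
    then obtain s where s: "s \<in> T" "E J \<odot> s = s" "z = (g \<odot> s) \<odot> (g \<odot> s)\<^sup>\<star>" by (auto simp: face_set_def)
    have gs: "g \<odot> s \<in> T" using gT s by simp
    have "u \<odot> (g \<odot> s) = 0" if u: "u \<in> T" "u \<odot> (g \<odot> E J) = 0" for u
    proof -
      have "u \<odot> (g \<odot> s) = u \<odot> ((g \<odot> E J) \<odot> s)" unfolding T_assoc[OF gT E_T s(1)] s(2) ..
      also have "\<dots> = (u \<odot> (g \<odot> E J)) \<odot> s" by (rule T_assoc[OF u(1) gJ s(1), symmetric])
      finally show ?thesis by (simp add: u(2))
    qed
    then have "null ((g \<odot> E J) \<odot> (g \<odot> E J)\<^sup>\<star>) \<subseteq> null z" unfolding s(3) null_x null_square[OF gs] by blast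
    then show "z \<in> {z \<in> psd. null ((g \<odot> E J) \<odot> (g \<odot> E J)\<^sup>\<star>) \<subseteq> null z}" using psdI[OF gs] s(3) by blast
  next
    fix z assume "z \<in> {z \<in> psd. null ((g \<odot> E J) \<odot> (g \<odot> E J)\<^sup>\<star>) \<subseteq> null z}"
    then obtain t where t: "t \<in> T" "z = t \<odot> t\<^sup>\<star>" and sub: "null ((g \<odot> E J) \<odot> (g \<odot> E J)\<^sup>\<star>) \<subseteq> null z"
      by (auto simp: psd_def)
    then show "z \<in> face_set g J"
      using factor_of_null_subset[OF g t(1), of J] unfolding t(2) face_set_def by blast
  }
qed

text \<open>
  The single point \<open>(gE\<^sub>J)(gE\<^sub>J)\<^sup>*\<close> of the face decides orthogonality, because its null set is the smallest
  one.
\<close>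

lemma conjugate_face_set:
  assumes g: "g \<in> Tpos"
  shows "conjugate_face A (face_set g J) = {u\<^sup>\<star> \<odot> u | u. u \<in> T \<and> u \<odot> (g \<odot> E J) = 0}"
proof -
  let ?x = "(g \<odot> E J) \<odot> (g \<odot> E J)\<^sup>\<star>"
  have gT: "g \<in> T" by (rule Tpos_T[OF g])
  have gJ: "g \<odot> E J \<in> T" using gT by simp
  note F = face_set_eq[OF g]
  have xF: "?x \<in> face_set g J" unfolding F using psdI[OF gJ] by blast
  have inner: "inner_of A z (u\<^sup>\<star> \<odot> u) = ip z (u\<^sup>\<star> \<odot> u)" if "z \<in> face_set g J" for z u
    using that psd_H H_simps(1) inner_of_eq[OF _ mul_carrier] unfolding F by blast
  have perp: "u\<^sup>\<star> \<odot> u \<in> perp A (face_set g J) \<longleftrightarrow> u \<odot> (g \<odot> E J) = 0" if u: "u \<in> T" for u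
  proof
    assume "u\<^sup>\<star> \<odot> u \<in> perp A (face_set g J)"
    then have "inner_of A ?x (u\<^sup>\<star> \<odot> u) = 0" using xF unfolding perp_def by blast
    then have "u \<in> null ?x" using u unfolding inner[OF xF] null_def by blast
    then show "u \<odot> (g \<odot> E J) = 0" unfolding null_square[OF gJ] by blast
  next
    assume "u \<odot> (g \<odot> E J) = 0"
    then have "u \<in> null ?x" using u unfolding null_square[OF gJ] by blast
    then have "ip z (u\<^sup>\<star> \<odot> u) = 0" if "z \<in> face_set g J" for z
      using that unfolding F null_def by blast
    then show "u\<^sup>\<star> \<odot> u \<in> perp A (face_set g J)"
      unfolding perp_def using inner H_simps(7)[OF T_carrier[OF u]] by simp
  qed
  show ?thesis unfolding conjugate_face_def dual_cone_eq using perp by blast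
qed

interpretation R: t_algebra "reversed A"
  by unfold_locales (rule T_algebra_reversed)

text \<open>
  With \<open>w = ug\<close> the condition \<open>ugE\<^sub>J = 0\<close> becomes \<open>wE\<^sub>I\<^sub>-\<^sub>J = w\<close>, and \<open>u\<^sup>* = h\<^sup>*w\<^sup>*\<close> with \<open>h = g\<^sup>-\<^sup>1\<close>. The element
  \<open>w\<^sup>*\<close> is triangular for the reversed order.
\<close>

lemma conjugate_face_reversed:
  assumes g: "g \<in> Tpos" and h: "h \<in> Tpos" "h \<odot> g = E I" "g \<odot> h = E I" and J: "J \<subseteq> I"
  shows "h\<^sup>\<star> \<in> triangular_pos (reversed A)"
    and "conjugate_face A (face_set g J) = R.face_set (h\<^sup>\<star>) (flip ` (I - J))"
proof -
  note T = Tpos_T[OF g] Tpos_T[OF h(1)]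
  have hR: "h\<^sup>\<star> \<in> R.T" using T by (simp add: reversed_T)
  have "R.diag i (h\<^sup>\<star>) > 0" if "i \<in> I" for i
    using h(1) flip(1)[OF that] by (simp add: reversed_diag[OF that] diag_str Tpos_iff)
  then show "h\<^sup>\<star> \<in> triangular_pos (reversed A)" using hR by (simp add: R.Tpos_iff indices_reversed)
  have RE: "R.E (flip ` (I - J)) = E (I - J)" by (rule reversed_E) blast
  have E: "E (I - J) = E I - E J"
    by (rule entry_eqI) (use J in \<open>auto simp: entry_E entry_simps\<close>)
  show "conjugate_face A (face_set g J) = R.face_set (h\<^sup>\<star>) (flip ` (I - J))"
    unfolding conjugate_face_set[OF g] R.face_set_def reversed_mul reversed_str RE
  proof (intro equalityI subsetI)
    fix y assume "y \<in> {u\<^sup>\<star> \<odot> u | u. u \<in> T \<and> u \<odot> (g \<odot> E J) = 0}"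
    then obtain u where u: "u \<in> T" "u \<odot> (g \<odot> E J) = 0" "y = u\<^sup>\<star> \<odot> u" by blast
    define w where "w = u \<odot> g"
    have w: "w \<in> T" using u T by (simp add: w_def)
    have "w \<odot> E J = 0" using u(2) T_assoc[OF u(1) T(1) E_T] by (simp add: w_def)
    then have "w \<odot> E (I - J) = w" using w by (simp add: E mul_simps E_I_T_mul)
    then have "(w \<odot> E (I - J))\<^sup>\<star> = w\<^sup>\<star>" by simp
    then have 1: "E (I - J) \<odot> w\<^sup>\<star> = w\<^sup>\<star>" by (simp add: str_mul)
    have 2: "w\<^sup>\<star> \<in> R.T" using w by (simp add: reversed_T)
    have "u = w \<odot> h" unfolding w_def T_assoc[OF u(1) T] h(3) using u(1) by (simp add: E_I_T_mul)
    then have "u\<^sup>\<star> = h\<^sup>\<star> \<odot> w\<^sup>\<star>" by (simp add: str_mul)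
    then have "y = (h\<^sup>\<star> \<odot> w\<^sup>\<star>) \<odot> (h\<^sup>\<star> \<odot> w\<^sup>\<star>)\<^sup>\<star>" using u(1,3) by (metis T_carrier str_str)
    then show "y \<in> {(h\<^sup>\<star> \<odot> s) \<odot> (h\<^sup>\<star> \<odot> s)\<^sup>\<star> | s. s \<in> R.T \<and> E (I - J) \<odot> s = s}" using 1 2 by blast
  next
    fix y assume "y \<in> {(h\<^sup>\<star> \<odot> s) \<odot> (h\<^sup>\<star> \<odot> s)\<^sup>\<star> | s. s \<in> R.T \<and> E (I - J) \<odot> s = s}"
    then obtain s where s: "s \<in> R.T" "E (I - J) \<odot> s = s" "y = (h\<^sup>\<star> \<odot> s) \<odot> (h\<^sup>\<star> \<odot> s)\<^sup>\<star>" by blast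
    have sC: "s \<in> C" and wT: "s\<^sup>\<star> \<in> T" using s(1) by (simp_all add: reversed_T)
    define u where "u = s\<^sup>\<star> \<odot> h"
    have u: "u \<in> T" using wT T by (simp add: u_def)
    have us: "u\<^sup>\<star> = h\<^sup>\<star> \<odot> s" using sC by (simp add: u_def str_mul)
    have y: "y = u\<^sup>\<star> \<odot> u" using u unfolding s(3) us[symmetric] by simp
    have "s\<^sup>\<star> = (E (I - J) \<odot> s)\<^sup>\<star>" by (simp add: s(2))
    then have sE: "s\<^sup>\<star> = s\<^sup>\<star> \<odot> E (I - J)" by (simp add: str_mul)
    have "u \<odot> (g \<odot> E J) = (s\<^sup>\<star> \<odot> (h \<odot> g)) \<odot> E J"
      unfolding u_def T_assoc[OF wT T(2) , symmetric] using wT T by (simp add: T_assoc)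
    also have "\<dots> = s\<^sup>\<star> \<odot> E J" unfolding h(2) E_I_T_mul(2)[OF wT] ..
    also have "\<dots> = (s\<^sup>\<star> \<odot> E (I - J)) \<odot> E J" by (simp add: sE[symmetric])
    also have "\<dots> = s\<^sup>\<star> \<odot> E ((I - J) \<inter> J)" unfolding T_assoc[OF wT E_T E_T] E_mul_E ..
    also have "E ((I - J) \<inter> J) = 0" by (rule E_disjoint) blast
    finally show "y \<in> {u\<^sup>\<star> \<odot> u | u. u \<in> T \<and> u \<odot> (g \<odot> E J) = 0}" using u y by auto
  qed
qed

text \<open>
  A relatively interior point \<open>x\<close> dominates all of \<open>F\<close>; conversely a face contains whatever one of its
  points dominates.
\<close>

lemma face_normal_form:
  assumes F: "cone_face F psd" and x: "x \<in> cone_core F"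
  obtains g J where "g \<in> Tpos" "J \<subseteq> I" "F = face_set g J"
proof -
  have sub: "F \<subseteq> psd" and cc: "convex_cone F"
    and ext: "\<And>a b. a \<in> psd \<Longrightarrow> b \<in> psd \<Longrightarrow> a + b \<in> F \<Longrightarrow> a \<in> F \<and> b \<in> F"
    using F unfolding cone_face_def by blast+
  have xF: "x \<in> F" using x by (simp add: cone_core_def)
  then have xP: "x \<in> psd" using sub by blast
  obtain g J where g: "g \<in> Tpos" "J \<subseteq> I" "x = (g \<odot> E J) \<odot> (g \<odot> E J)\<^sup>\<star>" using normal_form[OF xP] .
  have "F = {z \<in> psd. null x \<subseteq> null z}"
  proof (intro equalityI subsetI)
    fix z assume z: "z \<in> F"
    then obtain e where "e > 0" "x - e *\<^sub>R z \<in> F" using x unfolding cone_core_def by blast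
    then have "dominates x z" unfolding dominates_def using sub by blast
    then show "z \<in> {z \<in> psd. null x \<subseteq> null z}" using dominates_iff_null[OF xP] z sub by blast
  next
    fix z assume "z \<in> {z \<in> psd. null x \<subseteq> null z}"
    then have z: "z \<in> psd" "dominates x z" using dominates_iff_null[OF xP] by blast+
    then obtain e where e: "e > 0" "x - e *\<^sub>R z \<in> psd" unfolding dominates_def by blast
    have ez: "e *\<^sub>R z \<in> psd" using convex_cone_scaleR[OF convex_cone_psd less_imp_le[OF e(1)] z(1)] .
    have "e *\<^sub>R z \<in> F" using ext[OF e(2) ez] xF by simp
    then have "inverse e *\<^sub>R (e *\<^sub>R z) \<in> F"
      using convex_cone_scaleR[OF cc, of "inverse e" "e *\<^sub>R z"] e(1) by simp
    then show "z \<in> F" using e(1) by simp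
  qed
  then have "F = face_set g J" unfolding face_set_eq[OF g(1)] g(3) .
  then show ?thesis using that g by blast
qed

end

text \<open>
  By \<open>psd_iff\<close> the set \<open>psd\<close> is an intersection of half-spaces within a finite-dimensional space, hence closed.
  Conversely \<open>tt\<^sup>*\<close> is the limit of \<open>(t + c)(t + c)\<^sup>*\<close> for positive scalars \<open>c\<close> tending to zero.
\<close>

lemma closure_cone:
  fixes A :: "'a::real_normed_vector matrix_alg"
  assumes "T_algebra A"
  shows "closure (cone_of A) = t_algebra.psd A"
proof -
  interpret t_algebra A by unfold_locales fact
  obtain D where D: "finite D" "C \<subseteq> span D" using ax_finite by blast
  obtain B where B: "B \<subseteq> H" "independent B" "H \<subseteq> span B" by (meson maximal_independent_subset)
  have "finite B" using independent_span_bound[OF D(1) B(2)] B(1) D(2) H_simps(1) by blast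
  have span: "span B = H" using B span_minimal[OF B(1) subspace_H] by blast
  have psd: "psd = (\<Inter>u\<in>T. {x \<in> span B. ip x (u\<^sup>\<star> \<odot> u) \<ge> 0})"
    unfolding span set_eq_iff INT_iff mem_Collect_eq psd_iff using T_simps(1) by blast
  have lin: "linear (\<lambda>x. ip x c)" for c using bilinear_ip by (simp add: bilinear_def)
  have "closed psd"
    unfolding psd by (intro closed_INT ballI closed_halfspace_in_span[OF \<open>finite B\<close> lin])
  show ?thesis
  proof
    show "closure (cone_of A) \<subseteq> psd" by (rule closure_minimal[OF cone_psd \<open>closed psd\<close>])
    show "psd \<subseteq> closure (cone_of A)"
    proof
      fix x assume "x \<in> psd"
      then obtain t where t: "t \<in> T" "x = t \<odot> t\<^sup>\<star>" "\<forall>i. diag i t \<ge> 0"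
        using cholesky_upper[of x] psd_iff by blast
      define c where "c n = inverse (real (Suc n))" for n
      have c: "c n > 0" for n by (simp add: c_def)
      have c0: "c \<longlonglongrightarrow> 0" unfolding c_def by (rule LIMSEQ_inverse_real_of_nat)
      define X where "X n = t \<odot> t\<^sup>\<star> + c n *\<^sub>R (t + t\<^sup>\<star>) + (c n * c n) *\<^sub>R E I" for n
      have "X n \<in> cone_of A" for n
      proof -
        let ?s = "t + c n *\<^sub>R E I"
        have "?s \<in> Tpos" using t c[of n] by (simp add: Tpos_iff diag_simps diag_E add_nonneg_pos)
        moreover have "X n = ?s \<odot> ?s\<^sup>\<star>"
          using t(1) by (simp add: X_def str_simps mul_simps E_I_mul E_mul_E scaleR_add_right)
        ultimately show ?thesis unfolding cone_of_eq by blast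
      qed
      moreover have "X \<longlonglongrightarrow> t \<odot> t\<^sup>\<star> + 0 *\<^sub>R (t + t\<^sup>\<star>) + (0 * 0) *\<^sub>R E I"
        unfolding X_def by (intro tendsto_intros c0)
      ultimately show "x \<in> closure (cone_of A)" unfolding closure_sequential t(2) by auto
    qed
  qed
qed

theorem proposition3p12:
  fixes A :: "'a::real_normed_vector matrix_alg" and F :: "'a set" and r s :: nat
  assumes "T_algebra A" and "alg_rank A = r"
    and "cone_face F (closure (cone_of A))"
    and "has_cone_rank F s"
  shows "s \<le> r \<and> has_cone_rank (conjugate_face A F) (r - s)"
proof -
  interpret t_algebra A by unfold_locales fact
  have F: "cone_face F psd" using assms(3) unfolding closure_cone[OF assms(1)] .
  obtain D where D: "finite D" "C \<subseteq> span D" using ax_finite by blast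
  have "F \<subseteq> span D" using F psd_H H_simps(1) D(2) unfolding cone_face_def by blast
  then have ri: "rel_interior F = cone_core F"
    using rel_interior_convex_cone[OF _ D(1)] F unfolding cone_face_def by blast
  \<comment> \<open>an open cone \<open>cone_of B\<close> is never empty, so neither is the relative interior of \<open>F\<close>\<close>
  obtain B :: "(nat \<Rightarrow>\<^sub>0 real) matrix_alg" where B: "T_algebra B" "linearly_isomorphic (rel_interior F) (cone_of B)"
    using assms(4) unfolding has_cone_rank_def by blast
  obtain f where "f ` cone_core F = cone_of B" using B(2) unfolding ri linearly_isomorphic_def by blast
  moreover have "cone_of B \<noteq> {}" using t_algebra.E_I_cone[of B] B(1) unfolding t_algebra_def by blast
  ultimately obtain x where "x \<in> cone_core F" by blast
  then obtain g J where g: "g \<in> Tpos" and J: "J \<subseteq> I" and FJ: "F = face_set g J"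
    using face_normal_form[OF F] by blast
  have "s = card J"
    using has_cone_rank_unique[OF assms(4)] face_set_rank[OF assms(1) g J] unfolding FJ by blast
  moreover have card: "card J \<le> card I" by (rule card_mono[OF finite_I J])
  moreover have cI: "card I = r" using assms(2) by (simp add: indices_def)
  moreover have "has_cone_rank (conjugate_face A F) (r - card J)"
  proof -
    obtain h where h: "h \<in> Tpos" "h \<odot> g = E I" "g \<odot> h = E I" using inverse_exists[OF g] .
    note R = conjugate_face_reversed[OF g h J]
    have "flip ` (I - J) \<subseteq> indices (reversed A)" unfolding indices_reversed using flip(1) by blast
    from face_set_rank[OF T_algebra_reversed R(1) this]
    have "has_cone_rank (conjugate_face A F) (card (flip ` (I - J)))" unfolding FJ R(2) .
    moreover have "card (flip ` (I - J)) = card (I - J)"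
      using bij_flip by (intro card_image) (meson Diff_subset bij_betw_def inj_on_subset)
    moreover have "card (I - J) = r - card J"
      using card_Diff_subset[OF finite_subset[OF J finite_I] J] cI by simp
    ultimately show ?thesis by simp
  qed
  ultimately show ?thesis by simp
qed

end
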